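(* Let $G$ be a classical simple algebraic group ($SL_n$, $Sp_{2n}$ or $SO_n$) over an algebraically closed field of characteristic $p\ge 0$ with natural module $V$, and suppose $F$ is a finite subgroup of $G$ such that $C_G(F)^0$ is $G$-irreducible. Then $p\neq 2$ and $F$ is an elementary abelian $2$-group. Moreover, $G\ne SL_n$ and the following hold. (i) If $G=Sp_{2n}$, then $$C_G(F)^0=\prod_i Sp_{2n_i}=\prod_i Sp(W_i),$$ where $\sum n_i=n$ and the $W_i$ are the distinct weight spaces of $F$ on $V$. (ii) If $G=SO_n$, then $$C_G(F)^0=\prod_i SO_{n_i}=\prod_i SO(W_i),$$ where $n_i\ge 3$ for all $i$, $\sum n_i=n$ or $n-1$, and the $W_i$ are weight spaces of $F$.
   Context: A subgroup of a simple algebraic group $G$ is $G$-irreducible if it is not contained in any proper parabolic subgroup of $G$. $C_G(F)^0$ is the identity component of the centralizer. A weight space of the elementary abelian $2$-group $F$ on $V$ is a nonzero simultaneous eigenspace $\{v\in V: fv=\chi(f)v\ \forall f\in F\}$ for a character $\chi:F\to\{\pm1\}$.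
   Formalization: Two hypotheses are added because the claim fails without them: F is not central when G = SL_n (including Sp_2 = SL_2), and F is nontrivial when p = 2; for F = 1 the group C_G(F)^0 = G is G-irreducible, contradicting "G ≠ SL_n" and "p ≠ 2". *)

theory Defs
  imports "HOL-Analysis.Analysis" "HOL-Algebra.Solvable_Groups"
    "HOL-Computational_Algebra.Polynomial"
begin

section \<open>The Zariski topology on matrices\<close>

inductive poly_fun :: "('a::field ^ 'n ^ 'n \<Rightarrow> 'a) \<Rightarrow> bool" where
  const: "poly_fun (\<lambda>A. c)"
| entry: "poly_fun (\<lambda>A. A $ i $ j)"
| add: "poly_fun f \<Longrightarrow> poly_fun g \<Longrightarrow> poly_fun (\<lambda>A. f A + g A)"
| mult: "poly_fun f \<Longrightarrow> poly_fun g \<Longrightarrow> poly_fun (\<lambda>A. f A * g A)"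

definition zero_locus :: "('a::field ^ 'n ^ 'n \<Rightarrow> 'a) set \<Rightarrow> ('a ^ 'n ^ 'n) set" where
  "zero_locus P = {A. \<forall>f\<in>P. f A = 0}"

definition zariski_closed :: "('a::field ^ 'n ^ 'n) set \<Rightarrow> bool" where
  "zariski_closed S \<longleftrightarrow> (\<exists>P. Collect poly_fun \<supseteq> P \<and> S = zero_locus P)"

definition zariski :: "('a::field ^ 'n ^ 'n) topology" where
  "zariski = topology (\<lambda>U. zariski_closed (- U))"

lemma zariski_closed_Un:
  assumes "zariski_closed S" "zariski_closed T"
  shows "zariski_closed (S \<union> T)"
proof -
  obtain P Q where P: "\<forall>f\<in>P. poly_fun f" "S = zero_locus P"
    and Q: "\<forall>f\<in>Q. poly_fun f" "T = zero_locus Q"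
    using assms unfolding zariski_closed_def by blast
  define R where "R = (\<lambda>(f, g). \<lambda>A. f A * g A) ` (P \<times> Q)"
  have "\<forall>f\<in>R. poly_fun f"
    using P(1) Q(1) by (auto simp: R_def intro: poly_fun.mult)
  moreover have "S \<union> T = zero_locus R"
    unfolding P(2) Q(2) by (auto simp: R_def zero_locus_def)
  ultimately show ?thesis
    unfolding zariski_closed_def by blast
qed

lemma zariski_closed_Inter:
  assumes "\<forall>S\<in>\<S>. zariski_closed S"
  shows "zariski_closed (\<Inter>\<S>)"
proof -
  obtain P where P: "\<forall>S\<in>\<S>. (\<forall>f\<in>P S. poly_fun f) \<and> S = zero_locus (P S)"
    using assms unfolding zariski_closed_def by (metis mem_Collect_eq subsetD)
  have "\<Inter>\<S> = zero_locus (\<Union>S\<in>\<S>. P S)"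
    using P by (auto simp: zero_locus_def) blast
  moreover have "\<forall>f\<in>(\<Union>S\<in>\<S>. P S). poly_fun f"
    using P by blast
  ultimately show ?thesis
    unfolding zariski_closed_def by blast
qed

lemma istopology_zariski: "istopology (\<lambda>U::('a::field ^ 'n ^ 'n) set. zariski_closed (- U))"
proof -
  have "zariski_closed (- \<Union>\<K>)" if "\<forall>K\<in>\<K>. zariski_closed (- K)" for \<K> :: "('a ^ 'n ^ 'n) set set"
    using zariski_closed_Inter[of "uminus ` \<K>"] that by (simp add: uminus_Sup)
  then show ?thesis
    unfolding istopology_def by (simp add: zariski_closed_Un)
qed

lemma openin_zariski: "openin zariski U \<longleftrightarrow> zariski_closed (- U)"
  by (simp add: zariski_def istopology_zariski)

lemma topspace_zariski [simp]: "topspace zariski = UNIV"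
proof -
  have "zariski_closed (- (UNIV :: ('a ^ 'n ^ 'n) set))"
    unfolding zariski_closed_def zero_locus_def
    by (rule exI[of _ "{\<lambda>A. 1}"]) (auto intro: poly_fun.const)
  then show ?thesis
    by (metis openin_zariski openin_subset top.extremum_unique)
qed

lemma closedin_zariski: "closedin zariski S \<longleftrightarrow> zariski_closed S"
  by (simp add: closedin_def openin_zariski Compl_eq_Diff_UNIV[symmetric])


section \<open>Linear algebraic groups as sets of matrices\<close>

definition GL :: "('a::field ^ 'n ^ 'n) monoid" where
  "GL = \<lparr>carrier = {A. invertible A}, monoid.mult = (**), one = mat 1\<rparr>"

lemma group_GL: "group (GL :: ('a::field ^ 'n ^ 'n) monoid)"
proof (rule groupI)
  fix x :: "'a ^ 'n ^ 'n"
  assume "x \<in> carrier GL"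
  then obtain y where "x ** y = mat 1" "y ** x = mat 1"
    by (auto simp: GL_def invertible_def)
  then show "\<exists>y\<in>carrier GL. y \<otimes>\<^bsub>GL\<^esub> x = \<one>\<^bsub>GL\<^esub>"
    by (auto simp: GL_def invertible_def)
qed (auto simp: GL_def invertible_mult matrix_mul_assoc invertible_def[of "mat 1"])

definition identity_component :: "('a::field ^ 'n ^ 'n) set \<Rightarrow> ('a ^ 'n ^ 'n) set" where
  "identity_component H = connected_component_of_set (subtopology zariski H) (mat 1)"

definition centralizer :: "('a::field ^ 'n ^ 'n) set \<Rightarrow> ('a ^ 'n ^ 'n) set \<Rightarrow> ('a ^ 'n ^ 'n) set" where
  "centralizer G F = {g \<in> G. \<forall>f\<in>F. g ** f = f ** g}"

definition closed_subgroup :: "('a::field ^ 'n ^ 'n) set \<Rightarrow> ('a ^ 'n ^ 'n) set \<Rightarrow> bool" where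
  "closed_subgroup G H \<longleftrightarrow> H \<subseteq> G \<and> subgroup H GL \<and> closedin (subtopology zariski G) H"

definition connected_solvable :: "('a::field ^ 'n ^ 'n) set \<Rightarrow> ('a ^ 'n ^ 'n) set \<Rightarrow> bool" where
  "connected_solvable G H \<longleftrightarrow>
     closed_subgroup G H \<and> connectedin zariski H \<and> solvable (GL\<lparr>carrier := H\<rparr>)"

definition borel_subgroup :: "('a::field ^ 'n ^ 'n) set \<Rightarrow> ('a ^ 'n ^ 'n) set \<Rightarrow> bool" where
  "borel_subgroup G B \<longleftrightarrow>
     connected_solvable G B \<and> (\<forall>H. connected_solvable G H \<and> B \<subseteq> H \<longrightarrow> H = B)"

definition parabolic_subgroup :: "('a::field ^ 'n ^ 'n) set \<Rightarrow> ('a ^ 'n ^ 'n) set \<Rightarrow> bool" where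
  "parabolic_subgroup G P \<longleftrightarrow> closed_subgroup G P \<and> (\<exists>B. borel_subgroup G B \<and> B \<subseteq> P)"

definition irreducible_in :: "('a::field ^ 'n ^ 'n) set \<Rightarrow> ('a ^ 'n ^ 'n) set \<Rightarrow> bool" where
  "irreducible_in G H \<longleftrightarrow> \<not> (\<exists>P. parabolic_subgroup G P \<and> P \<noteq> G \<and> H \<subseteq> P)"

definition elementary_abelian_2 :: "('a::field ^ 'n ^ 'n) set \<Rightarrow> bool" where
  "elementary_abelian_2 F \<longleftrightarrow>
     comm_group (GL\<lparr>carrier := F\<rparr>) \<and> (\<forall>f\<in>F. f ** f = mat 1)"

text \<open>The subgroup \<open>H\<close> is the internal direct product of its subgroups \<open>S i\<close>, \<open>i \<in> I\<close>.\<close>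

definition internal_direct_product ::
    "('a::field ^ 'n ^ 'n) set \<Rightarrow> ('i \<Rightarrow> ('a ^ 'n ^ 'n) set) \<Rightarrow> 'i set \<Rightarrow> bool" where
  "internal_direct_product H S I \<longleftrightarrow>
     (\<forall>i\<in>I. subgroup (S i) GL) \<and>
     (\<forall>i\<in>I. \<forall>j\<in>I. i \<noteq> j \<longrightarrow> (\<forall>x\<in>S i. \<forall>y\<in>S j. x ** y = y ** x)) \<and>
     (\<forall>i\<in>I. S i \<inter> generate GL (\<Union>j\<in>I - {i}. S j) = {mat 1}) \<and>
     H = generate GL (\<Union>i\<in>I. S i)"


section \<open>Forms and classical groups\<close>

definition bilinear_form :: "('a::field ^ 'n \<Rightarrow> 'a ^ 'n \<Rightarrow> 'a) \<Rightarrow> bool" where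
  "bilinear_form b \<longleftrightarrow>
     (\<forall>x. Vector_Spaces.linear (*s) (*) (b x)) \<and>
     (\<forall>y. Vector_Spaces.linear (*s) (*) (\<lambda>x. b x y))"

definition nondegenerate_on :: "('a::field ^ 'n \<Rightarrow> 'a ^ 'n \<Rightarrow> 'a) \<Rightarrow> ('a ^ 'n) set \<Rightarrow> bool" where
  "nondegenerate_on b W \<longleftrightarrow> (\<forall>x\<in>W. (\<forall>y\<in>W. b x y = 0) \<longrightarrow> x = 0)"

definition symplectic_form :: "('a::field ^ 'n \<Rightarrow> 'a ^ 'n \<Rightarrow> 'a) \<Rightarrow> bool" where
  "symplectic_form b \<longleftrightarrow> bilinear_form b \<and> (\<forall>x. b x x = 0) \<and> nondegenerate_on b UNIV"

definition polar_form :: "('a::field ^ 'n \<Rightarrow> 'a) \<Rightarrow> 'a ^ 'n \<Rightarrow> 'a ^ 'n \<Rightarrow> 'a" where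
  "polar_form Q x y = Q (x + y) - Q x - Q y"

text \<open>The condition \<open>Q x \<noteq> 0\<close> for nonzero radical vectors, rather than a zero radical, admits
  the odd-dimensional forms in characteristic 2, whose polar form has a one-dimensional radical.
  Over an algebraically closed field the polar form is nondegenerate in all other cases.\<close>

definition nondegenerate_quadratic_on :: "('a::field ^ 'n \<Rightarrow> 'a) \<Rightarrow> ('a ^ 'n) set \<Rightarrow> bool" where
  "nondegenerate_quadratic_on Q W \<longleftrightarrow>
     (\<forall>x\<in>W. Q x = 0 \<and> (\<forall>y\<in>W. polar_form Q x y = 0) \<longrightarrow> x = 0)"

definition nondegenerate_quadratic_form :: "('a::field ^ 'n \<Rightarrow> 'a) \<Rightarrow> bool" where
  "nondegenerate_quadratic_form Q \<longleftrightarrow>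
     (\<forall>c x. Q (c *s x) = c\<^sup>2 * Q x) \<and> bilinear_form (polar_form Q) \<and>
     nondegenerate_quadratic_on Q UNIV"

definition SL :: "('a::field ^ 'n ^ 'n) set" where
  "SL = {g. det g = 1}"

definition Sp :: "('a::field ^ 'n \<Rightarrow> 'a ^ 'n \<Rightarrow> 'a) \<Rightarrow> ('a ^ 'n ^ 'n) set" where
  "Sp b = {g. invertible g \<and> (\<forall>x y. b (g *v x) (g *v y) = b x y)}"

definition GO :: "('a::field ^ 'n \<Rightarrow> 'a) \<Rightarrow> ('a ^ 'n ^ 'n) set" where
  "GO Q = {g. invertible g \<and> (\<forall>x. Q (g *v x) = Q x)}"

text \<open>In characteristic 2 every isometry has determinant 1, so the special orthogonal group is
  taken there, as usual for algebraic groups, to be the identity component of the full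
  isometry group.\<close>

definition SO :: "('a::field ^ 'n \<Rightarrow> 'a) \<Rightarrow> ('a ^ 'n ^ 'n) set" where
  "SO Q = (if CHAR('a) = 2 then identity_component (GO Q) else {g \<in> GO Q. det g = 1})"

text \<open>For a nondegenerate subspace \<open>W\<close>, the isometry group of \<open>W\<close> is regarded as a subgroup of
  that of the whole space, acting trivially on the orthogonal complement of \<open>W\<close>. Such isometries
  leave \<open>W\<close> invariant and have the same determinant as their restriction to \<open>W\<close>.\<close>

definition Sp_on :: "('a::field ^ 'n \<Rightarrow> 'a ^ 'n \<Rightarrow> 'a) \<Rightarrow> ('a ^ 'n) set \<Rightarrow> ('a ^ 'n ^ 'n) set" where
  "Sp_on b W = {g \<in> Sp b. \<forall>v. (\<forall>w\<in>W. b v w = 0) \<longrightarrow> g *v v = v}"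

text \<open>Used only in characteristic different from 2.\<close>

definition SO_on :: "('a::field ^ 'n \<Rightarrow> 'a) \<Rightarrow> ('a ^ 'n) set \<Rightarrow> ('a ^ 'n ^ 'n) set" where
  "SO_on Q W = {g \<in> SO Q. \<forall>v. (\<forall>w\<in>W. polar_form Q v w = 0) \<longrightarrow> g *v v = v}"

text \<open>The dimension bounds select the simple groups: \<open>SL\<^sub>1\<close>, \<open>SO\<^sub>1\<close>, \<open>SO\<^sub>2\<close> and \<open>SO\<^sub>4\<close> are not
  simple as algebraic groups.\<close>

definition is_SL :: "('a::field ^ 'n ^ 'n) set \<Rightarrow> bool" where
  "is_SL G \<longleftrightarrow> CARD('n) \<ge> 2 \<and> G = SL"

definition is_Sp :: "('a::field ^ 'n \<Rightarrow> 'a ^ 'n \<Rightarrow> 'a) \<Rightarrow> ('a ^ 'n ^ 'n) set \<Rightarrow> bool" where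
  "is_Sp b G \<longleftrightarrow> symplectic_form b \<and> G = Sp b"

definition is_SO :: "('a::field ^ 'n \<Rightarrow> 'a) \<Rightarrow> ('a ^ 'n ^ 'n) set \<Rightarrow> bool" where
  "is_SO Q G \<longleftrightarrow> CARD('n) \<ge> 3 \<and> CARD('n) \<noteq> 4 \<and> nondegenerate_quadratic_form Q \<and> G = SO Q"

definition classical_simple :: "('a::field ^ 'n ^ 'n) set \<Rightarrow> bool" where
  "classical_simple G \<longleftrightarrow> is_SL G \<or> (\<exists>b. is_Sp b G) \<or> (\<exists>Q. is_SO Q G)"


section \<open>Weight spaces\<close>

definition weight_space :: "('a::field ^ 'n ^ 'n) set \<Rightarrow> ('a ^ 'n ^ 'n \<Rightarrow> 'a) \<Rightarrow> ('a ^ 'n) set" where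
  "weight_space F \<phi> = {v. \<forall>f\<in>F. f *v v = \<phi> f *s v}"

definition weight_spaces :: "('a::field ^ 'n ^ 'n) set \<Rightarrow> ('a ^ 'n) set set" where
  "weight_spaces F =
     {W. \<exists>\<phi>. (\<forall>f\<in>F. \<phi> f \<in> {1, -1}) \<and> (\<forall>f\<in>F. \<forall>g\<in>F. \<phi> (f ** g) = \<phi> f * \<phi> g) \<and>
             W = weight_space F \<phi> \<and> W \<noteq> {0}}"

end

theory Submission
  imports Defs
begin

text \<open>
  By the Lie--Kolchin theorem, the identity component of the stabilizer of a full flag (isotropic in
  the symplectic and orthogonal cases) is a Borel subgroup, because a connected solvable group
  containing it fixes a flag of its own and Siegel transformations force the two flags to agree. Hence the
  stabilizer of a totally singular subspace is parabolic, and \<open>C = C\<^sub>G(F)\<^sup>0\<close> fixes no nonzero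
  totally singular subspace (no proper nonzero subspace at all if \<open>G\<close> is special linear).

  Eigenspaces of elements of \<open>F\<close> are stable under \<open>C\<close>, and so is the intersection of the kernel and
  the image of \<open>f\<^sup>2 - 1\<close>. The former are totally singular for eigenvalues other than 1 and -1, the latter
  is totally isotropic; so every element of \<open>F\<close> is an involution and the characteristic is not 2. (For
  orthogonal groups in characteristic 2, the remaining possibility that \<open>F\<close> contains a reflection
  is excluded with Dickson's invariant.) The weight spaces are then mutually orthogonal.
  \<open>Sp(W)\<close> is generated by transvections, and \<open>SO(W)\<close> by products of two reflections; both lie on
  rational curves through 1, so these groups are contained in \<open>C\<close>. Conversely, \<open>C\<close> acts on each weight
  space with determinant 1, by connectedness. A weight space of dimension 2, or two of dimension
  1, would give a singular line stable under \<open>C\<close>.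
\<close>

section \<open>Polynomial maps and connected sets\<close>

text \<open>Borel subgroups are given only as maximal connected solvable closed subgroups, so
  parabolicity of a stabilizer has to be won from maximality: an overgroup \<open>H\<close> is fed
  to Lie--Kolchin on successive quotients, and unipotent elements known to lie in \<open>H\<close>
  pin down the line that it fixes. Two obstacles shape this. In odd dimension and characteristic 2
  the polar form has a radical, so double orthogonals return a subspace plus the radical, and
  Lie--Kolchin is run modulo \<open>plus_radical V\<close>. In even orthogonal groups the last
  quotient can be a hyperbolic plane with two singular lines, and only connectedness prevents their
  exchange. Connectedness is used in two elementary ways: a quantity with finitely many candidate
  values, each defining a closed set, is constant; and a curve with rational coordinates is
  connected because a nonzero polynomial has finitely many roots. The premises
  \<open>SL_noncentral\<close> and \<open>char2_nontrivial\<close> exclude central \<open>F\<close>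
  in \<open>SL\<close> and trivial \<open>F\<close> in characteristic 2, where the centralizer is
  all of \<open>G\<close> and irreducibility says nothing.\<close>

lemma poly_fun_sum:
  assumes "\<And>i. i \<in> I \<Longrightarrow> poly_fun (f i)"
  shows "poly_fun (\<lambda>A. \<Sum>i\<in>I. f i A)"
  using assms
  by (induction I rule: infinite_finite_induct) (auto intro: poly_fun.intros)

lemma poly_fun_prod:
  assumes "\<And>i. i \<in> I \<Longrightarrow> poly_fun (f i)"
  shows "poly_fun (\<lambda>A. \<Prod>i\<in>I. f i A)"
  using assms
  by (induction I rule: infinite_finite_induct) (auto intro: poly_fun.intros)

lemma poly_fun_uminus: "poly_fun f \<Longrightarrow> poly_fun (\<lambda>A. - f A)"
  using poly_fun.mult[OF poly_fun.const[of "-1"], of f] by simp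

lemma poly_fun_diff: "poly_fun f \<Longrightarrow> poly_fun g \<Longrightarrow> poly_fun (\<lambda>A. f A - g A)"
  using poly_fun.add[OF _ poly_fun_uminus, of f g] by simp

lemma poly_fun_power: "poly_fun f \<Longrightarrow> poly_fun (\<lambda>A. f A ^ k)"
  by (induction k) (auto intro: poly_fun.intros)

lemmas poly_fun_intros =
  poly_fun.intros poly_fun_sum poly_fun_prod poly_fun_uminus poly_fun_diff poly_fun_power

definition poly_map :: "('a::field ^ 'n ^ 'n \<Rightarrow> 'a ^ 'n ^ 'n) \<Rightarrow> bool" where
  "poly_map \<phi> \<longleftrightarrow> (\<forall>i j. poly_fun (\<lambda>A. \<phi> A $ i $ j))"

lemma poly_fun_comp:
  assumes "poly_fun f" "poly_map \<phi>"
  shows "poly_fun (\<lambda>A. f (\<phi> A))"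
  using assms(1)
proof induction
  case (entry i j)
  then show ?case using assms(2) by (simp add: poly_map_def)
qed (auto intro: poly_fun.intros)

lemma poly_fun_det: "poly_map \<phi> \<Longrightarrow> poly_fun (\<lambda>A. det (\<phi> A))"
  unfolding det_def by (intro poly_fun_intros) (auto simp: poly_map_def)

lemma poly_map_id: "poly_map (\<lambda>A. A)"
  by (simp add: poly_map_def poly_fun.entry)

lemma poly_map_const: "poly_map (\<lambda>A. M)"
  by (simp add: poly_map_def poly_fun.const)

lemma poly_map_add: "poly_map \<phi> \<Longrightarrow> poly_map \<psi> \<Longrightarrow> poly_map (\<lambda>A. \<phi> A + \<psi> A)"
  by (simp add: poly_map_def poly_fun.add)

lemma poly_map_mult: "poly_map \<phi> \<Longrightarrow> poly_map \<psi> \<Longrightarrow> poly_map (\<lambda>A. \<phi> A ** \<psi> A)"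
  by (auto simp: poly_map_def matrix_matrix_mult_def intro!: poly_fun_intros)

lemma linear_functional_expand:
  fixes \<phi> :: "'a::field ^ 'n \<Rightarrow> 'a"
  assumes "Vector_Spaces.linear (*s) (*) \<phi>"
  shows "\<phi> x = (\<Sum>i\<in>UNIV. x $ i * \<phi> (axis i 1))"
proof -
  interpret Vector_Spaces.linear "(*s)" "(*)" \<phi> by fact
  have "\<phi> x = \<phi> (\<Sum>i\<in>UNIV. x $ i *s axis i 1)"
    by (simp add: basis_expansion)
  then show ?thesis by (simp add: sum scale)
qed

lemma poly_fun_functional:
  assumes "Vector_Spaces.linear (*s) (*) \<phi>"
  shows "poly_fun (\<lambda>A. \<phi> (A *v x))"
proof -
  have "(\<lambda>A. \<phi> (A *v x)) = (\<lambda>A. \<Sum>i\<in>UNIV. (\<Sum>j\<in>UNIV. A $ i $ j * x $ j) * \<phi> (axis i 1))"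
    by (subst linear_functional_expand[OF assms]) (simp add: matrix_vector_mult_def)
  then show ?thesis by (simp only:) (intro poly_fun_intros)
qed

lemma zariski_closed_zero: "poly_fun f \<Longrightarrow> zariski_closed {A. f A = 0}"
  unfolding zariski_closed_def zero_locus_def by (rule exI[of _ "{f}"]) auto

lemma zariski_closed_INT:
  assumes "\<And>i. i \<in> I \<Longrightarrow> zariski_closed (S i)"
  shows "zariski_closed (\<Inter>i\<in>I. S i)"
  using zariski_closed_Inter[of "S ` I"] assms by auto

lemma zariski_closed_vimage:
  assumes "zariski_closed S" "poly_map \<phi>"
  shows "zariski_closed (\<phi> -` S)"
proof -
  obtain P where P: "\<forall>f\<in>P. poly_fun f" "S = zero_locus P"
    using assms(1) unfolding zariski_closed_def by blast
  have "\<phi> -` S = (\<Inter>f\<in>P. {A. f (\<phi> A) = 0})"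
    using P by (auto simp: zero_locus_def)
  then show ?thesis
    using P(1) poly_fun_comp[OF _ assms(2)]
    by (auto intro!: zariski_closed_INT zariski_closed_zero)
qed

lemma continuous_map_poly:
  assumes "poly_map \<phi>"
  shows "continuous_map zariski zariski \<phi>"
  using zariski_closed_vimage[OF _ assms]
  by (auto simp: continuous_map_closedin closedin_zariski vimage_def)

lemma connectedin_poly_image:
  "connectedin zariski S \<Longrightarrow> poly_map \<phi> \<Longrightarrow> connectedin zariski (\<phi> ` S)"
  using connectedin_continuous_map_image continuous_map_poly by blast

lemma connectedin_zariski_two:
  assumes "connectedin zariski S" "zariski_closed Y" "zariski_closed Z" "S \<subseteq> Y \<union> Z"
    "S \<inter> Y \<inter> Z = {}" "S \<inter> Y \<noteq> {}"
  shows "S \<subseteq> Y"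
  using assms unfolding connectedin_closedin closedin_zariski by blast

lemma connectedin_zariskiI:
  assumes "\<And>Y Z. zariski_closed Y \<Longrightarrow> zariski_closed Z \<Longrightarrow> S \<subseteq> Y \<union> Z \<Longrightarrow> S \<inter> Y \<inter> Z = {} \<Longrightarrow>
    S \<inter> Y \<noteq> {} \<Longrightarrow> S \<inter> Z \<noteq> {} \<Longrightarrow> False"
  shows "connectedin zariski S"
  unfolding connectedin_closedin closedin_zariski using assms by (simp; blast)

lemma zariski_closed_empty: "zariski_closed {}"
  using closedin_empty closedin_zariski by blast

lemma zariski_closed_UN:
  assumes "finite I" "\<And>i. i \<in> I \<Longrightarrow> zariski_closed (S i)"
  shows "zariski_closed (\<Union>i\<in>I. S i)"
  using assms by (induction I rule: finite_induct) (auto intro: zariski_closed_empty zariski_closed_Un)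

text \<open>The union of the other finitely many pieces is closed, which reduces to two pieces. Used
  when a scalar attached to a group element has finitely many candidates and must keep its value at
  1.\<close>

lemma connectedin_zariski_finite:
  assumes S: "connectedin zariski S" and I: "finite I"
    and closed: "\<And>c. c \<in> I \<Longrightarrow> zariski_closed (Z c)"
    and cover: "S \<subseteq> (\<Union>c\<in>I. Z c)"
    and disj: "\<And>c d x. c \<in> I \<Longrightarrow> d \<in> I \<Longrightarrow> x \<in> S \<Longrightarrow> x \<in> Z c \<Longrightarrow> x \<in> Z d \<Longrightarrow> c = d"
    and c: "c \<in> I" "x \<in> S" "x \<in> Z c"
  shows "S \<subseteq> Z c"
proof (rule connectedin_zariski_two[OF S])
  show "zariski_closed (\<Union>d\<in>I-{c}. Z d)"
    using I closed by (intro zariski_closed_UN) auto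
  show "S \<subseteq> Z c \<union> (\<Union>d\<in>I-{c}. Z d)" using cover by blast
  show "S \<inter> Z c \<inter> (\<Union>d\<in>I-{c}. Z d) = {}" using disj c by blast
qed (use c closed in auto)

text \<open>Euclid's argument: over a finite field the product of all \<open>X - a\<close>, plus 1,
  is nonconstant without a root.\<close>

lemma infinite_UNIV_alg_closed: "infinite (UNIV :: 'a::alg_closed_field set)"
proof
  assume fin: "finite (UNIV :: 'a set)"
  define p :: "'a poly" where "p = (\<Prod>a\<in>UNIV. [:-a, 1:]) + 1"
  have deg: "degree (\<Prod>a\<in>(UNIV::'a set). [:-a, 1:]) = card (UNIV::'a set)"
    by (subst degree_prod_eq_sum_degree) auto
  have "card (UNIV::'a set) > 0" using fin by (simp add: card_gt_0_iff)
  then have "degree p > 0"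
    unfolding p_def using deg by (subst degree_add_eq_left) auto
  then obtain x where "poly p x = 0" using alg_closed_imp_poly_has_root by blast
  moreover have "poly p x = 1"
    unfolding p_def using fin by (simp add: poly_prod)
  ultimately show False by simp
qed

section \<open>Rational functions without poles and rational curves\<close>

definition rat_on :: "'a set \<Rightarrow> ('a::field \<Rightarrow> 'a) \<Rightarrow> bool" where
  "rat_on T g \<longleftrightarrow> (\<exists>p q. \<forall>t\<in>T. poly q t \<noteq> 0 \<and> g t = poly p t / poly q t)"

lemma rat_on_const: "rat_on T (\<lambda>t. c)"
  unfolding rat_on_def by (rule exI[of _ "[:c:]"], rule exI[of _ 1]) simp

lemma rat_on_id: "rat_on T (\<lambda>t. t)"
  unfolding rat_on_def by (rule exI[of _ "[:0,1:]"], rule exI[of _ 1]) simp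

lemma rat_on_add:
  assumes "rat_on T f" "rat_on T g" shows "rat_on T (\<lambda>t. f t + g t)"
proof -
  obtain p q r s where "\<forall>t\<in>T. poly q t \<noteq> 0 \<and> f t = poly p t / poly q t"
    "\<forall>t\<in>T. poly s t \<noteq> 0 \<and> g t = poly r t / poly s t"
    using assms unfolding rat_on_def by metis
  then show ?thesis unfolding rat_on_def
    by (intro exI[of _ "p * s + r * q"] exI[of _ "q * s"]) (auto simp: field_simps)
qed

lemma rat_on_mult:
  assumes "rat_on T f" "rat_on T g" shows "rat_on T (\<lambda>t. f t * g t)"
proof -
  obtain p q r s where "\<forall>t\<in>T. poly q t \<noteq> 0 \<and> f t = poly p t / poly q t"
    "\<forall>t\<in>T. poly s t \<noteq> 0 \<and> g t = poly r t / poly s t"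
    using assms unfolding rat_on_def by metis
  then show ?thesis unfolding rat_on_def
    by (intro exI[of _ "p * r"] exI[of _ "q * s"]) (auto simp: field_simps)
qed

lemma rat_on_uminus: "rat_on T f \<Longrightarrow> rat_on T (\<lambda>t. - f t)"
  using rat_on_mult[OF rat_on_const[of _ "-1"], of T f] by simp

lemma rat_on_diff: "rat_on T f \<Longrightarrow> rat_on T g \<Longrightarrow> rat_on T (\<lambda>t. f t - g t)"
  using rat_on_add[OF _ rat_on_uminus, of T f g] by simp

lemma rat_on_divide:
  assumes "rat_on T f" "rat_on T g" "\<And>t. t \<in> T \<Longrightarrow> g t \<noteq> 0" shows "rat_on T (\<lambda>t. f t / g t)"
proof -
  obtain p q r s where "\<forall>t\<in>T. poly q t \<noteq> 0 \<and> f t = poly p t / poly q t"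
    "\<forall>t\<in>T. poly s t \<noteq> 0 \<and> g t = poly r t / poly s t"
    using assms unfolding rat_on_def by metis
  then show ?thesis using assms(3) unfolding rat_on_def
    by (intro exI[of _ "p * s"] exI[of _ "q * r"]) (auto simp: field_simps)
qed

lemma rat_on_sum: "(\<And>i. i \<in> I \<Longrightarrow> rat_on T (f i)) \<Longrightarrow> rat_on T (\<lambda>t. \<Sum>i\<in>I. f i t)"
  by (induction I rule: infinite_finite_induct) (auto intro: rat_on_const rat_on_add)

lemmas rat_on_intros = rat_on_const rat_on_id rat_on_add rat_on_mult rat_on_uminus rat_on_diff
  rat_on_sum rat_on_divide

lemma rat_on_zeros:
  assumes "rat_on T f"
  shows "(\<forall>t\<in>T. f t = 0) \<or> finite {t\<in>T. f t = 0}"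
proof -
  obtain p q where pq: "\<forall>t\<in>T. poly q t \<noteq> 0 \<and> f t = poly p t / poly q t"
    using assms unfolding rat_on_def by metis
  show ?thesis
  proof (cases "p = 0")
    case False
    then have "finite {t. poly p t = 0}" by (rule poly_roots_finite)
    then have "finite {t\<in>T. f t = 0}" by (rule rev_finite_subset) (use pq in auto)
    then show ?thesis ..
  qed (use pq in auto)
qed

lemma rat_on_poly_fun:
  assumes "poly_fun f" "\<And>i j. rat_on T (\<lambda>t. \<gamma> t $ i $ j)"
  shows "rat_on T (\<lambda>t. f (\<gamma> t))"
  using assms by (induction) (auto intro: rat_on_intros)

text \<open>Along the curve a polynomial equation becomes a rational equation in the parameter,
  which has finitely many solutions unless it holds identically. Hence an infinite parameter set
  never splits into two proper closed pieces.\<close>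

lemma zariski_closed_curve:
  assumes "zariski_closed Z" "\<And>i j. rat_on T (\<lambda>t. \<gamma> t $ i $ j)"
  shows "(\<forall>t\<in>T. \<gamma> t \<in> Z) \<or> finite {t\<in>T. \<gamma> t \<in> Z}"
proof (cases "\<forall>t\<in>T. \<gamma> t \<in> Z")
  case False
  obtain P where P: "\<forall>f\<in>P. poly_fun f" "Z = zero_locus P"
    using assms(1) unfolding zariski_closed_def by blast
  obtain t f where "t \<in> T" "f \<in> P" "f (\<gamma> t) \<noteq> 0"
    using False P by (auto simp: zero_locus_def)
  then have "finite {t\<in>T. f (\<gamma> t) = 0}"
    using rat_on_zeros[OF rat_on_poly_fun[of f T \<gamma>]] P assms(2) by blast
  then have "finite {t\<in>T. \<gamma> t \<in> Z}"
    by (rule rev_finite_subset) (use P \<open>f \<in> P\<close> in \<open>auto simp: zero_locus_def\<close>)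
  then show ?thesis ..
qed simp

lemma connectedin_rational_curve:
  assumes "infinite T" "\<And>i j. rat_on T (\<lambda>t. \<gamma> t $ i $ j)"
  shows "connectedin zariski (\<gamma> ` T)"
proof (rule connectedin_zariskiI)
  fix Y Z assume *: "zariski_closed Y" "zariski_closed Z" "\<gamma> ` T \<subseteq> Y \<union> Z"
    "\<gamma> ` T \<inter> Y \<inter> Z = {}" "\<gamma> ` T \<inter> Y \<noteq> {}" "\<gamma> ` T \<inter> Z \<noteq> {}"
  then have "\<not> (\<forall>t\<in>T. \<gamma> t \<in> Y)" "\<not> (\<forall>t\<in>T. \<gamma> t \<in> Z)" by blast+
  then have "finite {t\<in>T. \<gamma> t \<in> Y}" "finite {t\<in>T. \<gamma> t \<in> Z}"
    using zariski_closed_curve[OF _ assms(2)] *(1,2) by blast+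
  moreover have "T \<subseteq> {t\<in>T. \<gamma> t \<in> Y} \<union> {t\<in>T. \<gamma> t \<in> Z}" using *(3) by auto
  ultimately show False using assms(1) finite_subset by blast
qed

text \<open>The determinant is a polynomial in the parameter without roots, hence constant.
  Unipotent curves get determinant 1 in this way without any computation.\<close>

lemma det_polynomial_curve_const:
  fixes \<gamma> :: "'a::alg_closed_field \<Rightarrow> 'a ^ 'n ^ 'n"
  assumes poly: "\<And>i j. \<exists>p. \<forall>t. \<gamma> t $ i $ j = poly p t"
    and nz: "\<And>t. det (\<gamma> t) \<noteq> 0"
  shows "det (\<gamma> t) = det (\<gamma> 0)"
proof -
  have "\<exists>p. \<forall>t. f (\<gamma> t) = poly p t" if "poly_fun f" for f
    using that
  proof induction
    case (const c)
    then show ?case by (rule_tac exI[of _ "[:c:]"]) simp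
  next
    case (add f g)
    then show ?case by (metis poly_add)
  next
    case (mult f g)
    then show ?case by (metis poly_mult)
  qed (use poly in blast)
  then obtain p where p: "\<And>t. det (\<gamma> t) = poly p t"
    using poly_fun_det[OF poly_map_id] by blast
  then have "degree p = 0"
    using nz alg_closed_imp_poly_has_root[of p] by force
  then show ?thesis unfolding p by (metis degree_eq_zeroE mult_zero_right poly_0 poly_pCons)
qed

text \<open>The regular functions on the general linear group: polynomials in the entries with the
  determinant inverted. The second argument stands for the inverse of the first, so that expressions
  with inverses can be written down before the denominator \<open>det A ^ k\<close> is
  cleared.\<close>

definition regular_fun :: "('a::field ^ 'n ^ 'n \<Rightarrow> 'a ^ 'n ^ 'n \<Rightarrow> 'a) \<Rightarrow> bool" where
  "regular_fun f \<longleftrightarrow>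
     (\<exists>r k. poly_fun r \<and> (\<forall>A B. A ** B = mat 1 \<longrightarrow> f A B * det A ^ k = r A))"

lemma regular_fun_poly: "poly_fun f \<Longrightarrow> regular_fun (\<lambda>A B. f A)"
  unfolding regular_fun_def by (intro exI[of _ f] exI[of _ 0]) auto

text \<open>Cramer's rule; the denominator is the first power of the determinant.\<close>

lemma regular_fun_inverse_entry:
  "regular_fun (\<lambda>(A :: 'a::field ^ 'n ^ 'n) B. B $ i $ j)"
proof -
  define r where "r = (\<lambda>A::'a^'n^'n. det (\<chi> k l. if l = i then (mat 1 :: 'a^'n^'n) $ k $ j else A $ k $ l))"
  have "poly_fun (\<lambda>A::'a^'n^'n. if l = i then (mat 1 :: 'a^'n^'n) $ k $ j else A $ k $ l)" for k l
    by (cases "l = i") (simp_all add: poly_fun.const poly_fun.entry)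
  then have "poly_fun r" unfolding r_def by (intro poly_fun_det) (simp add: poly_map_def)
  moreover have "B $ i $ j * det A ^ 1 = r A" if "A ** B = mat 1" for A B
  proof -
    have nz: "det A \<noteq> 0" using that by (metis det_I det_mul mult_zero_left zero_neq_one)
    have "A *v (column j B) = column j (mat 1)"
      by (simp add: that[symmetric] matrix_vector_mult_def matrix_matrix_mult_def column_def)
    then have "column j B = (\<chi> k. det (\<chi> i j'. if j' = k then column j (mat 1) $ i else A $ i $ j') / det A)"
      using cramer[OF nz] by blast
    then have "column j B $ i = r A / det A"
      by (simp add: r_def column_def cong: if_cong)
    then show ?thesis using nz by (simp add: column_def field_simps)
  qed
  ultimately show ?thesis unfolding regular_fun_def by blast
qed

lemma regular_fun_add:
  fixes f g :: "'a::field ^ 'n ^ 'n \<Rightarrow> 'a ^ 'n ^ 'n \<Rightarrow> 'a"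
  assumes "regular_fun f" "regular_fun g"
  shows "regular_fun (\<lambda>A B. f A B + g A B)"
proof -
  obtain r k s l where *: "poly_fun r" "poly_fun s"
    "\<And>A B. A ** B = mat 1 \<Longrightarrow> f A B * det A ^ k = r A"
    "\<And>A B. A ** B = mat 1 \<Longrightarrow> g A B * det A ^ l = s A"
    using assms unfolding regular_fun_def by metis
  show ?thesis
    unfolding regular_fun_def
  proof (intro exI conjI allI impI)
    show "poly_fun (\<lambda>A. r A * det A ^ l + s A * det A ^ k)"
      using * poly_fun_det[OF poly_map_id] by (intro poly_fun_intros)
    show "(f A B + g A B) * det A ^ (k + l) = r A * det A ^ l + s A * det A ^ k"
      if "A ** B = mat 1" for A B
      unfolding *(3)[OF that, symmetric] *(4)[OF that, symmetric] by (simp add: power_add algebra_simps)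
  qed
qed

lemma regular_fun_mult:
  fixes f g :: "'a::field ^ 'n ^ 'n \<Rightarrow> 'a ^ 'n ^ 'n \<Rightarrow> 'a"
  assumes "regular_fun f" "regular_fun g"
  shows "regular_fun (\<lambda>A B. f A B * g A B)"
proof -
  obtain r k s l where *: "poly_fun r" "poly_fun s"
    "\<And>A B. A ** B = mat 1 \<Longrightarrow> f A B * det A ^ k = r A"
    "\<And>A B. A ** B = mat 1 \<Longrightarrow> g A B * det A ^ l = s A"
    using assms unfolding regular_fun_def by metis
  show ?thesis
    unfolding regular_fun_def
  proof (intro exI conjI allI impI)
    show "poly_fun (\<lambda>A. r A * s A)"
      using * by (intro poly_fun_intros)
    show "(f A B * g A B) * det A ^ (k + l) = r A * s A"
      if "A ** B = mat 1" for A B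
      unfolding *(3)[OF that, symmetric] *(4)[OF that, symmetric] by (simp add: power_add algebra_simps)
  qed
qed

lemma regular_fun_sum:
  "(\<And>i. i \<in> I \<Longrightarrow> regular_fun (f i)) \<Longrightarrow> regular_fun (\<lambda>A B. \<Sum>i\<in>I. f i A B)"
proof (induction I rule: infinite_finite_induct)
  case (insert i I)
  have "regular_fun (\<lambda>A B. f i A B + (\<Sum>i\<in>I. f i A B))"
    by (rule regular_fun_add) (use insert in auto)
  then show ?case using insert.hyps by simp
next
  case empty
  show ?case unfolding sum.empty by (rule regular_fun_poly[OF poly_fun.const])
next
  case (infinite I)
  show ?case unfolding sum.infinite[OF infinite.hyps] by (rule regular_fun_poly[OF poly_fun.const])
qed

lemma regular_fun_comp:
  assumes "poly_fun f" "\<And>i j. regular_fun (\<lambda>A B. \<Phi> A B $ i $ j)"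
  shows "regular_fun (\<lambda>A B. f (\<Phi> A B))"
  using assms(1)
proof induction
  case (const c)
  show ?case by (rule regular_fun_poly[OF poly_fun.const])
next
  case (add f g)
  show ?case by (rule regular_fun_add[OF add.IH])
next
  case (mult f g)
  show ?case by (rule regular_fun_mult[OF mult.IH])
next
  case (entry i j)
  show ?case by (rule assms(2))
qed

text \<open>Inversion is not polynomial, so commutator maps escape
  \<open>connectedin_poly_image\<close>. As \<open>det A\<close> is nonzero on \<open>S\<close>, the
  equation \<open>f (\<Phi> A (\<iota> A)) = 0\<close> is equivalent there to a polynomial one, and
  closed sets still pull back to sets closed in \<open>S\<close>.\<close>

lemma connectedin_regular_image:
  fixes S :: "('a::field ^ 'n ^ 'n) set"
  assumes "connectedin zariski S" "\<And>A. A \<in> S \<Longrightarrow> A ** \<iota> A = mat 1"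
    and \<Phi>: "\<And>i j. regular_fun (\<lambda>A B. \<Phi> A B $ i $ j)"
  shows "connectedin zariski ((\<lambda>A. \<Phi> A (\<iota> A)) ` S)"
proof -
  have pull: "\<exists>Y. zariski_closed Y \<and> (\<forall>A\<in>S. A \<in> Y \<longleftrightarrow> \<Phi> A (\<iota> A) \<in> Z)" if Z: "zariski_closed Z" for Z
  proof -
    obtain P where P: "\<forall>f\<in>P. poly_fun f" "Z = zero_locus P"
      using Z unfolding zariski_closed_def by blast
    have ex: "\<exists>C. zariski_closed C \<and> (\<forall>A\<in>S. A \<in> C \<longleftrightarrow> f (\<Phi> A (\<iota> A)) = 0)" if "f \<in> P" for f
    proof -
      have "regular_fun (\<lambda>A B. f (\<Phi> A B))"
        by (rule regular_fun_comp[where f = f and \<Phi> = \<Phi>]) (use P(1) that \<Phi> in auto)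
      then obtain r k where r: "poly_fun r"
        "\<And>A B. A ** B = mat 1 \<Longrightarrow> f (\<Phi> A B) * det A ^ k = r A"
        unfolding regular_fun_def by blast
      have "r A = 0 \<longleftrightarrow> f (\<Phi> A (\<iota> A)) = 0" if "A \<in> S" for A
      proof -
        have "det A \<noteq> 0"
          using assms(2)[OF that] by (metis det_I det_mul mult_zero_left zero_neq_one)
        then show ?thesis
          unfolding r(2)[OF assms(2)[OF that], symmetric] by simp
      qed
      then show ?thesis
        using zariski_closed_zero[OF r(1)] by (intro exI[of _ "{A. r A = 0}"]) simp
    qed
    \<comment> \<open>All closed sets that cut out on \<open>S\<close> the zeros of some
      \<open>f\<close> in \<open>P\<close> are collected at once, which avoids choosing one for each
      \<open>f\<close>; only their trace on \<open>S\<close> matters.\<close>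
    define \<C> where "\<C> = {C. zariski_closed C \<and> (\<exists>f\<in>P. \<forall>A\<in>S. A \<in> C \<longleftrightarrow> f (\<Phi> A (\<iota> A)) = 0)}"
    have "zariski_closed (\<Inter>\<C>)"
      by (rule zariski_closed_Inter) (simp add: \<C>_def)
    moreover have "A \<in> \<Inter>\<C> \<longleftrightarrow> \<Phi> A (\<iota> A) \<in> Z" if A: "A \<in> S" for A
    proof
      assume L: "A \<in> \<Inter>\<C>"
      have "f (\<Phi> A (\<iota> A)) = 0" if f: "f \<in> P" for f
      proof -
        obtain C where C: "zariski_closed C" "\<forall>A\<in>S. A \<in> C \<longleftrightarrow> f (\<Phi> A (\<iota> A)) = 0"
          using ex[OF f] by auto
        then have "C \<in> \<C>" unfolding \<C>_def using f by auto
        then show ?thesis using C(2) A L by auto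
      qed
      then show "\<Phi> A (\<iota> A) \<in> Z" unfolding P(2) zero_locus_def by simp
    next
      assume "\<Phi> A (\<iota> A) \<in> Z"
      then show "A \<in> \<Inter>\<C>" unfolding P(2) zero_locus_def \<C>_def using A by auto
    qed
    ultimately show ?thesis by (intro exI[of _ "\<Inter>\<C>"]) simp
  qed
  let ?h = "\<lambda>A. \<Phi> A (\<iota> A)"
  show ?thesis
  proof (rule connectedin_zariskiI)
    fix Y Z assume *: "zariski_closed Y" "zariski_closed Z" "?h ` S \<subseteq> Y \<union> Z"
      "?h ` S \<inter> Y \<inter> Z = {}" "?h ` S \<inter> Y \<noteq> {}" "?h ` S \<inter> Z \<noteq> {}"
    obtain Y' where Y': "zariski_closed Y'" "\<forall>A\<in>S. A \<in> Y' \<longleftrightarrow> ?h A \<in> Y"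
      using pull[OF *(1)] by auto
    obtain Z' where Z': "zariski_closed Z'" "\<forall>A\<in>S. A \<in> Z' \<longleftrightarrow> ?h A \<in> Z"
      using pull[OF *(2)] by auto
    have "S \<subseteq> Y'"
    proof (rule connectedin_zariski_two[OF assms(1) Y'(1) Z'(1)])
      show "S \<subseteq> Y' \<union> Z'" using Y'(2) Z'(2) *(3) by auto
      show "S \<inter> Y' \<inter> Z' = {}" using Y'(2) Z'(2) *(4) by auto
      show "S \<inter> Y' \<noteq> {}" using Y'(2) *(5) by auto
    qed
    then have "?h ` S \<subseteq> Y" using Y'(2) by auto
    then show False using *(4,6) by auto
  qed
qed

section \<open>Subgroups and identity components\<close>

lemma subgroup_GL_iff:
  fixes H :: "('a::field ^ 'n ^ 'n) set"
  shows "subgroup H GL \<longleftrightarrow> mat 1 \<in> H \<and> (\<forall>A\<in>H. \<forall>B\<in>H. A ** B \<in> H) \<and>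
    (\<forall>A\<in>H. \<exists>B\<in>H. A ** B = mat 1 \<and> B ** A = mat 1)"
proof -
  interpret group "GL :: ('a ^ 'n ^ 'n) monoid" by (rule group_GL)
  have [simp]: "carrier (GL :: ('a ^ 'n ^ 'n) monoid) = {A. invertible A}"
    "(A :: 'a ^ 'n ^ 'n) \<otimes>\<^bsub>GL\<^esub> B = A ** B" "\<one>\<^bsub>GL\<^esub> = (mat 1 :: 'a ^ 'n ^ 'n)" for A B
    by (simp_all add: GL_def)
  show ?thesis
  proof
    assume H: "subgroup H GL"
    have "\<exists>B\<in>H. A ** B = mat 1 \<and> B ** A = mat 1" if "A \<in> H" for A
      using subgroup.m_inv_closed[OF H that] l_inv[of A] r_inv[of A] subgroup.mem_carrier[OF H that]
      by (intro bexI[of _ "inv\<^bsub>GL\<^esub> A"]) simp_all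
    then show "mat 1 \<in> H \<and> (\<forall>A\<in>H. \<forall>B\<in>H. A ** B \<in> H) \<and>
      (\<forall>A\<in>H. \<exists>B\<in>H. A ** B = mat 1 \<and> B ** A = mat 1)"
      using subgroup.one_closed[OF H] subgroup.m_closed[OF H] by simp
  next
    assume H: "mat 1 \<in> H \<and> (\<forall>A\<in>H. \<forall>B\<in>H. A ** B \<in> H) \<and>
      (\<forall>A\<in>H. \<exists>B\<in>H. A ** B = mat 1 \<and> B ** A = mat 1)"
    have inv: "H \<subseteq> {A. invertible A}"
    proof
      fix A assume "A \<in> H"
      then obtain B where "A ** B = mat 1" "B ** A = mat 1" using H by metis
      then show "A \<in> {A. invertible A}" unfolding invertible_def by auto
    qed
    show "subgroup H GL"
    proof (rule subgroupI)
      show "inv\<^bsub>GL\<^esub> A \<in> H" if A: "A \<in> H" for A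
      proof -
        obtain B where B: "B \<in> H" "A ** B = mat 1" "B ** A = mat 1" using H A by blast
        then have "inv\<^bsub>GL\<^esub> A = B" using inv A by (intro inv_equality) auto
        then show ?thesis using B by simp
      qed
    qed (use H inv in auto)
  qed
qed

lemma subgroup_GL_one: "subgroup H GL \<Longrightarrow> mat 1 \<in> H"
  and subgroup_GL_mult: "subgroup H GL \<Longrightarrow> A \<in> H \<Longrightarrow> B \<in> H \<Longrightarrow> A ** B \<in> H"
  and subgroup_GL_inverse: "subgroup H GL \<Longrightarrow> A \<in> H \<Longrightarrow> \<exists>B\<in>H. A ** B = mat 1 \<and> B ** A = mat 1"
  by (simp_all add: subgroup_GL_iff)

lemma GL_inv:
  fixes A B :: "'a::field ^ 'n ^ 'n"
  assumes "A ** B = mat 1" "B ** A = mat 1"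
  shows "inv\<^bsub>GL\<^esub> A = B"
proof -
  interpret group "GL :: ('a ^ 'n ^ 'n) monoid" by (rule group_GL)
  have "invertible A" "invertible B" using assms unfolding invertible_def by blast+
  then show ?thesis using assms by (intro inv_equality) (auto simp: GL_def)
qed

lemma mult_inverse_vector:
  fixes A B :: "'a::field ^ 'n ^ 'n"
  shows "A ** B = mat 1 \<Longrightarrow> A *v (B *v v) = v"
  by (simp add: matrix_vector_mul_assoc)

lemma identity_component_subset: "identity_component H \<subseteq> H"
  unfolding identity_component_def using connected_component_of_subset_topspace by fastforce

lemma connectedin_identity_component: "connectedin zariski (identity_component H)"
  unfolding identity_component_def
  using connectedin_connected_component_of[of "subtopology zariski H" "mat 1"]
  by (simp add: connectedin_subtopology)

lemma identity_component_one: "mat 1 \<in> H \<Longrightarrow> mat 1 \<in> identity_component H"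
  unfolding identity_component_def by (simp add: connected_component_of_refl)

lemma identity_component_maximal:
  "connectedin zariski K \<Longrightarrow> K \<subseteq> H \<Longrightarrow> mat 1 \<in> K \<Longrightarrow> K \<subseteq> identity_component H"
  unfolding identity_component_def
  by (rule connected_component_of_maximal) (simp_all add: connectedin_subtopology)

text \<open>The translate of \<open>K\<close> by \<open>g\<close> is connected and contains
  \<open>g\<close>, so its union with the component is connected and cannot be larger than the
  component.\<close>

lemma identity_component_mult:
  assumes H: "subgroup H GL" and g: "g \<in> identity_component H"
    and K: "connectedin zariski K" "K \<subseteq> H" "mat 1 \<in> K" and k: "k \<in> K"
  shows "g ** k \<in> identity_component H"
proof -
  have gH: "g \<in> H" using g identity_component_subset by blast
  have "connectedin zariski ((\<lambda>A. g ** A) ` K)"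
    using K(1) by (rule connectedin_poly_image) (intro poly_map_mult poly_map_const poly_map_id)
  moreover have g': "g \<in> (\<lambda>A. g ** A) ` K" using K(3) by (force intro: image_eqI[of _ _ "mat 1"])
  ultimately have "connectedin zariski (identity_component H \<union> (\<lambda>A. g ** A) ` K)"
    using g by (intro connectedin_Un connectedin_identity_component) blast+
  then have "identity_component H \<union> (\<lambda>A. g ** A) ` K \<subseteq> identity_component H"
    using identity_component_subset[of H] K(2) gH subgroup_GL_mult[OF H]
      identity_component_one[OF subgroup_GL_one[OF H]]
    by (intro identity_component_maximal) auto
  then show ?thesis using k by blast
qed

lemma subgroup_identity_component:
  assumes H: "subgroup H GL"
  shows "subgroup (identity_component H) GL"
  unfolding subgroup_GL_iff
proof (intro conjI ballI)
  show one: "mat 1 \<in> identity_component H"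
    by (rule identity_component_one[OF subgroup_GL_one[OF H]])
  show "A ** B \<in> identity_component H" if "A \<in> identity_component H" "B \<in> identity_component H" for A B
    by (rule identity_component_mult[OF H that(1) connectedin_identity_component identity_component_subset one that(2)])
  show "\<exists>B\<in>identity_component H. A ** B = mat 1 \<and> B ** A = mat 1" if A: "A \<in> identity_component H" for A
  proof -
    obtain B where B: "B \<in> H" "A ** B = mat 1" "B ** A = mat 1"
      using A identity_component_subset subgroup_GL_inverse[OF H] by blast
    \<comment> \<open>Left translation by the inverse \<open>B\<close> sends \<open>A\<close> to 1
      and 1 to \<open>B\<close>, so the translated component is connected, contains 1, and brings
      \<open>B\<close> with it.\<close>
    have "(\<lambda>C. B ** C) ` identity_component H \<subseteq> identity_component H"
    proof (rule identity_component_maximal)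
      show "connectedin zariski ((\<lambda>C. B ** C) ` identity_component H)"
        by (intro connectedin_poly_image connectedin_identity_component poly_map_mult poly_map_const poly_map_id)
      show "(\<lambda>C. B ** C) ` identity_component H \<subseteq> H"
        using identity_component_subset B(1) subgroup_GL_mult[OF H] by blast
      show "mat 1 \<in> (\<lambda>C. B ** C) ` identity_component H"
        using A B(3) by (metis image_eqI)
    qed
    then have "B \<in> identity_component H" using one by (metis image_subset_iff matrix_mul_rid)
    then show ?thesis using B by blast
  qed
qed

lemma closedin_identity_component:
  "closedin (subtopology zariski H) (identity_component H)"
  unfolding identity_component_def by (rule closedin_connected_component_of)

section \<open>Derived subgroups and solvability\<close>

lemma subgroup_derived:
  fixes H :: "('a::field ^ 'n ^ 'n) set"
  assumes "subgroup H GL"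
  shows "subgroup (derived GL H) GL" "derived GL H \<subseteq> H"
  using group.derived_is_subgroup[OF group_GL subgroup.subset[OF assms]]
    group.derived_incl[OF group_GL subset_refl assms] by blast+

lemma commutator_in_derived:
  assumes "x \<in> H" "y \<in> H" "x ** x' = mat 1" "x' ** x = mat 1" "y ** y' = mat 1" "y' ** y = mat 1"
  shows "x ** y ** x' ** y' \<in> derived GL H"
proof -
  have "x ** y ** x' ** y' = x \<otimes>\<^bsub>GL\<^esub> y \<otimes>\<^bsub>GL\<^esub> inv\<^bsub>GL\<^esub> x \<otimes>\<^bsub>GL\<^esub> inv\<^bsub>GL\<^esub> y"
    using GL_inv[OF assms(3,4)] GL_inv[OF assms(5,6)] by (simp add: GL_def)
  then show ?thesis
    unfolding derived_def using assms(1,2) by (intro generate.incl) blast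
qed

lemma derived_subsetI:
  fixes H K :: "('a::field ^ 'n ^ 'n) set"
  assumes H: "subgroup H GL" and K: "subgroup K GL"
    and comm: "\<And>x y x' y'. x \<in> H \<Longrightarrow> y \<in> H \<Longrightarrow> x' \<in> H \<Longrightarrow> y' \<in> H \<Longrightarrow> x ** x' = mat 1 \<Longrightarrow> x' ** x = mat 1 \<Longrightarrow>
      y ** y' = mat 1 \<Longrightarrow> y' ** y = mat 1 \<Longrightarrow> x ** y ** x' ** y' \<in> K"
  shows "derived GL H \<subseteq> K"
  unfolding derived_def
proof (rule group.generate_subgroup_incl[OF group_GL _ K], clarify)
  fix x y assume xy: "x \<in> H" "y \<in> H"
  obtain x' y' where *: "x' \<in> H" "x ** x' = mat 1" "x' ** x = mat 1"
    "y' \<in> H" "y ** y' = mat 1" "y' ** y = mat 1"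
    using xy subgroup_GL_inverse[OF H] by meson
  have "x \<otimes>\<^bsub>GL\<^esub> y \<otimes>\<^bsub>GL\<^esub> inv\<^bsub>GL\<^esub> x \<otimes>\<^bsub>GL\<^esub> inv\<^bsub>GL\<^esub> y = x ** y ** x' ** y'"
    using GL_inv[OF *(2,3)] GL_inv[OF *(5,6)] by (simp add: GL_def)
  then show "x \<otimes>\<^bsub>GL\<^esub> y \<otimes>\<^bsub>GL\<^esub> inv\<^bsub>GL\<^esub> x \<otimes>\<^bsub>GL\<^esub> inv\<^bsub>GL\<^esub> y \<in> K"
    using comm[OF xy *(1,4,2,3,5,6)] by simp
qed

text \<open>For fixed \<open>y\<close> the commutators \<open>x ** y ** x' ** y'\<close> form the
  image of the connected set \<open>H\<close> under a regular map sending 1 to 1, so they lie in the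
  identity component of the derived subgroup. That component is a subgroup, hence
  everything.\<close>

lemma connectedin_derived:
  fixes H :: "('a::field ^ 'n ^ 'n) set"
  assumes H: "subgroup H GL" and conn: "connectedin zariski H"
  shows "connectedin zariski (derived GL H)"
proof -
  let ?D = "derived GL H"
  have D: "subgroup ?D GL" using subgroup_derived[OF H] by blast
  obtain \<iota> where \<iota>: "\<And>A. A \<in> H \<Longrightarrow> \<iota> A \<in> H \<and> A ** \<iota> A = mat 1 \<and> \<iota> A ** A = mat 1"
    using subgroup_GL_inverse[OF H] by metis
  have "?D \<subseteq> identity_component ?D"
  proof (rule derived_subsetI[OF H subgroup_identity_component[OF D]])
    fix x y x' y' :: "'a ^ 'n ^ 'n" assume *: "x \<in> H" "y \<in> H" "x' \<in> H" "y' \<in> H" "x ** x' = mat 1" "x' ** x = mat 1"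
      "y ** y' = mat 1" "y' ** y = mat 1"
    define \<Phi> where "\<Phi> = (\<lambda>(A :: 'a ^ 'n ^ 'n) (B :: 'a ^ 'n ^ 'n). A ** y ** B ** y')"
    have reg: "regular_fun (\<lambda>A B. \<Phi> A B $ i $ j)" for i j
    proof -
      have *: "regular_fun (\<lambda>A B. \<Sum>k\<in>UNIV. (\<Sum>l\<in>UNIV. (A ** y) $ i $ l * B $ l $ k) * y' $ k $ j)"
        using poly_map_mult[OF poly_map_id poly_map_const, of y] unfolding poly_map_def
        by (intro regular_fun_sum regular_fun_mult[OF regular_fun_sum regular_fun_poly[OF poly_fun.const]]
            regular_fun_mult[OF regular_fun_poly regular_fun_inverse_entry]) simp
      have "\<Phi> A B $ i $ j = (\<Sum>k\<in>UNIV. (\<Sum>l\<in>UNIV. (A ** y) $ i $ l * B $ l $ k) * y' $ k $ j)" for A B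
        by (simp add: \<Phi>_def matrix_matrix_mult_def)
      with * show ?thesis by presburger
    qed
    have conn': "connectedin zariski ((\<lambda>A. \<Phi> A (\<iota> A)) ` H)"
      using connectedin_regular_image[OF conn _ reg] \<iota> by blast
    have "\<Phi> (mat 1) (\<iota> (mat 1)) = mat 1"
      using \<iota>[OF subgroup_GL_one[OF H]] * by (simp add: \<Phi>_def)
    then have "mat 1 \<in> (\<lambda>A. \<Phi> A (\<iota> A)) ` H" using subgroup_GL_one[OF H] by (metis image_eqI)
    moreover have "(\<lambda>A. \<Phi> A (\<iota> A)) ` H \<subseteq> ?D"
      using commutator_in_derived[of _ H y _ y'] \<iota> * by (auto simp: \<Phi>_def)
    ultimately have "(\<lambda>A. \<Phi> A (\<iota> A)) ` H \<subseteq> identity_component ?D"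
      using identity_component_maximal[OF conn'] by blast
    moreover have "\<iota> x = x'"
      using \<iota>[OF *(1)] *(5,6) by (metis matrix_mul_assoc matrix_mul_lid matrix_mul_rid)
    ultimately show "x ** y ** x' ** y' \<in> identity_component ?D"
      using *(1) unfolding \<Phi>_def by force
  qed
  then have "?D = identity_component ?D" using identity_component_subset by blast
  then show ?thesis using connectedin_identity_component by metis
qed

text \<open>Moves the derived series from the group with carrier \<open>H\<close> into
  \<open>GL\<close>, so that one ambient group serves for all its terms.\<close>

lemma solvable_GL_iff:
  fixes H :: "('a::field ^ 'n ^ 'n) set"
  assumes H: "subgroup H GL"
  shows "solvable (GL\<lparr>carrier := H\<rparr>) \<longleftrightarrow> (\<exists>n. (derived GL ^^ n) H = {mat 1})"
proof -
  have "group (GL\<lparr>carrier := H\<rparr>)" using H group_GL subgroup.subgroup_is_group by blast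
  note * = group.solvable_iff_trivial_derived_seq[OF this]
  have sub: "(derived GL ^^ n) H \<subseteq> H" for n
  proof (induction n)
    case (Suc n)
    then show ?case using group.derived_incl[OF group_GL _ H] by simp
  qed simp
  have "(derived (GL\<lparr>carrier := H\<rparr>) ^^ n) H = (derived GL ^^ n) H" for n
    by (induction n) (simp_all add: group.derived_consistent[OF group_GL sub H])
  then show ?thesis using * by (simp add: GL_def)
qed

section \<open>Eigenvectors modulo a subspace\<close>

definition stable :: "('a::field ^ 'n ^ 'n) set \<Rightarrow> ('a ^ 'n) set \<Rightarrow> bool" where
  "stable H U \<longleftrightarrow> (\<forall>h\<in>H. \<forall>u\<in>U. h *v u \<in> U)"

lemma stableD: "stable H U \<Longrightarrow> h \<in> H \<Longrightarrow> u \<in> U \<Longrightarrow> h *v u \<in> U"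
  by (simp add: stable_def)

lemma stable_subset: "stable H U \<Longrightarrow> K \<subseteq> H \<Longrightarrow> stable K U"
  by (auto simp: stable_def)

lemma functional_separating:
  fixes U :: "('a::field ^ 'n) set"
  assumes U: "vec.subspace U" and w: "w \<notin> U"
  obtains \<phi> where "Vector_Spaces.linear (*s) (*) \<phi>" "\<And>u. u \<in> U \<Longrightarrow> \<phi> u = 0" "\<phi> w = 1"
proof -
  interpret P: vector_space_pair "(*s) :: 'a \<Rightarrow> 'a ^ 'n \<Rightarrow> 'a ^ 'n" "(*) :: 'a \<Rightarrow> 'a \<Rightarrow> 'a" ..
  obtain B where B: "B \<subseteq> U" "vec.independent B" "U \<subseteq> vec.span B"
    using vec.basis_exists by metis
  have "vec.span B = U" using B U by (meson vec.span_minimal subset_antisym)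
  then have ind: "vec.independent (insert w B)"
    using B w by (simp add: vec.independent_insert)
  define f where "f = (\<lambda>x. if x = w then 1 else 0 :: 'a)"
  obtain \<phi> where \<phi>: "Vector_Spaces.linear (*s) (*) \<phi>" "\<forall>x\<in>insert w B. \<phi> x = f x"
    using P.linear_independent_extend[OF ind] by blast
  interpret \<phi>: Vector_Spaces.linear "(*s)" "(*)" \<phi> by (rule \<phi>(1))
  have "w \<notin> B" using B w by blast
  then have "\<phi> x = 0" if "x \<in> B" for x using \<phi>(2) that by (auto simp: f_def)
  then have "\<phi> u = 0" if "u \<in> U" for u
    using \<phi>.eq_0_on_span that B(3) by blast
  then show ?thesis using that[OF \<phi>(1)] \<phi>(2) by (simp add: f_def)
qed

text \<open>A subspace is cut out by the linear functionals vanishing on it, each of which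
  contributes one polynomial equation in the entries.\<close>

lemma zariski_closed_maps_to:
  fixes v :: "'a::field ^ 'n"
  assumes U: "vec.subspace U" and \<psi>: "poly_map \<psi>"
  shows "zariski_closed {A. \<psi> A *v v \<in> U}"
proof -
  let ?\<Phi> = "{\<phi>. Vector_Spaces.linear (*s) (*) \<phi> \<and> (\<forall>u\<in>U. \<phi> u = 0)}"
  have "{A. \<psi> A *v v \<in> U} = (\<Inter>\<phi>\<in>?\<Phi>. {A. \<phi> (\<psi> A *v v) = 0})" (is "?L = ?R")
  proof
    show "?R \<subseteq> ?L"
    proof
      fix A assume A: "A \<in> ?R"
      show "A \<in> ?L"
      proof (rule ccontr)
        assume "A \<notin> ?L"
        then have nin: "\<psi> A *v v \<notin> U" by simp
        obtain \<phi> where "Vector_Spaces.linear (*s) (*) \<phi>" "\<And>u. u \<in> U \<Longrightarrow> \<phi> u = 0" "\<phi> (\<psi> A *v v) = 1"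
          using functional_separating[OF U nin] by blast
        then show False using A by auto
      qed
    qed
  qed auto
  moreover have "zariski_closed ?R"
  proof (intro zariski_closed_INT zariski_closed_zero)
    fix \<phi> assume "\<phi> \<in> ?\<Phi>"
    then have "poly_fun (\<lambda>A. \<phi> (A *v v))" by (intro poly_fun_functional) simp
    from poly_fun_comp[OF this \<psi>] show "poly_fun (\<lambda>A. \<phi> (\<psi> A *v v))" .
  qed
  ultimately show ?thesis by simp
qed

lemma zariski_closed_stabilizer:
  fixes U :: "('a::field ^ 'n) set"
  assumes "vec.subspace U"
  shows "zariski_closed {A. \<forall>u\<in>U. A *v u \<in> U}"
proof -
  have "zariski_closed (\<Inter>u\<in>U. {A. A *v u \<in> U})"
    by (intro zariski_closed_INT zariski_closed_maps_to[OF assms poly_map_id])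
  then show ?thesis by (simp add: Collect_ball_eq)
qed

section \<open>Polynomials in a matrix applied to vectors, by Horner's scheme\<close>

definition peval :: "'a::field poly \<Rightarrow> 'a ^ 'n ^ 'n \<Rightarrow> 'a ^ 'n \<Rightarrow> 'a ^ 'n" where
  "peval p A v = fold_coeffs (\<lambda>a w. a *s v + A *v w) p 0"

lemma peval_0 [simp]: "peval 0 A v = 0"
  by (simp add: peval_def)

lemma peval_pCons [simp]: "peval (pCons a p) A v = a *s v + A *v peval p A v"
  by (cases "p = 0"; cases "a = 0") (simp_all add: peval_def)

lemma peval_add: "peval (p + q) A v = peval p A v + peval q A v"
proof (induction p arbitrary: q)
  case (pCons a p)
  then show ?case
    by (cases q) (simp add: matrix_vector_right_distrib vec.scale_left_distrib)
qed simp

lemma peval_smult: "peval (smult c p) A v = c *s peval p A v"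
  by (induction p) (simp_all add: vec.scale_right_distrib vector_scalar_commute)

lemma peval_mult: "peval (p * q) A v = peval p A (peval q A v)"
  by (induction p) (simp_all add: peval_add peval_smult)

lemma peval_zero_vec [simp]: "peval p A 0 = 0"
  by (induction p) simp_all

lemma peval_vec_add: "peval p A (v + w) = peval p A v + peval p A w"
  by (induction p) (simp_all add: matrix_vector_right_distrib vec.scale_right_distrib)

lemma peval_vec_scale: "peval p A (c *s v) = c *s peval p A v"
  by (induction p)
    (simp_all add: vector_scalar_commute vec.scale_right_distrib mult.commute)

lemma peval_stable:
  assumes "vec.subspace U" "\<And>u. u \<in> U \<Longrightarrow> A *v u \<in> U" "v \<in> U"
  shows "peval p A v \<in> U"
  by (induction p) (use assms in \<open>simp_all add: vec.subspace_0 vec.subspace_add vec.subspace_scale\<close>)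

lemma peval_eigenvector:
  assumes W: "vec.subspace W" "\<And>w. w \<in> W \<Longrightarrow> A *v w \<in> W" and v: "A *v v - c *s v \<in> W"
  shows "peval p A v - poly p c *s v \<in> W"
proof (induction p)
  case (pCons a p)
  have eq: "peval (pCons a p) A v - poly (pCons a p) c *s v
      = A *v (peval p A v - poly p c *s v) + poly p c *s (A *v v - c *s v)"
    by (simp add: matrix_vector_mult_diff_distrib vector_scalar_commute algebra_simps
        vec.scale_right_diff_distrib vec.scale_left_distrib)
  show ?case
    unfolding eq by (intro vec.subspace_add[OF W(1)] W(2) pCons.IH vec.subspace_scale[OF W(1)] v)
qed (simp add: vec.subspace_0[OF W(1)])

text \<open>If no nonzero polynomial kills \<open>v\<close>, the iterates of \<open>A\<close> on
  \<open>v\<close> are independent at every length, which eventually exceeds the dimension.\<close>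

lemma annihilating_polynomial_vector:
  fixes A :: "'a::field ^ 'n ^ 'n"
  shows "\<exists>p. p \<noteq> 0 \<and> peval p A v = 0"
proof (rule ccontr)
  assume none: "\<not> ?thesis"
  define x where "x i = peval (monom 1 i) A v" for i
  have span: "w \<in> vec.span (x ` {..<k}) \<Longrightarrow> \<exists>q. (degree q < k \<or> q = 0) \<and> w = peval q A v" for k w
  proof (induction rule: vec.span_induct_alt)
    case base
    show ?case by (rule exI[of _ 0]) simp
  next
    case (step c y z)
    then obtain q i where q: "degree q < k \<or> q = 0" "z = peval q A v" "i < k" "y = x i" by auto
    have "degree (smult c (monom 1 i) + q) < k"
      using q by (intro degree_add_less) (auto intro!: le_less_trans[OF degree_smult_le] le_less_trans[OF degree_monom_le])
    then show ?case using q
      by (intro exI[of _ "smult c (monom 1 i) + q"]) (simp add: peval_add peval_smult x_def)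
  qed
  have "vec.independent (x ` {..<k}) \<and> card (x ` {..<k}) = k" for k
  proof (induction k)
    case (Suc k)
    have nspan: "x k \<notin> vec.span (x ` {..<k})"
    proof
      assume "x k \<in> vec.span (x ` {..<k})"
      then obtain q where q: "degree q < k \<or> q = 0" "x k = peval q A v" using span by blast
      have "peval (monom 1 k + smult (-1) q) A v = 0"
        using q(2) unfolding peval_add peval_smult x_def by simp
      then have "monom 1 k + smult (-1) q = 0" using none by blast
      then have "q = monom 1 k" by simp
      then show False using q(1) by (simp add: degree_monom_eq)
    qed
    then have "x k \<notin> x ` {..<k}" by (metis vec.span_base)
    moreover have "vec.independent (insert (x k) (x ` {..<k}))"
      using Suc nspan by (intro vec.independent_insertI) auto
    ultimately show ?case using Suc unfolding lessThan_Suc image_insert by simp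
  qed (simp add: vec.independent_empty)
  note * = this[of "Suc (vec.dim (UNIV :: ('a ^ 'n) set))"]
  have "card (x ` {..<Suc (vec.dim (UNIV :: ('a ^ 'n) set))}) \<le> vec.dim (UNIV :: ('a ^ 'n) set)"
    using * by (intro vec.independent_card_le_dim) auto
  then show False using * by simp
qed

text \<open>Annihilators of the finitely many basis vectors are multiplied together, which works
  because polynomials in one matrix commute. This takes the place of the Cayley--Hamilton
  theorem.\<close>

lemma annihilating_polynomial:
  fixes A :: "'a::field ^ 'n ^ 'n"
  obtains p where "p \<noteq> 0" "\<And>v. peval p A v = 0"
proof -
  have "\<exists>p. p \<noteq> 0 \<and> (\<forall>v\<in>S. peval p A v = 0)" if "finite S" for S :: "('a ^ 'n) set"
    using that
  proof induction
    case empty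
    show ?case by (rule exI[of _ 1]) simp
  next
    case (insert v S)
    obtain p where p: "p \<noteq> 0" "\<forall>v\<in>S. peval p A v = 0" using insert.IH by blast
    obtain q where q: "q \<noteq> 0" "peval q A v = 0" using annihilating_polynomial_vector by blast
    have "peval (q * p) A v = 0"
      using q(2) by (simp add: mult.commute[of q] peval_mult)
    then show ?case
      by (intro exI[of _ "q * p"])
        (use p q in \<open>auto simp: peval_mult\<close>)
  qed
  from this[OF vec.finite_Basis] obtain p where p: "p \<noteq> 0" "\<forall>v\<in>cart_basis. peval p A v = 0"
    by blast
  have "vec.span cart_basis \<subseteq> {v. peval p A v = 0}"
    by (rule vec.span_minimal)
      (use p in \<open>auto simp: vec.subspace_def peval_vec_add peval_vec_scale\<close>)
  then show ?thesis using that[OF p(1)] vec.span_Basis by auto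
qed

text \<open>The roots of one annihilating polynomial of \<open>A\<close> contain its eigenvalues on
  the quotient by every stable \<open>W\<close> at once.\<close>

lemma finite_eigenvalues:
  fixes A :: "'a::field ^ 'n ^ 'n"
  obtains C where "finite C"
    "\<And>W v c. vec.subspace W \<Longrightarrow> (\<And>w. w \<in> W \<Longrightarrow> A *v w \<in> W) \<Longrightarrow> v \<notin> W \<Longrightarrow> A *v v - c *s v \<in> W \<Longrightarrow> c \<in> C"
proof -
  obtain p where p: "p \<noteq> 0" "\<And>v. peval p A v = 0" using annihilating_polynomial by blast
  have "c \<in> {c. poly p c = 0}"
    if "vec.subspace W" "\<And>w. w \<in> W \<Longrightarrow> A *v w \<in> W" "v \<notin> W" "A *v v - c *s v \<in> W" for W v c
  proof (rule ccontr)
    assume nz: "c \<notin> {c. poly p c = 0}"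
    have "poly p c *s v \<in> W"
      using peval_eigenvector[OF that(1,2,4), of p] p(2) vec.subspace_neg[OF that(1)] by fastforce
    then have "inverse (poly p c) *s (poly p c *s v) \<in> W" by (rule vec.subspace_scale[OF that(1)])
    then show False using nz that(3) by simp
  qed
  then show ?thesis using that[of "{c. poly p c = 0}"] poly_roots_finite[OF p(1)] by blast
qed

text \<open>Linear factors are stripped off an annihilating polynomial until the remaining factor
  takes \<open>v\<close> outside \<open>W\<close> while the factor just removed brings it back; that
  value is the eigenvector.\<close>

lemma eigenvector_mod:
  fixes A :: "'a::alg_closed_field ^ 'n ^ 'n"
  assumes X: "vec.subspace X" "\<And>x. x \<in> X \<Longrightarrow> A *v x \<in> X"
    and W: "vec.subspace W" and v0: "v0 \<in> X" "v0 \<notin> W"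
  obtains v c where "v \<in> X" "v \<notin> W" "A *v v - c *s v \<in> W"
proof -
  have main: "\<exists>v c. v \<in> X \<and> v \<notin> W \<and> A *v v - c *s v \<in> W"
    if "p \<noteq> 0" "v \<in> X" "v \<notin> W" "peval p A v \<in> W" for p v
    using that
  proof (induction "degree p" arbitrary: p)
    case 0
    then obtain a where a: "p = [:a:]" by (metis degree_eq_zeroE)
    then have "a *s v \<in> W" "a \<noteq> 0" using 0 by simp_all
    then have "inverse a *s (a *s v) \<in> W" using vec.subspace_scale[OF W] by blast
    then show ?case using 0 \<open>a \<noteq> 0\<close> by simp
  next
    case (Suc n)
    obtain c where "poly p c = 0"
      using Suc.hyps(2) alg_closed_imp_poly_has_root[of p] by auto
    then obtain q where q: "p = [:-c, 1:] * q" using poly_eq_0_iff_dvd by blast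
    then have q0: "q \<noteq> 0" using Suc.prems by auto
    then have "degree q = n" using Suc.hyps(2) unfolding q by (subst (asm) degree_mult_eq) auto
    show ?case
    proof (cases "peval q A v \<in> W")
      case True
      then show ?thesis using Suc.hyps(1)[of q] \<open>degree q = n\<close> q0 Suc.prems by blast
    next
      case False
      have "peval p A v = A *v peval q A v - c *s peval q A v"
        unfolding q peval_mult by simp
      then have "A *v peval q A v - c *s peval q A v \<in> W" using Suc.prems by simp
      moreover have "peval q A v \<in> X" using peval_stable[OF X] Suc.prems by blast
      ultimately show ?thesis using False by blast
    qed
  qed
  obtain p where p: "p \<noteq> 0" "\<And>v. peval p A v = 0" using annihilating_polynomial by blast
  then show ?thesis using main[OF p(1) v0] vec.subspace_0[OF W] that by auto
qed

section \<open>Lie--Kolchin modulo a subspace\<close>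

lemma subspace_scale_cancel:
  fixes v :: "'a::field ^ 'n"
  assumes "vec.subspace W" "a *s v \<in> W" "a \<noteq> 0"
  shows "v \<in> W"
proof -
  have "inverse a *s (a *s v) \<in> W" by (rule vec.subspace_scale[OF assms(1,2)])
  then show ?thesis unfolding vec.scale_scale using assms(3) by simp
qed

lemma mat_mult_vector:
  fixes x :: "'a::comm_semiring_1 ^ 'n"
  shows "mat c *v x = c *s x"
proof -
  have "(\<Sum>j\<in>UNIV. (if i = j then c else 0) * x $ j) = (\<Sum>j\<in>UNIV. if i = j then c * x $ j else 0)" for i
    by (rule sum.cong) auto
  then show ?thesis by (simp add: vec_eq_iff matrix_vector_mult_def mat_def)
qed

lemma stable_cancel:
  assumes "subgroup H GL" "stable H W" "g \<in> H" "g *v v \<in> W"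
  shows "v \<in> W"
proof -
  obtain B where "B \<in> H" "B ** g = mat 1" using subgroup_GL_inverse[OF assms(1,3)] by blast
  then show ?thesis using stableD[OF assms(2) _ assms(4), of B] by (simp add: mult_inverse_vector)
qed

lemma matrix_scale_diff:
  fixes A :: "'a::field ^ 'n ^ 'n"
  shows "A *v (v - c *s w) = A *v v - c *s (A *v w)"
  by (simp add: matrix_vector_mult_diff_distrib vector_scalar_commute)

lemma subspace_eigenspace_mod:
  assumes "vec.subspace X" "vec.subspace W"
  shows "vec.subspace {v \<in> X. h *v v - c *s v \<in> W}"
proof (rule vec.subspaceI)
  show "0 \<in> {v \<in> X. h *v v - c *s v \<in> W}"
    using assms by (simp add: vec.subspace_0)
  fix x y a assume x: "x \<in> {v \<in> X. h *v v - c *s v \<in> W}"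
  have eq: "h *v (a *s x) - c *s (a *s x) = a *s (h *v x - c *s x)"
    by (simp add: vector_scalar_commute vec.scale_right_diff_distrib mult.commute)
  have "h *v (a *s x) - c *s (a *s x) \<in> W"
    unfolding eq using x by (intro vec.subspace_scale[OF assms(2)]) simp
  then show "a *s x \<in> {v \<in> X. h *v v - c *s v \<in> W}"
    using x assms by (simp add: vec.subspace_scale)
  assume y: "y \<in> {v \<in> X. h *v v - c *s v \<in> W}"
  have eq: "h *v (x + y) - c *s (x + y) = (h *v x - c *s x) + (h *v y - c *s y)"
    by (simp add: matrix_vector_right_distrib vec.scale_right_distrib)
  have "h *v (x + y) - c *s (x + y) \<in> W"
    unfolding eq using x y by (intro vec.subspace_add[OF assms(2)]) auto
  then show "x + y \<in> {v \<in> X. h *v v - c *s v \<in> W}"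
    using x y assms by (simp add: vec.subspace_add)
qed

text \<open>If some \<open>h\<close> is not a scalar modulo \<open>W\<close>, its eigenspace modulo
  \<open>W\<close> is smaller than \<open>X\<close>, still strictly larger than \<open>W\<close>,
  and stable because everything commutes with \<open>h\<close> modulo \<open>W\<close>; the
  induction descends to it.\<close>

lemma commuting_common_eigenvector:
  fixes H :: "('a::alg_closed_field ^ 'n ^ 'n) set"
  assumes X: "vec.subspace X" "stable H X" and W: "vec.subspace W" "stable H W" "W \<subseteq> X" "W \<noteq> X"
    and comm: "\<And>x y v. x \<in> H \<Longrightarrow> y \<in> H \<Longrightarrow> v \<in> X \<Longrightarrow> x *v (y *v v) - y *v (x *v v) \<in> W"
  shows "\<exists>v. v \<in> X \<and> v \<notin> W \<and> (\<forall>h\<in>H. \<exists>c. h *v v - c *s v \<in> W)"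
  using X W(3,4) comm
proof (induction "vec.dim X" arbitrary: X rule: less_induct)
  case less
  obtain v0 where v0: "v0 \<in> X" "v0 \<notin> W" using less.prems by blast
  show ?case
  proof (cases "\<forall>h\<in>H. \<exists>c. \<forall>v\<in>X. h *v v - c *s v \<in> W")
    case True
    then show ?thesis using v0 by blast
  next
    case False
    then obtain h where h: "h \<in> H" "\<not> (\<exists>c. \<forall>v\<in>X. h *v v - c *s v \<in> W)" by blast
    obtain v1 c where v1: "v1 \<in> X" "v1 \<notin> W" "h *v v1 - c *s v1 \<in> W"
      using eigenvector_mod[OF less.prems(1) stableD[OF less.prems(2) h(1)] W(1) v0] by blast
    define X1 where "X1 = {v\<in>X. h *v v - c *s v \<in> W}"
    have sub: "vec.subspace X1"
      unfolding X1_def by (rule subspace_eigenspace_mod[OF less.prems(1) W(1)])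
    have X1X: "X1 \<subset> X" using h(2) unfolding X1_def by blast
    have "vec.dim X1 < vec.dim X"
    proof (rule vec.dim_psubset)
      show "vec.span X1 \<subset> vec.span X"
        unfolding vec.span_eq_iff[THEN iffD2, OF sub] vec.span_eq_iff[THEN iffD2, OF less.prems(1)]
        by (rule X1X)
    qed
    moreover have "stable H X1"
      unfolding stable_def
    proof (intro ballI)
      fix g v assume gv: "g \<in> H" "v \<in> X1"
      then have v: "v \<in> X" "h *v v - c *s v \<in> W" by (auto simp: X1_def)
      have "h *v (g *v v) - g *v (h *v v) \<in> W" using less.prems(5)[OF h(1) gv(1) v(1)] .
      moreover have "g *v (h *v v - c *s v) \<in> W" using stableD[OF W(2) gv(1) v(2)] .
      ultimately have "(h *v (g *v v) - g *v (h *v v)) + g *v (h *v v - c *s v) \<in> W"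
        by (rule vec.subspace_add[OF W(1)])
      then have "h *v (g *v v) - c *s (g *v v) \<in> W" by (simp add: matrix_scale_diff)
      then show "g *v v \<in> X1" using stableD[OF less.prems(2) gv(1) v(1)] by (simp add: X1_def)
    qed
    moreover have "W \<subseteq> X1"
    proof
      fix w assume w: "w \<in> W"
      have "h *v w - c *s w \<in> W"
        by (intro vec.subspace_diff[OF W(1)] vec.subspace_scale[OF W(1)] w stableD[OF W(2) h(1)])
      then show "w \<in> X1" using w less.prems(3) by (auto simp: X1_def)
    qed
    moreover have "W \<noteq> X1" using v1 by (auto simp: X1_def)
    ultimately have "\<exists>v. v \<in> X1 \<and> v \<notin> W \<and> (\<forall>h\<in>H. \<exists>c. h *v v - c *s v \<in> W)"
      using less.prems(5) X1X by (intro less.hyps sub) auto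
    then show ?thesis using X1X by blast
  qed
qed

text \<open>The weights of the derived subgroup are permuted by the connected group, hence fixed.
  The commutators then act as scalars, and these are trivial by a second connectedness argument,
  since multiplication by such a scalar permutes the finitely many eigenvalues of a group element.\<close>

lemma lie_kolchin_derived:
  fixes H :: "('a::alg_closed_field ^ 'n ^ 'n) set"
  assumes "subgroup H GL" "connectedin zariski H" "(derived GL ^^ n) H = {mat 1}"
    and "vec.subspace X" "stable H X" "vec.subspace W" "stable H W" "W \<subseteq> X" "W \<noteq> X"
  shows "\<exists>v. v \<in> X \<and> v \<notin> W \<and> (\<forall>h\<in>H. \<exists>c. h *v v - c *s v \<in> W)"
  using assms
proof (induction n arbitrary: H)
  case 0
  then obtain v where "v \<in> X" "v \<notin> W" by blast
  moreover have "mat 1 *v v - 1 *s v \<in> W" using vec.subspace_0[OF 0(6)] by simp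
  ultimately have "v \<in> X \<and> v \<notin> W \<and> (\<forall>h\<in>{mat 1}. \<exists>c. h *v v - c *s v \<in> W)" by blast
  then show ?case using 0(3) by (intro exI[of _ v]) simp
next
  case (Suc n)
  note H = Suc.prems(1) and conn = Suc.prems(2) and X = Suc.prems(4,5) and W = Suc.prems(6,7)
    and WX = Suc.prems(8,9)
  let ?D = "derived GL H"
  have D: "subgroup ?D GL" and DH: "?D \<subseteq> H" using subgroup_derived[OF H] .
  have "\<exists>v. v \<in> X \<and> v \<notin> W \<and> (\<forall>h\<in>?D. \<exists>c. h *v v - c *s v \<in> W)"
  proof (rule Suc.IH)
    show "(derived GL ^^ n) ?D = {mat 1}" using Suc.prems(3) by (simp add: funpow_swap1)
  qed (rule D connectedin_derived[OF H conn] X(1) W(1) WX stable_subset[OF X(2) DH]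
      stable_subset[OF W(2) DH])+
  then obtain v0 where v0: "v0 \<in> X" "v0 \<notin> W" "\<forall>h\<in>?D. \<exists>c. h *v v0 - c *s v0 \<in> W" by blast
  then obtain \<kappa> where \<kappa>: "\<And>h. h \<in> ?D \<Longrightarrow> h *v v0 - \<kappa> h *s v0 \<in> W" by metis
  have scale_mem: "c = d" if "c *s v - d *s v \<in> W" "v \<notin> W" for c d v
  proof (rule ccontr)
    assume "c \<noteq> d"
    have "(c - d) *s v \<in> W" using that(1) by (simp add: vec.scale_left_diff_distrib)
    then have "v \<in> W" by (rule subspace_scale_cancel[OF W(1)]) (use \<open>c \<noteq> d\<close> in simp)
    then show False using that(2) by simp
  qed
  have eig_unique: "c = d" if "x - c *s v \<in> W" "x - d *s v \<in> W" "v \<notin> W" for c d x v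
  proof -
    have "(x - d *s v) - (x - c *s v) \<in> W" by (rule vec.subspace_diff[OF W(1) that(2,1)])
    then show ?thesis using scale_mem[of c v d] that(3) by simp
  qed
  have notin: "g *v v \<notin> W" if "g \<in> H" "v \<notin> W" for g v
    using stable_cancel[OF H W(2) that(1)] that(2) by blast
  \<comment> \<open>Normality of the derived subgroup: the conjugate of \<open>h\<close> is a
    commutator times \<open>h\<close>.\<close>
  have conj: "g' ** h ** g \<in> ?D"
    if "g \<in> H" "g' \<in> H" "g ** g' = mat 1" "g' ** g = mat 1" "h \<in> ?D" for g g' h
  proof -
    obtain h' where h': "h' \<in> ?D" "h ** h' = mat 1" "h' ** h = mat 1"
      using subgroup_GL_inverse[OF D \<open>h \<in> ?D\<close>] by blast
    have "g' ** h ** g ** h' \<in> ?D"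
      using commutator_in_derived[of g' H h g h'] that h' DH by blast
    then have "(g' ** h ** g ** h') ** h \<in> ?D" using subgroup_GL_mult[OF D] \<open>h \<in> ?D\<close> by blast
    then show ?thesis using h' by (simp flip: matrix_mul_assoc)
  qed
  have weight: "h *v (g *v v0) - \<kappa> h *s (g *v v0) \<in> W" if g: "g \<in> H" and h: "h \<in> ?D" for g h
  proof -
    obtain C where C: "finite C" "\<And>W v c. vec.subspace W \<Longrightarrow> (\<And>w. w \<in> W \<Longrightarrow> h *v w \<in> W) \<Longrightarrow> v \<notin> W \<Longrightarrow>
        h *v v - c *s v \<in> W \<Longrightarrow> c \<in> C"
      using finite_eigenvalues by blast
    have hW: "\<And>w. w \<in> W \<Longrightarrow> h *v w \<in> W" using stableD[OF W(2)] h DH by blast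
    \<comment> \<open>\<open>Z c\<close> holds the elements that carry \<open>v0\<close> to a vector
      of weight \<open>c\<close> for \<open>h\<close>. Each \<open>k\<close> in \<open>H\<close>
      lies in one of them, because \<open>k' ** h ** k\<close> is again in the derived subgroup and
      so has \<open>v0\<close> as an eigenvector modulo \<open>W\<close>.\<close>
    define Z where "Z c = {g. h *v (g *v v0) - c *s (g *v v0) \<in> W}" for c
    have ex: "\<exists>c\<in>C. k \<in> Z c" if k: "k \<in> H" for k
    proof -
      obtain k' where k': "k' \<in> H" "k ** k' = mat 1" "k' ** k = mat 1"
        using subgroup_GL_inverse[OF H k] by blast
      have "(k' ** h ** k) *v v0 - \<kappa> (k' ** h ** k) *s v0 \<in> W"
        by (rule \<kappa>[OF conj[OF k k' h]])
      then have "k *v ((k' ** h ** k) *v v0 - \<kappa> (k' ** h ** k) *s v0) \<in> W"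
        by (rule stableD[OF W(2) k])
      moreover have "k *v ((k' ** h ** k) *v v0) = h *v (k *v v0)"
        using mult_inverse_vector[OF k'(2), of "h *v (k *v v0)"] by (simp flip: matrix_vector_mul_assoc)
      ultimately have mem: "h *v (k *v v0) - \<kappa> (k' ** h ** k) *s (k *v v0) \<in> W"
        by (simp add: matrix_scale_diff)
      then have "\<kappa> (k' ** h ** k) \<in> C" using C(2)[OF W(1) hW notin[OF k v0(2)]] by blast
      then show ?thesis using mem by (auto simp: Z_def)
    qed
    have one: "mat 1 \<in> Z (\<kappa> h)" using \<kappa>[OF h] by (simp add: Z_def)
    have "H \<subseteq> Z (\<kappa> h)"
    proof (rule connectedin_zariski_finite[OF conn C(1), where Z = Z])
      show "zariski_closed (Z c)" for c
      proof -
        have "Z c = {A. ((h - mat c) ** A) *v v0 \<in> W}"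
          by (simp add: Z_def matrix_vector_mult_diff_rdistrib mat_mult_vector flip: matrix_vector_mul_assoc)
        then show ?thesis
          using zariski_closed_maps_to[OF W(1) poly_map_mult[OF poly_map_const poly_map_id]] by simp
      qed
      show "H \<subseteq> (\<Union>c\<in>C. Z c)" using ex by blast
      show "c = d" if "c \<in> C" "d \<in> C" "x \<in> H" "x \<in> Z c" "x \<in> Z d" for c d x
        using eig_unique[of _ c "x *v v0" d] that(4,5) notin[OF that(3) v0(2)] unfolding Z_def by blast
      show "\<kappa> h \<in> C" using C(2)[OF W(1) hW v0(2) \<kappa>[OF h]] by blast
      show "mat 1 \<in> H" using subgroup_GL_one[OF H] .
      show "mat 1 \<in> Z (\<kappa> h)" using one .
    qed
    then show ?thesis using g by (auto simp: Z_def)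
  qed
  \<comment> \<open>The full weight space of \<open>\<kappa>\<close> modulo \<open>W\<close>. The
    line of \<open>v0\<close> need not be preserved by \<open>H\<close>, but this space is, once the
    weight is known to be invariant.\<close>
  define X' where "X' = (\<Inter>h\<in>?D. {v\<in>X. h *v v - \<kappa> h *s v \<in> W})"
  have X'D: "v \<in> X \<and> (\<forall>h\<in>?D. h *v v - \<kappa> h *s v \<in> W)" if "v \<in> X'" for v
    using that subgroup_GL_one[OF D] by (auto simp: X'_def)
  have X'I: "v \<in> X'" if "v \<in> X" "\<forall>h\<in>?D. h *v v - \<kappa> h *s v \<in> W" for v
    using that by (auto simp: X'_def)
  have sub: "vec.subspace X'"
    unfolding X'_def by (rule vec.subspace_Inter) (use subspace_eigenspace_mod X(1) W(1) in blast)
  have WX': "W \<subseteq> X'"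
  proof
    fix w assume w: "w \<in> W"
    show "w \<in> X'"
    proof (rule X'I)
      show "\<forall>h\<in>?D. h *v w - \<kappa> h *s w \<in> W"
        using DH by (intro ballI vec.subspace_diff[OF W(1)] vec.subspace_scale[OF W(1)] w stableD[OF W(2)]) auto
    qed (use w WX in blast)
  qed
  have v0X': "v0 \<in> X'" using v0(1) \<kappa> by (intro X'I) auto
  have stX': "stable H X'"
    unfolding stable_def
  proof (intro ballI)
    fix g v assume g: "g \<in> H" and v: "v \<in> X'"
    obtain g' where g': "g' \<in> H" "g ** g' = mat 1" "g' ** g = mat 1"
      using subgroup_GL_inverse[OF H g] by blast
    show "g *v v \<in> X'"
    proof (rule X'I)
      show "g *v v \<in> X" using X'D[OF v] stableD[OF X(2) g] by blast
      show "\<forall>h\<in>?D. h *v (g *v v) - \<kappa> h *s (g *v v) \<in> W"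
      proof
        fix h assume h: "h \<in> ?D"
        \<comment> \<open>The weights of \<open>h\<close> and of its conjugate are compared at
          \<open>v0\<close>: both are the eigenvalue of \<open>h\<close> on \<open>g *v v0\<close>,
          so they agree.\<close>
        let ?k = "g' ** h ** g"
        have k: "?k \<in> ?D" by (rule conj[OF g g' h])
        have gk: "g *v (?k *v x) = h *v (g *v x)" for x
          using mult_inverse_vector[OF g'(2), of "h *v (g *v x)"] by (simp flip: matrix_vector_mul_assoc)
        have "g *v (?k *v v0 - \<kappa> ?k *s v0) \<in> W" using stableD[OF W(2) g \<kappa>[OF k]] .
        then have "h *v (g *v v0) - \<kappa> ?k *s (g *v v0) \<in> W" by (simp add: matrix_scale_diff gk)
        then have "\<kappa> ?k = \<kappa> h"
          using eig_unique weight[OF g h] notin[OF g v0(2)] by blast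
        moreover have "g *v (?k *v v - \<kappa> ?k *s v) \<in> W" using stableD[OF W(2) g] X'D[OF v] k by blast
        ultimately show "h *v (g *v v) - \<kappa> h *s (g *v v) \<in> W" by (simp add: matrix_scale_diff gk)
      qed
    qed
  qed
  have comm: "x *v (y *v v) - y *v (x *v v) \<in> W" if x: "x \<in> H" and y: "y \<in> H" and v: "v \<in> X'" for x y v
  proof -
    obtain y' where y': "y' \<in> H" "y ** y' = mat 1" "y' ** y = mat 1"
      using subgroup_GL_inverse[OF H y] by blast
    obtain C where C: "finite C" "\<And>W v c. vec.subspace W \<Longrightarrow> (\<And>w. w \<in> W \<Longrightarrow> y *v w \<in> W) \<Longrightarrow> v \<notin> W \<Longrightarrow>
        y *v v - c *s v \<in> W \<Longrightarrow> c \<in> C"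
      using finite_eigenvalues by blast
    obtain v1 c1 where v1: "v1 \<in> X'" "v1 \<notin> W" "y *v v1 - c1 *s v1 \<in> W"
      using eigenvector_mod[OF sub stableD[OF stX' y] W(1) v0X' v0(2)] by blast
    have "c1 \<noteq> 0" using v1 notin[OF y v1(2)] by auto
    define Z where "Z c = {k. k *v (y *v v1) - c *s (y *v (k *v v1)) \<in> W}" for c
    \<comment> \<open>If the commutator of \<open>k\<close> and \<open>y\<close> acts as a scalar
      \<open>\<kappa>\<close>, then \<open>k *v v1\<close> is an eigenvector of \<open>y\<close> for
      \<open>c1 / \<kappa>\<close>, and this quotient is one of the finitely many eigenvalues in
      \<open>C\<close>. The extra 1 is the value at \<open>k = mat 1\<close>.\<close>
    define I where "I = insert 1 ((\<lambda>c. c1 / c) ` C)"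
    have scal: "\<exists>c\<in>I. \<forall>v\<in>X'. k *v (y *v v) - c *s (y *v (k *v v)) \<in> W" if k: "k \<in> H" for k
    proof -
      obtain k' where k': "k' \<in> H" "k ** k' = mat 1" "k' ** k = mat 1"
        using subgroup_GL_inverse[OF H k] by blast
      let ?c = "k ** y ** k' ** y'"
      have cD: "?c \<in> ?D" by (rule commutator_in_derived[OF k y k'(2,3) y'(2,3)])
      have mem: "k *v (y *v v) - \<kappa> ?c *s (y *v (k *v v)) \<in> W" if "v \<in> X'" for v
      proof -
        have "y *v (k *v v) \<in> X'" using that stableD[OF stX'] k y by blast
        then have "?c *v (y *v (k *v v)) - \<kappa> ?c *s (y *v (k *v v)) \<in> W" using X'D cD by blast
        moreover have "?c *v (y *v (k *v v)) = k *v (y *v v)"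
          using mult_inverse_vector[OF y'(3)] mult_inverse_vector[OF k'(3)]
          by (simp flip: matrix_vector_mul_assoc)
        ultimately show ?thesis by simp
      qed
      have "k *v (y *v v1 - c1 *s v1) \<in> W" using stableD[OF W(2) k v1(3)] .
      then have "(k *v (y *v v1) - \<kappa> ?c *s (y *v (k *v v1))) - k *v (y *v v1 - c1 *s v1) \<in> W"
        using mem[OF v1(1)] vec.subspace_diff[OF W(1)] by blast
      then have e: "c1 *s (k *v v1) - \<kappa> ?c *s (y *v (k *v v1)) \<in> W"
        by (simp add: matrix_scale_diff)
      have nz: "\<kappa> ?c \<noteq> 0"
      proof
        assume "\<kappa> ?c = 0"
        then have "c1 *s (k *v v1) - 0 *s (k *v v1) \<in> W" using e by simp
        then show False using scale_mem notin[OF k v1(2)] \<open>c1 \<noteq> 0\<close> by blast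
      qed
      have "(- inverse (\<kappa> ?c)) *s (c1 *s (k *v v1) - \<kappa> ?c *s (y *v (k *v v1))) \<in> W"
        by (rule vec.subspace_scale[OF W(1) e])
      then have "y *v (k *v v1) - (c1 / \<kappa> ?c) *s (k *v v1) \<in> W"
        using nz by (simp add: vec.scale_right_diff_distrib field_simps)
      then have "c1 / \<kappa> ?c \<in> C"
        using C(2)[OF W(1) stableD[OF W(2) y] notin[OF k v1(2)]] by blast
      then have "\<kappa> ?c \<in> I" using \<open>c1 \<noteq> 0\<close> nz by (auto simp: I_def image_iff intro!: bexI[of _ "c1 / \<kappa> ?c"])
      then show ?thesis using mem by blast
    qed
    have "H \<subseteq> Z 1"
    proof (rule connectedin_zariski_finite[OF conn, where Z = Z and I = I])
      show "finite I" using C(1) by (simp add: I_def)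
      show "zariski_closed (Z c)" for c
      proof -
        have "poly_map (\<lambda>A. A ** y + mat (- c) ** y ** A)"
          by (intro poly_map_add poly_map_mult poly_map_const poly_map_id)
        from zariski_closed_maps_to[OF W(1) this, of v1]
        show ?thesis
          unfolding Z_def
          by (simp add: matrix_vector_mult_add_rdistrib mat_mult_vector flip: matrix_vector_mul_assoc)
      qed
      show "H \<subseteq> (\<Union>c\<in>I. Z c)" using scal v1(1) by (fastforce simp: Z_def)
      show "c = d" if "c \<in> I" "d \<in> I" "x \<in> H" "x \<in> Z c" "x \<in> Z d" for c d x
        using eig_unique[of _ c "y *v (x *v v1)" d] that(4,5) notin[OF y notin[OF that(3) v1(2)]]
        unfolding Z_def by blast
      show "1 \<in> I" by (simp add: I_def)
      show "mat 1 \<in> H" using subgroup_GL_one[OF H] .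
      show "mat 1 \<in> Z 1" using vec.subspace_0[OF W(1)] by (simp add: Z_def)
    qed
    then have Z1: "x *v (y *v v1) - 1 *s (y *v (x *v v1)) \<in> W" using x by (auto simp: Z_def)
    obtain c where c: "\<forall>v\<in>X'. x *v (y *v v) - c *s (y *v (x *v v)) \<in> W" using scal[OF x] by blast
    then have "c = 1"
      using eig_unique[OF _ Z1, of c] v1 notin[OF y notin[OF x v1(2)]] by blast
    then show ?thesis using c v by simp
  qed
  have "\<exists>v. v \<in> X' \<and> v \<notin> W \<and> (\<forall>h\<in>H. \<exists>c. h *v v - c *s v \<in> W)"
    by (rule commuting_common_eigenvector[OF sub stX' W WX']) (use v0X' v0(2) comm in auto)
  then show ?case using X'D by blast
qed

theorem lie_kolchin:
  fixes H :: "('a::alg_closed_field ^ 'n ^ 'n) set"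
  assumes "subgroup H GL" "connectedin zariski H" "solvable (GL\<lparr>carrier := H\<rparr>)"
    and "vec.subspace X" "stable H X" "vec.subspace W" "stable H W" "W \<subseteq> X" "W \<noteq> X"
  obtains v where "v \<in> X" "v \<notin> W" "\<And>h. h \<in> H \<Longrightarrow> \<exists>c. h *v v - c *s v \<in> W"
proof -
  obtain n where "(derived GL ^^ n) H = {mat 1}"
    using assms(3) solvable_GL_iff[OF assms(1)] by blast
  from lie_kolchin_derived[OF assms(1,2) this assms(4-)] show ?thesis using that by blast
qed

text \<open>On each quotient, of dimension at most one, \<open>H\<close> acts by scalars. So
  commutators lower the flag by one step, and each further derived group lowers it by at least one
  more.\<close>

lemma flag_stabilizer_solvable:
  fixes H :: "('a::field ^ 'n ^ 'n) set"
  assumes H: "subgroup H GL" and stab: "\<And>i. stable H (W i)"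
    and sub: "\<And>i. vec.subspace (W i)" and W0: "W 0 = {0}" and WN: "W N = UNIV"
    and mono: "\<And>i. W i \<subseteq> W (Suc i)" and step: "\<And>i. \<exists>x. W (Suc i) \<subseteq> vec.span (insert x (W i))"
  shows "solvable (GL\<lparr>carrier := H\<rparr>)"
proof -
  have mono': "i \<le> j \<Longrightarrow> W i \<subseteq> W j" for i j
    using mono lift_Suc_mono_le[of W] by blast
  \<comment> \<open>\<open>P k g\<close> says that \<open>g - 1\<close> lowers the flag by
    \<open>k\<close> steps. Truncated subtraction makes the target \<open>W 0 = {0}\<close> once
    \<open>k\<close> reaches \<open>i\<close>, so \<open>P N\<close> forces the identity on
    \<open>W N = UNIV\<close>.\<close>
  define P where "P k g \<longleftrightarrow> (\<forall>i. \<forall>v\<in>W i. g *v v - v \<in> W (i - k))" for k and g :: "'a^'n^'n"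
  have quot: "\<exists>a. \<forall>z\<in>W i. x *v z - a *s z \<in> W (i - 1)" if x: "x \<in> H" for x i
  proof (cases i)
    case 0
    then show ?thesis using W0 vec.subspace_0[OF sub] by (auto simp: W0)
  next
    case (Suc j)
    obtain e where e: "W (Suc j) \<subseteq> vec.span (insert e (W j))" using step by blast
    have spn: "vec.span (W j) = W j" using sub by simp
    show ?thesis
    proof (cases "e \<in> W (Suc j)")
      case True
      then have "x *v e \<in> vec.span (insert e (W j))" using stableD[OF stab x] e by blast
      then obtain a where a: "x *v e - a *s e \<in> W j" using vec.span_breakdown_eq spn by metis
      have "x *v z - a *s z \<in> W j" if "z \<in> W (Suc j)" for z
      proof -
        have "z \<in> vec.span (insert e (W j))" using that e by blast
        then obtain c where c: "z - c *s e \<in> W j" using vec.span_breakdown_eq spn by metis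
        have "x *v z - a *s z = (x *v (z - c *s e) - a *s (z - c *s e)) + c *s (x *v e - a *s e)"
          by (simp add: matrix_scale_diff vec.scale_right_diff_distrib mult.commute)
        also have "\<dots> \<in> W j"
          by (intro vec.subspace_add[OF sub] vec.subspace_diff[OF sub] vec.subspace_scale[OF sub] a c
              stableD[OF stab x])
        finally show ?thesis .
      qed
      then show ?thesis using Suc by (intro exI[of _ a]) simp
    next
      case False
      have "W (Suc j) \<subseteq> W j"
      proof
        fix z assume z: "z \<in> W (Suc j)"
        then have "z \<in> vec.span (insert e (W j))" using e by blast
        then obtain c where c: "z - c *s e \<in> W j" using vec.span_breakdown_eq spn by metis
        show "z \<in> W j"
        proof (cases "c = 0")
          case False
          have "z - (z - c *s e) \<in> W (Suc j)" using vec.subspace_diff[OF sub z] c mono by blast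
          then have "c *s e \<in> W (Suc j)" by simp
          then show ?thesis using False \<open>e \<notin> W (Suc j)\<close> subspace_scale_cancel[OF sub] by blast
        qed (use c in simp)
      qed
      then show ?thesis
        using Suc stableD[OF stab x] vec.subspace_0[OF sub]
        by (intro exI[of _ 0]) auto
    qed
  qed
  have derP: "\<And>g. g \<in> (derived GL ^^ k) H \<Longrightarrow> P k g" for k
  proof (induction k)
    case 0
    then show ?case
      using stableD[OF stab] vec.subspace_diff[OF sub] by (simp add: P_def)
  next
    case (Suc k)
    let ?D = "(derived GL ^^ k) H"
    have D: "subgroup ?D GL" using group.exp_of_derived_is_subgroup[OF group_GL H] .
    have DH: "?D \<subseteq> H"
    proof (induction k)
      case (Suc k)
      then show ?case using group.derived_incl[OF group_GL _ H] by simp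
    qed simp
    let ?K = "{g\<in>H. P (Suc k) g}"
    have "subgroup ?K GL"
      unfolding subgroup_GL_iff
    proof (intro conjI ballI)
      show "mat 1 \<in> ?K" using subgroup_GL_one[OF H] vec.subspace_0[OF sub] by (simp add: P_def)
      fix A assume A: "A \<in> ?K"
      show "A ** B \<in> ?K" if B: "B \<in> ?K" for B
      proof -
        have "(A ** B) *v v - v \<in> W (i - Suc k)" if "v \<in> W i" for i v
        proof -
          have "A *v (B *v v - v) + (A *v v - v) \<in> W (i - Suc k)"
            using A B that by (intro vec.subspace_add[OF sub] stableD[OF stab]) (auto simp: P_def)
          then show ?thesis
            by (simp add: matrix_vector_mult_diff_distrib flip: matrix_vector_mul_assoc)
        qed
        then show ?thesis using A B subgroup_GL_mult[OF H] by (simp add: P_def)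
      qed
      obtain B where B: "B \<in> H" "A ** B = mat 1" "B ** A = mat 1"
        using A subgroup_GL_inverse[OF H] by blast
      have "B *v v - v \<in> W (i - Suc k)" if "v \<in> W i" for i v
      proof -
        have "B *v (A *v v - v) \<in> W (i - Suc k)"
          using A B that by (intro stableD[OF stab]) (auto simp: P_def)
        then have "- (B *v (A *v v - v)) \<in> W (i - Suc k)" by (rule vec.subspace_neg[OF sub])
        then show ?thesis
          by (simp add: matrix_vector_mult_diff_distrib mult_inverse_vector[OF B(3)])
      qed
      then show "\<exists>B\<in>?K. A ** B = mat 1 \<and> B ** A = mat 1" using B by (auto simp: P_def)
    qed
    then have "derived GL ?D \<subseteq> ?K"
    proof (rule derived_subsetI[OF D])
      fix x y x' y' assume xy: "x \<in> ?D" "y \<in> ?D" "x' \<in> ?D" "y' \<in> ?D" "x ** x' = mat 1" "x' ** x = mat 1"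
      "y ** y' = mat 1" "y' ** y = mat 1"
      have xyH: "x \<in> H" "y \<in> H" "x' \<in> H" "y' \<in> H" using xy DH by blast+
      have comm: "x *v (y *v z) - y *v (x *v z) \<in> W (i - Suc k)" if z: "z \<in> W i" for i z
      proof (cases k)
        case 0
        \<comment> \<open>\<open>P 0\<close> says nothing about \<open>x - 1\<close>. With the
          scalar \<open>a\<close> by which \<open>x\<close> acts on the quotient,
          \<open>xy - yx = (x - a)y - y(x - a)\<close>.\<close>
        obtain a where a: "\<forall>z\<in>W i. x *v z - a *s z \<in> W (i - 1)" using quot[OF xyH(1)] by blast
        have "x *v (y *v z) - a *s (y *v z) \<in> W (i - 1)"
          using a stableD[OF stab xyH(2) z] by blast
        moreover have "y *v (x *v z - a *s z) \<in> W (i - 1)"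
          using a z stableD[OF stab xyH(2)] by blast
        ultimately have "(x *v (y *v z) - a *s (y *v z)) - y *v (x *v z - a *s z) \<in> W (i - 1)"
          by (rule vec.subspace_diff[OF sub])
        then show ?thesis using 0 by (simp add: matrix_scale_diff)
      next
        case (Suc l)
        \<comment> \<open>Now \<open>xy - yx = (x - 1)(y - 1) - (y - 1)(x - 1)\<close> lowers by
          \<open>2k\<close> steps, at least \<open>k + 1\<close> since \<open>k\<close> is
          positive.\<close>
        have 1: "y *v z - z \<in> W (i - k)" "x *v z - z \<in> W (i - k)"
          using Suc.IH xy z by (auto simp: P_def)
        have "x *v (y *v z - z) - (y *v z - z) \<in> W (i - k - k)"
          "y *v (x *v z - z) - (x *v z - z) \<in> W (i - k - k)"
          using Suc.IH[OF xy(1)] Suc.IH[OF xy(2)] 1 unfolding P_def by blast+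
        then have "(x *v (y *v z - z) - (y *v z - z)) - (y *v (x *v z - z) - (x *v z - z)) \<in> W (i - k - k)"
          by (rule vec.subspace_diff[OF sub])
        then have "x *v (y *v z) - y *v (x *v z) \<in> W (i - k - k)"
          by (simp add: matrix_vector_mult_diff_distrib algebra_simps)
        moreover have "i - k - k \<le> i - Suc k" using Suc by simp
        ultimately show ?thesis using mono' by blast
      qed
      have "P (Suc k) (x ** y ** x' ** y')"
        unfolding P_def
      proof (intro allI ballI)
        fix i v assume "v \<in> W i"
        then have "x' *v (y' *v v) \<in> W i" using xyH by (intro stableD[OF stab])
        from comm[OF this]
        show "x ** y ** x' ** y' *v v - v \<in> W (i - Suc k)"
          using mult_inverse_vector[OF xy(5)] mult_inverse_vector[OF xy(7)]
          by (simp flip: matrix_vector_mul_assoc)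
      qed
      then show "x ** y ** x' ** y' \<in> ?K" using xyH subgroup_GL_mult[OF H] by blast
    qed
    then show ?case using Suc.prems by auto
  qed
  have "(derived GL ^^ N) H \<subseteq> {mat 1}"
  proof
    fix g assume "g \<in> (derived GL ^^ N) H"
    then have "g *v v - v \<in> W (N - N)" for v using derP WN by (fastforce simp: P_def)
    then have "g *v v = mat 1 *v v" for v using W0 by simp
    then show "g \<in> {mat 1}" by (simp add: matrix_eq)
  qed
  moreover have "mat 1 \<in> (derived GL ^^ N) H"
    using group.exp_of_derived_is_subgroup[OF group_GL H] subgroup_GL_one by blast
  ultimately show ?thesis using solvable_GL_iff[OF H] by blast
qed

section \<open>Borel subgroups as stabilizers of flags\<close>

definition stabilizer :: "('a::field ^ 'n ^ 'n) set \<Rightarrow> ('a ^ 'n) set set \<Rightarrow> ('a ^ 'n ^ 'n) set" where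
  "stabilizer G \<U> = {g \<in> G. \<forall>U\<in>\<U>. \<forall>u\<in>U. g *v u \<in> U}"

text \<open>\<open>A\<close> is injective, so by dimension it maps \<open>U\<close> onto
  itself.\<close>

lemma inverse_maps_to:
  fixes A B :: "'a::field ^ 'n ^ 'n"
  assumes AB: "A ** B = mat 1" "B ** A = mat 1" and U: "vec.subspace U"
    and A: "\<And>u. u \<in> U \<Longrightarrow> A *v u \<in> U" and u: "u \<in> U"
  shows "B *v u \<in> U"
proof -
  have "inj_on ((*v) A) (vec.span U)"
    by (rule inj_on_inverseI[of _ "(*v) B"]) (simp add: mult_inverse_vector AB)
  then have "vec.dim ((*v) A ` U) = vec.dim U"
    by (intro vec.dim_image_eq) auto
  moreover have "vec.subspace ((*v) A ` U)"
    by (rule vec.linear_subspace_image[OF _ U]) (rule matrix_vector_mul_linear_gen)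
  ultimately have "(*v) A ` U = U"
    by (intro vec.subspace_dim_equal U) (use A in auto)
  then obtain u' where "u' \<in> U" "u = A *v u'" using u by blast
  then show ?thesis by (simp add: mult_inverse_vector AB)
qed

lemma subgroup_stabilizer:
  assumes G: "subgroup G GL" and sub: "\<And>U. U \<in> \<U> \<Longrightarrow> vec.subspace U"
  shows "subgroup (stabilizer G \<U>) GL"
  unfolding subgroup_GL_iff
proof (intro conjI ballI)
  show "mat 1 \<in> stabilizer G \<U>" using subgroup_GL_one[OF G] by (simp add: stabilizer_def)
  show "A ** B \<in> stabilizer G \<U>" if "A \<in> stabilizer G \<U>" "B \<in> stabilizer G \<U>" for A B
    using that subgroup_GL_mult[OF G] by (simp add: stabilizer_def flip: matrix_vector_mul_assoc)
  fix A assume A: "A \<in> stabilizer G \<U>"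
  then obtain B where B: "B \<in> G" "A ** B = mat 1" "B ** A = mat 1"
    using subgroup_GL_inverse[OF G] unfolding stabilizer_def by blast
  have "B *v u \<in> U" if "U \<in> \<U>" "u \<in> U" for u U
    by (rule inverse_maps_to[OF B(2,3) sub[OF that(1)] _ that(2)]) (use A that in \<open>auto simp: stabilizer_def\<close>)
  then show "\<exists>B\<in>stabilizer G \<U>. A ** B = mat 1 \<and> B ** A = mat 1"
    using B by (intro bexI[of _ B]) (auto simp: stabilizer_def)
qed

lemma closedin_stabilizer:
  assumes sub: "\<And>U. U \<in> \<U> \<Longrightarrow> vec.subspace U"
  shows "closedin (subtopology zariski G) (stabilizer G \<U>)"
proof -
  have "zariski_closed (\<Inter>U\<in>\<U>. {A. \<forall>u\<in>U. A *v u \<in> U})"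
    by (intro zariski_closed_INT zariski_closed_stabilizer sub)
  moreover have "stabilizer G \<U> = (\<Inter>U\<in>\<U>. {A. \<forall>u\<in>U. A *v u \<in> U}) \<inter> G"
    by (auto simp: stabilizer_def)
  ultimately show ?thesis unfolding closedin_subtopology closedin_zariski by blast
qed

lemma closedin_identity_component_trans:
  assumes "closedin (subtopology zariski G) S" "S \<subseteq> G"
  shows "closedin (subtopology zariski G) (identity_component S)"
proof -
  obtain Y where Y: "closedin zariski Y" "S = Y \<inter> G"
    using assms(1) unfolding closedin_subtopology by blast
  obtain Z where Z: "closedin zariski Z" "identity_component S = Z \<inter> S"
    using closedin_identity_component[of S] unfolding closedin_subtopology by blast
  have "identity_component S = (Y \<inter> Z) \<inter> G" using Y Z by blast
  then show ?thesis using closedin_Int[OF Y(1) Z(1)] unfolding closedin_subtopology by blast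
qed

text \<open>The only place where maximality of a Borel subgroup is checked. By the premise
  \<open>max\<close> a connected solvable group above the identity component of the flag stabilizer
  preserves the flag; it then lies in the stabilizer and, being connected, in that
  component.\<close>

lemma parabolic_stabilizerI:
  fixes G :: "('a::field ^ 'n ^ 'n) set" and W :: "nat \<Rightarrow> ('a ^ 'n) set"
  assumes G: "subgroup G GL"
    and sub: "\<And>i. vec.subspace (W i)" and W0: "W 0 = {0}" and WN: "W N = UNIV"
    and mono: "\<And>i. W i \<subseteq> W (Suc i)" and step: "\<And>i. \<exists>x. W (Suc i) \<subseteq> vec.span (insert x (W i))"
    and max: "\<And>H i. subgroup H GL \<Longrightarrow> connectedin zariski H \<Longrightarrow> solvable (GL\<lparr>carrier := H\<rparr>) \<Longrightarrow>
      H \<subseteq> G \<Longrightarrow> identity_component (stabilizer G (range W)) \<subseteq> H \<Longrightarrow> stable H (W i)"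
  shows "parabolic_subgroup G (stabilizer G {W k})"
proof -
  let ?S = "stabilizer G (range W)" and ?B = "identity_component (stabilizer G (range W))"
  have S: "subgroup ?S GL" "?S \<subseteq> G"
    by (rule subgroup_stabilizer[OF G]) (use sub in \<open>auto simp: stabilizer_def\<close>)
  have B: "subgroup ?B GL" "?B \<subseteq> ?S"
    using subgroup_identity_component[OF S(1)] identity_component_subset .
  have stab: "stable ?B (W i)" for i using B(2) by (auto simp: stable_def stabilizer_def)
  have "closed_subgroup G ?B"
    unfolding closed_subgroup_def
    using B S closedin_identity_component_trans[OF closedin_stabilizer S(2)] sub by blast
  moreover have "solvable (GL\<lparr>carrier := ?B\<rparr>)"
    by (rule flag_stabilizer_solvable[OF B(1) stab sub W0 WN mono step])
  ultimately have "connected_solvable G ?B"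
    unfolding connected_solvable_def using connectedin_identity_component by blast
  moreover have "H = ?B" if H: "connected_solvable G H" "?B \<subseteq> H" for H
  proof -
    have *: "subgroup H GL" "connectedin zariski H" "solvable (GL\<lparr>carrier := H\<rparr>)" "H \<subseteq> G"
      using H(1) by (auto simp: connected_solvable_def closed_subgroup_def)
    have "H \<subseteq> ?S"
      using max[OF * H(2)] *(4) by (auto simp: stabilizer_def stable_def)
    then have "H \<subseteq> ?B" by (rule identity_component_maximal[OF *(2) _ subgroup_GL_one[OF *(1)]])
    then show ?thesis using H(2) by blast
  qed
  ultimately have "borel_subgroup G ?B" unfolding borel_subgroup_def by blast
  moreover have "?S \<subseteq> stabilizer G {W k}" by (auto simp: stabilizer_def)
  moreover have "closed_subgroup G (stabilizer G {W k})"
    unfolding closed_subgroup_def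
    using subgroup_stabilizer[OF G, of "{W k}"] closedin_stabilizer[of "{W k}" G] sub
    by (auto simp: stabilizer_def)
  ultimately show ?thesis unfolding parabolic_subgroup_def using B(2) by blast
qed

text \<open>The element \<open>g\<close> shows that the parabolic subgroup is proper.\<close>

lemma irreducible_not_stable:
  assumes "irreducible_in G C" "parabolic_subgroup G (stabilizer G {U})" "C \<subseteq> G"
    and "g \<in> G" "u \<in> U" "g *v u \<notin> U"
  shows "\<not> stable C U"
  using assms unfolding irreducible_in_def stable_def stabilizer_def by fast

text \<open>The members are the spans of the prefixes of a spanning list of \<open>U\<close>
  followed by one of \<open>M\<close>. Redundant vectors and indices beyond the list merely repeat a
  member, so no adapted basis is needed.\<close>

lemma flag_through:
  fixes U M :: "('a::field ^ 'n) set"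
  assumes U: "vec.subspace U" and M: "vec.subspace M" and UM: "U \<subseteq> M"
  obtains V z k m where "\<forall>i. vec.subspace (V i)" "V 0 = {0}" "V k = U" "k \<le> m" "\<forall>i\<ge>m. V i = M"
    "\<forall>i. V (Suc i) = vec.span (insert (z i) (V i))" "\<forall>i j. i \<le> j \<longrightarrow> V i \<subseteq> V j" "\<forall>i. V i \<subseteq> M"
proof -
  have fin: "\<exists>xs. vec.span (set xs) = X" if X: "vec.subspace X" for X :: "('a ^ 'n) set"
  proof -
    obtain B where B: "B \<subseteq> X" "vec.independent B" "X \<subseteq> vec.span B"
      using vec.basis_exists by metis
    obtain xs where "set xs = B" using vec.finiteI_independent[OF B(2)] finite_list by blast
    then show ?thesis using B vec.span_minimal[OF B(1) X] by blast
  qed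
  obtain xs where xs: "vec.span (set xs) = U" using fin[OF U] by blast
  obtain ys where ys: "vec.span (set ys) = M" using fin[OF M] by blast
  define zs where "zs = xs @ ys"
  define V where "V i = vec.span (set (take i zs))" for i
  define z where "z i = (if i < length zs then zs ! i else 0)" for i
  have zsM: "vec.span (set zs) = M"
  proof
    have "set xs \<subseteq> M" "set ys \<subseteq> M" using xs ys UM vec.span_superset by blast+
    then show "vec.span (set zs) \<subseteq> M" by (intro vec.span_minimal M) (simp add: zs_def)
    show "M \<subseteq> vec.span (set zs)" unfolding ys[symmetric] by (intro vec.span_mono) (simp add: zs_def)
  qed
  have "V (Suc i) = vec.span (insert (z i) (V i))" for i
  proof (cases "i < length zs")
    case True
    have "vec.span (insert (z i) (vec.span (set (take i zs)))) = vec.span (insert (z i) (set (take i zs)))"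
    proof (intro subset_antisym vec.span_minimal[OF _ vec.subspace_span])
      show "insert (z i) (vec.span (set (take i zs))) \<subseteq> vec.span (insert (z i) (set (take i zs)))"
        using vec.span_mono[of "set (take i zs)" "insert (z i) (set (take i zs))"]
        by (auto intro: vec.span_base)
      show "insert (z i) (set (take i zs)) \<subseteq> vec.span (insert (z i) (vec.span (set (take i zs))))"
        by (auto intro: vec.span_base)
    qed
    then show ?thesis using True by (simp add: V_def z_def take_Suc_conv_app_nth)
  next
    case False
    then show ?thesis by (simp add: V_def z_def vec.span_insert_0 vec.span_span)
  qed
  moreover have "V i \<subseteq> V j" if "i \<le> j" for i j
    unfolding V_def by (intro vec.span_mono set_take_subset_set_take that)
  moreover have "V i = M" if "i \<ge> length zs" for i using that zsM by (simp add: V_def)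
  moreover have "V i \<subseteq> M" for i unfolding V_def zsM[symmetric] by (intro vec.span_mono set_take_subset)
  moreover have "V (length xs) = U" "V 0 = {0}" using xs by (simp_all add: V_def zs_def)
  ultimately show ?thesis
    using that[of V "length xs" "length zs" z] by (auto simp: V_def zs_def vec.subspace_span)
qed

lemma stable_span_insert:
  assumes V: "vec.subspace V" "stable H V" and v: "\<And>h. h \<in> H \<Longrightarrow> \<exists>c. h *v v - c *s v \<in> V"
  shows "stable H (vec.span (insert v V))"
  unfolding stable_def
proof (intro ballI)
  have spn: "vec.span V = V" using V(1) by simp
  fix h x assume h: "h \<in> H" and "x \<in> vec.span (insert v V)"
  then obtain a where a: "x - a *s v \<in> V" using vec.span_breakdown_eq spn by metis
  obtain c where c: "h *v v - c *s v \<in> V" using v[OF h] by blast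
  have eq: "h *v x - (a * c) *s v = h *v (x - a *s v) + a *s (h *v v - c *s v)"
    by (simp add: matrix_scale_diff vec.scale_right_diff_distrib)
  have "h *v x - (a * c) *s v \<in> V"
    unfolding eq by (intro vec.subspace_add[OF V(1)] vec.subspace_scale[OF V(1)] c stableD[OF V(2) h] a)
  then show "h *v x \<in> vec.span (insert v V)" using vec.span_breakdown_eq spn by metis
qed

lemma span_insert_exchange:
  assumes V: "vec.subspace V" and "v \<in> vec.span (insert z V)" "v \<notin> V"
  shows "vec.span (insert v V) = vec.span (insert z V)"
proof -
  have "v \<notin> vec.span V" using assms(3) unfolding vec.span_eq_iff[THEN iffD2, OF V] .
  then have "z \<in> vec.span (insert v V)" by (rule vec.in_span_insert[OF assms(2)])
  then show ?thesis using assms(2)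
    by (intro subset_antisym vec.span_minimal vec.subspace_span) (auto intro: vec.span_base)
qed

lemma span_insert_member:
  assumes "vec.subspace V" "z \<in> V"
  shows "vec.span (insert z V) = V"
  using assms by (simp add: insert_absorb)

section \<open>Curves of unipotent elements\<close>

definition rank_one :: "'a::field ^ 'n \<Rightarrow> ('a ^ 'n \<Rightarrow> 'a) \<Rightarrow> 'a ^ 'n ^ 'n" where
  "rank_one z \<phi> = (\<chi> i j. z $ i * \<phi> (axis j 1))"

lemma rank_one_mult:
  assumes "Vector_Spaces.linear (*s) (*) \<phi>"
  shows "rank_one z \<phi> *v x = \<phi> x *s z"
  unfolding linear_functional_expand[OF assms, of x]
  by (simp add: vec_eq_iff rank_one_def matrix_vector_mult_def sum_distrib_left mult_ac)

lemma connectedin_polynomial_curve: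
  fixes \<gamma> :: "'a::alg_closed_field \<Rightarrow> 'a ^ 'n ^ 'n"
  assumes "\<And>i j. \<exists>p. \<forall>t. \<gamma> t $ i $ j = poly p t"
  shows "connectedin zariski (range \<gamma>)"
proof (rule connectedin_rational_curve[OF infinite_UNIV_alg_closed])
  fix i j
  obtain p where "\<forall>t. \<gamma> t $ i $ j = poly p t" using assms by blast
  then show "rat_on UNIV (\<lambda>t. \<gamma> t $ i $ j)"
    unfolding rat_on_def by (intro exI[of _ p] exI[of _ 1]) simp
qed

section \<open>The special linear group\<close>

lemma subgroup_SL: "subgroup (SL :: ('a::field ^ 'n ^ 'n) set) GL"
  unfolding subgroup_GL_iff
proof (intro conjI ballI)
  fix A :: "'a ^ 'n ^ 'n" assume A: "A \<in> SL"
  then have "invertible A" by (simp add: SL_def invertible_det_nz)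
  then obtain B where B: "A ** B = mat 1" "B ** A = mat 1" unfolding invertible_def by blast
  then have "det A * det B = 1" by (metis det_I det_mul)
  then show "\<exists>B\<in>SL. A ** B = mat 1 \<and> B ** A = mat 1" using A B by (auto simp: SL_def)
qed (auto simp: SL_def det_mul)

text \<open>\<open>\<gamma> (- t)\<close> inverts \<open>\<gamma> t\<close> because
  \<open>\<phi> z = 0\<close>; so the determinant has no zero along the polynomial curve and keeps
  the value 1 that it has at 0.\<close>

lemma transvection_curve:
  fixes z :: "'a::alg_closed_field ^ 'n"
  assumes \<phi>: "Vector_Spaces.linear (*s) (*) \<phi>" "\<phi> z = 0"
  defines "\<gamma> \<equiv> \<lambda>t. mat 1 + rank_one (t *s z) \<phi>"
  shows "\<gamma> t \<in> SL" "\<gamma> t *v x = x + (t * \<phi> x) *s z" "connectedin zariski (range \<gamma>)" "\<gamma> 0 = mat 1"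
proof -
  interpret Vector_Spaces.linear "(*s)" "(*)" \<phi> by (rule \<phi>(1))
  show act: "\<gamma> t *v x = x + (t * \<phi> x) *s z" for t x
    by (simp add: \<gamma>_def matrix_vector_mult_add_rdistrib rank_one_mult[OF \<phi>(1)] mult.commute)
  show zero: "\<gamma> 0 = mat 1" by (simp add: \<gamma>_def rank_one_def vec_eq_iff)
  have poly: "\<exists>p. \<forall>t. \<gamma> t $ i $ j = poly p t" for i j
    by (rule exI[of _ "[: mat 1 $ i $ j, z $ i * \<phi> (axis j 1) :]"]) (simp add: \<gamma>_def rank_one_def)
  then show "connectedin zariski (range \<gamma>)" by (rule connectedin_polynomial_curve)
  have "\<phi> (x - (t * \<phi> x) *s z) = \<phi> x" for t x
    unfolding diff scale \<phi>(2) by simp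
  then have "\<gamma> t ** \<gamma> (- t) = mat 1" for t
    unfolding matrix_eq by (simp add: act flip: matrix_vector_mul_assoc)
  then have "det (\<gamma> t) \<noteq> 0" for t by (metis det_I det_mul mult_zero_left zero_neq_one)
  then show "\<gamma> t \<in> SL"
    using det_polynomial_curve_const[OF poly, of t] by (simp add: SL_def zero)
qed

text \<open>Suppose Lie--Kolchin fixes the line of \<open>v\<close> modulo \<open>V i\<close> with
  \<open>v\<close> outside \<open>V (Suc i)\<close>. A functional vanishing on
  \<open>V (Suc i)\<close> but not at \<open>v\<close> gives a transvection along \<open>z i\<close>
  that preserves the whole flag and so lies in \<open>H\<close>; it shifts \<open>v\<close> by
  \<open>z i\<close>, which a fixed line does not allow. Hence the line is that of
  \<open>z i\<close>.\<close>

lemma parabolic_stabilizer_SL: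
  fixes U :: "('a::alg_closed_field ^ 'n) set"
  assumes U: "vec.subspace U"
  shows "parabolic_subgroup SL (stabilizer SL {U})"
proof -
  obtain V z k m where flag: "\<forall>i. vec.subspace (V i)" "V 0 = {0}" "V k = U" "k \<le> m"
    "\<forall>i\<ge>m. V i = UNIV" "\<forall>i. V (Suc i) = vec.span (insert (z i) (V i))"
    "\<forall>i j. i \<le> j \<longrightarrow> V i \<subseteq> V j" "\<forall>i. V i \<subseteq> UNIV"
    by (rule flag_through[OF U vec.subspace_UNIV subset_UNIV])
  then have V: "\<And>i. vec.subspace (V i)" "V 0 = {0}" "V k = U" "\<And>i. i \<ge> m \<Longrightarrow> V i = UNIV"
    "\<And>i. V (Suc i) = vec.span (insert (z i) (V i))" "\<And>i j. i \<le> j \<Longrightarrow> V i \<subseteq> V j"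
    by simp_all
  have "parabolic_subgroup SL (stabilizer SL {V k})"
  proof (rule parabolic_stabilizerI[where W = V and N = m])
    show "subgroup SL GL" by (rule subgroup_SL)
    show "vec.subspace (V i)" for i by (rule V(1))
    show "V 0 = {0}" by (rule V(2))
    show "V m = UNIV" using V(4) by simp
    show "V i \<subseteq> V (Suc i)" for i using V(6) by simp
    show "\<exists>x. V (Suc i) \<subseteq> vec.span (insert x (V i))" for i using V(5) by blast
    fix H i
    assume H: "subgroup H GL" "connectedin zariski H" "solvable (GL\<lparr>carrier := H\<rparr>)" "H \<subseteq> SL"
      "identity_component (stabilizer SL (range V)) \<subseteq> H"
    show "stable H (V i)"
    proof (induction i)
      case 0
      then show ?case using V(2) by (simp add: stable_def)
    next
      case (Suc i)
      show ?case
      proof (cases "z i \<in> V i")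
        case True
        then show ?thesis using Suc V(5)[of i] span_insert_member[OF V(1)] by simp
      next
        case False
        then have "V i \<noteq> UNIV" by blast
        then obtain v where v: "v \<notin> V i" "\<And>h. h \<in> H \<Longrightarrow> \<exists>c. h *v v - c *s v \<in> V i"
          using lie_kolchin[OF H(1-3) vec.subspace_UNIV _ V(1) Suc] by (auto simp: stable_def)
        have "v \<in> V (Suc i)"
        proof (rule ccontr)
          assume "v \<notin> V (Suc i)"
          then obtain \<phi> where \<phi>: "Vector_Spaces.linear (*s) (*) \<phi>" "\<And>u. u \<in> V (Suc i) \<Longrightarrow> \<phi> u = 0" "\<phi> v = 1"
            using functional_separating[OF V(1)] by blast
          have zV: "z i \<in> V (Suc i)" using V(5) by (simp add: vec.span_base)
          define \<gamma> where "\<gamma> = (\<lambda>t. mat 1 + rank_one (t *s z i) \<phi>)"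
          note tc = transvection_curve[OF \<phi>(1) \<phi>(2)[OF zV]]
          have curve: "\<gamma> t \<in> SL" "\<gamma> t *v x = x + (t * \<phi> x) *s z i" "connectedin zariski (range \<gamma>)"
            "\<gamma> 0 = mat 1" for t x
            unfolding \<gamma>_def by (rule tc)+
          have "\<gamma> t *v u \<in> V j" if u: "u \<in> V j" for t u j
          proof (cases "j \<le> Suc i")
            case True
            then have "\<phi> u = 0" using \<phi>(2) V(6) u by blast
            then show ?thesis using u by (simp add: curve(2))
          next
            case False
            then have "z i \<in> V j" using zV V(6)[of "Suc i" j] by auto
            then show ?thesis
              unfolding curve(2) by (intro vec.subspace_add[OF V(1) u] vec.subspace_scale[OF V(1)])
          qed
          then have "range \<gamma> \<subseteq> stabilizer SL (range V)" using curve(1) by (auto simp: stabilizer_def)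
          then have "range \<gamma> \<subseteq> identity_component (stabilizer SL (range V))"
            using curve(3,4) by (intro identity_component_maximal) (auto intro: range_eqI[of _ _ 0])
          then have "\<gamma> 1 \<in> H" using H(5) by blast
          then obtain c where c: "\<gamma> 1 *v v - c *s v \<in> V i" using v(2) by blast
          then have c': "(1 - c) *s v + z i \<in> V i"
            using \<phi>(3) by (simp add: curve(2) vec.scale_left_diff_distrib algebra_simps)
          then have "(1 - c) *s v + z i - z i \<in> V (Suc i)"
            using V(6)[of i "Suc i"] zV by (intro vec.subspace_diff[OF V(1)]) auto
          then have *: "(1 - c) *s v \<in> V (Suc i)"
            by (simp only: add_diff_cancel_right')
          show False
          proof (cases "c = 1")
            case True
            then show ?thesis using c' False by simp
          qed (use subspace_scale_cancel[OF V(1) *] \<open>v \<notin> V (Suc i)\<close> in simp)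
        qed
        then have "V (Suc i) = vec.span (insert v (V i))"
          using span_insert_exchange[OF V(1), of v "z i" i] v(1) V(5) by simp
        then show ?thesis using stable_span_insert[OF V(1) Suc v(2)] by simp
      qed
    qed
  qed
  then show ?thesis using V(3) by simp
qed

text \<open>An eigenspace of an element of \<open>F\<close> that fails to commute with
  \<open>SL\<close> is nonzero, proper and stable under the centralizer, so its stabilizer is a
  proper parabolic subgroup containing the component.\<close>

lemma irreducible_SL_noncentral:
  fixes F :: "('a::alg_closed_field ^ 'n ^ 'n) set"
  assumes irr: "irreducible_in SL (identity_component (centralizer SL F))"
  shows "F \<subseteq> centralizer UNIV SL"
proof (rule ccontr)
  assume "\<not> F \<subseteq> centralizer UNIV SL"
  then obtain f g where f: "f \<in> F" and g: "f ** g \<noteq> g ** f" by (auto simp: centralizer_def)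
  obtain v c where v: "v \<notin> {0}" "f *v v - c *s v \<in> {0}"
  proof (rule eigenvector_mod[of UNIV f "{0}" "axis undefined 1"])
    show "axis undefined 1 \<notin> {0 :: 'a ^ 'n}" by (simp add: axis_eq_0_iff)
  qed auto
  define U where "U = {v \<in> UNIV. f *v v - c *s v \<in> {0}}"
  have U: "vec.subspace U" unfolding U_def by (rule subspace_eigenspace_mod) auto
  let ?C = "identity_component (centralizer SL F)"
  have C: "?C \<subseteq> SL" "?C \<subseteq> centralizer SL F" using identity_component_subset[of "centralizer SL F"]
    by (auto simp: centralizer_def)
  have st: "stable ?C U"
    unfolding stable_def
  proof (intro ballI)
    fix h u assume h: "h \<in> ?C" and u: "u \<in> U"
    have "f *v (h *v u) = h *v (f *v u)"
      using h C(2) f by (auto simp: centralizer_def matrix_vector_mul_assoc)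
    then show "h *v u \<in> U" using u by (simp add: U_def vector_scalar_commute)
  qed
  have "U \<noteq> UNIV"
  proof
    assume "U = UNIV"
    then have "f *v x = c *s x" for x by (auto simp: U_def)
    then have "f ** g = g ** f"
      unfolding matrix_eq by (simp add: vector_scalar_commute flip: matrix_vector_mul_assoc)
    then show False using g by simp
  qed
  then obtain w where w: "w \<notin> U" by blast
  have v': "v \<in> U" "v \<noteq> 0" using v by (auto simp: U_def)
  have spnv: "vec.span {v} \<subseteq> U" using vec.span_minimal[OF _ U] v' by simp
  \<comment> \<open>\<open>\<phi> w = 0\<close> makes \<open>x \<mapsto> x + \<phi> x w\<close> a
    transvection, and \<open>\<phi> v = 1\<close> makes it carry \<open>v\<close> out of
    \<open>U\<close>.\<close>
  obtain \<phi> where \<phi>: "Vector_Spaces.linear (*s) (*) \<phi>" "\<phi> w = 0" "\<phi> v = 1"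
  proof -
    have "v \<notin> vec.span {w}"
    proof
      assume "v \<in> vec.span {w}"
      then obtain a where a: "v = a *s w" by (auto simp: vec.span_singleton)
      then have "w = inverse a *s v" using v' by auto
      then show False using w vec.subspace_scale[OF U v'(1)] by simp
    qed
    from functional_separating[OF vec.subspace_span this] show ?thesis
      using that vec.span_base[of w "{w}"] by blast
  qed
  note curve = transvection_curve[OF \<phi>(1,2)]
  have "mat 1 + rank_one (1 *s w) \<phi> \<in> SL" by (rule curve(1))
  moreover have "(mat 1 + rank_one (1 *s w) \<phi>) *v v = v + w" using curve(2)[of 1 v] \<phi>(3) by simp
  moreover have "v + w \<notin> U"
    using w vec.subspace_diff[OF U _ v'(1), of "v + w"] by auto
  ultimately show False
    using irreducible_not_stable[OF irr parabolic_stabilizer_SL[OF U] C(1) _ v'(1)] st by metis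
qed

section \<open>Stabilizers of totally singular subspaces\<close>

text \<open>Common setting for the symplectic groups (\<open>q = 0\<close>) and the orthogonal groups (\<open>q = Q\<close>, with
  polar form \<open>b\<close>). For singular \<open>u\<close> and \<open>x\<close> orthogonal to \<open>u\<close>, the group contains the isometry
  \<open>v \<mapsto> v + b v u x - b x v u + a b v u u\<close> for every admissible \<open>a\<close>: any \<open>a\<close> in the symplectic
  case (so \<open>x = 0\<close> gives the transvections), and only \<open>a = - Q x\<close> in the orthogonal case.\<close>

definition siegel :: "('a::field ^ 'n \<Rightarrow> 'a ^ 'n \<Rightarrow> 'a) \<Rightarrow> 'a ^ 'n \<Rightarrow> 'a ^ 'n \<Rightarrow> 'a \<Rightarrow> 'a ^ 'n ^ 'n" where
  "siegel b u x a = mat 1 + rank_one x (\<lambda>v. b v u) - rank_one u (b x) + rank_one (a *s u) (\<lambda>v. b v u)"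

locale bilinear_space =
  fixes b :: "'a::field ^ 'n \<Rightarrow> 'a ^ 'n \<Rightarrow> 'a"
  assumes bilinear: "bilinear_form b"
begin

lemma linear_right: "Vector_Spaces.linear (*s) (*) (b x)"
  and linear_left: "Vector_Spaces.linear (*s) (*) (\<lambda>x. b x y)"
  using bilinear unfolding bilinear_form_def by blast+

sublocale right: Vector_Spaces.linear "(*s)" "(*)" "b x" for x
  by (rule linear_right)

sublocale left: Vector_Spaces.linear "(*s)" "(*)" "\<lambda>x. b x y" for y
  by (rule linear_left)

lemmas bilin = left.add left.scale left.diff left.neg left.zero
  right.add right.scale right.diff right.neg right.zero

lemma siegel_mult: "siegel b u x a *v v = v + b v u *s x - b x v *s u + (a * b v u) *s u"
  unfolding siegel_def
  by (simp add: matrix_vector_mult_add_rdistrib matrix_vector_mult_diff_rdistrib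
      rank_one_mult[OF linear_left] rank_one_mult[OF linear_right] mult.commute)

text \<open>Scaling \<open>x\<close> by \<open>t\<close> and the coefficient by the square of
  \<open>t\<close> follows the scaling of \<open>q\<close>, so admissibility is kept; the curve is
  quadratic in \<open>t\<close> and passes through 1 at \<open>t = 0\<close>.\<close>

lemma siegel_curve_entry:
  "\<exists>p. \<forall>t. siegel b u (t *s x) (t\<^sup>2 * a) $ i $ j = poly p t"
  by (rule exI[of _ "[: mat 1 $ i $ j, x $ i * b (axis j 1) u - u $ i * b x (axis j 1),
        a * u $ i * b (axis j 1) u :]"])
    (simp add: siegel_def rank_one_def bilin algebra_simps power2_eq_square)

definition perp :: "('a ^ 'n) set \<Rightarrow> ('a ^ 'n) set" where
  "perp X = {v. \<forall>x\<in>X. b v x = 0}"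

lemma subspace_perp: "vec.subspace (perp X)"
  by (auto simp: perp_def vec.subspace_def bilin)

lemma perp_antimono: "X \<subseteq> Y \<Longrightarrow> perp Y \<subseteq> perp X"
  by (auto simp: perp_def)

lemma perp_span_insert:
  assumes "v \<in> perp X" "b v z = 0"
  shows "v \<in> perp (vec.span (insert z X))"
proof -
  have "b v x = 0" if "x \<in> vec.span (insert z X)" for x
    by (rule right.eq_0_on_span[OF _ that]) (use assms in \<open>auto simp: perp_def\<close>)
  then show ?thesis by (simp add: perp_def)
qed

text \<open>The sum of \<open>X\<close> and the radical of \<open>b\<close>. Orthogonality sees
  subspaces only up to this enlargement, which is proper for some odd-dimensional quadratic forms in
  characteristic 2.\<close>

definition plus_radical :: "('a ^ 'n) set \<Rightarrow> ('a ^ 'n) set" where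
  "plus_radical X = {w. \<exists>x\<in>X. \<forall>y. b (w - x) y = 0}"

lemma plus_radical_superset: "X \<subseteq> plus_radical X"
  by (force simp: plus_radical_def bilin)

lemma subspace_plus_radical:
  assumes X: "vec.subspace X" shows "vec.subspace (plus_radical X)"
proof (rule vec.subspaceI)
  show "0 \<in> plus_radical X" using vec.subspace_0[OF X] plus_radical_superset by blast
  fix v assume "v \<in> plus_radical X"
  then obtain x where x: "x \<in> X" "\<And>y. b (v - x) y = 0" by (auto simp: plus_radical_def)
  show "c *s v \<in> plus_radical X" for c
    unfolding plus_radical_def
    using x vec.subspace_scale[OF X x(1), of c] by (auto simp: bilin intro!: bexI[of _ "c *s x"])
  fix w assume "w \<in> plus_radical X"
  then obtain z where z: "z \<in> X" "\<And>y. b (w - z) y = 0" by (auto simp: plus_radical_def)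
  show "v + w \<in> plus_radical X"
    unfolding plus_radical_def
    using x z vec.subspace_add[OF X x(1) z(1)] by (auto simp: bilin intro!: bexI[of _ "x + z"])
qed

text \<open>Eliminate \<open>u\<close>: if its functional is independent of the others there is
  \<open>x\<close> dual to it, and subtracting a multiple of \<open>b y u\<close> from
  \<open>\<phi>\<close> leaves the smaller set. This replaces the isomorphism with the dual space,
  which a degenerate polar form lacks.\<close>

lemma functional_representation:
  assumes "finite S"
  shows "Vector_Spaces.linear (*s) (*) \<phi> \<Longrightarrow> (\<And>y. (\<And>s. s \<in> S \<Longrightarrow> b y s = 0) \<Longrightarrow> \<phi> y = 0) \<Longrightarrow>
    \<exists>s\<in>vec.span S. \<forall>y. \<phi> y = b y s"
  using assms
proof (induction S arbitrary: \<phi> rule: finite_induct)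
  case empty
  then show ?case by (auto simp: bilin)
next
  case (insert u S)
  interpret \<phi>: Vector_Spaces.linear "(*s)" "(*)" \<phi> by (rule insert.prems(1))
  show ?case
  proof (cases "\<forall>y. (\<forall>s\<in>S. b y s = 0) \<longrightarrow> b y u = 0")
    case True
    then have "\<exists>s\<in>vec.span S. \<forall>y. \<phi> y = b y s"
      using insert.prems by (intro insert.IH) auto
    then show ?thesis using vec.span_mono[of S "insert u S"] by blast
  next
    case False
    then obtain x where x: "\<And>s. s \<in> S \<Longrightarrow> b x s = 0" "b x u \<noteq> 0" by blast
    define c where "c = \<phi> x / b x u"
    have "Vector_Spaces.linear (*s) (*) (\<lambda>y. \<phi> y - c * b y u)"
      by unfold_locales (simp_all add: \<phi>.add \<phi>.scale bilin algebra_simps)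
    moreover have "\<phi> y - c * b y u = 0" if y: "\<And>s. s \<in> S \<Longrightarrow> b y s = 0" for y
    proof -
      have "\<phi> (y - (b y u / b x u) *s x) = 0"
        using x y by (intro insert.prems(2)) (auto simp: bilin)
      then show ?thesis by (simp add: \<phi>.diff \<phi>.scale c_def field_simps)
    qed
    ultimately obtain s where s: "s \<in> vec.span S" "\<And>y. \<phi> y - c * b y u = b y s"
      using insert.IH by blast
    have "\<phi> y = b y (s + c *s u)" for y
      using s(2)[of y] by (simp add: bilin algebra_simps)
    moreover have "s + c *s u \<in> vec.span (insert u S)"
      by (rule vec.span_add[OF subsetD[OF vec.span_mono s(1)] vec.span_scale[OF vec.span_base]]) auto
    ultimately show ?thesis by blast
  qed
qed

end

text \<open>\<open>\<epsilon>\<close> is the sign of symmetry of \<open>b\<close>. By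
  \<open>singular_combination\<close> any two vectors have a singular nontrivial combination, which
  bounds anisotropic parts by dimension one; by \<open>radical\<close> the radical of
  \<open>b\<close> has no nonzero singular vector.\<close>

locale form_space = bilinear_space b for b :: "'a::alg_closed_field ^ 'n \<Rightarrow> 'a ^ 'n \<Rightarrow> 'a" +
  fixes q :: "'a ^ 'n \<Rightarrow> 'a" and \<epsilon> :: 'a and adm :: "'a ^ 'n \<Rightarrow> 'a \<Rightarrow> bool"
    and G :: "('a ^ 'n ^ 'n) set"
  assumes b_swap: "b y x = \<epsilon> * b x y"
    and q_scale: "q (c *s x) = c\<^sup>2 * q x"
    and q_add: "b x y = 0 \<Longrightarrow> q (x + y) = q x + q y"
    and q_b: "q x = 0 \<Longrightarrow> b x x = 0"
    and singular_combination: "\<exists>c d. (c \<noteq> 0 \<or> d \<noteq> 0) \<and> q (c *s x + d *s y) = 0"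
    and radical: "(\<And>y. b x y = 0) \<Longrightarrow> q x = 0 \<Longrightarrow> x = 0"
    and subgroup_G: "subgroup G GL"
    and isometry: "g \<in> G \<Longrightarrow> b (g *v x) (g *v y) = b x y" "g \<in> G \<Longrightarrow> q (g *v x) = q x"
    and adm_ex: "\<exists>a. adm x a"
    and adm_scale: "adm x a \<Longrightarrow> adm (t *s x) (t\<^sup>2 * a)"
    and siegel_in: "q u = 0 \<Longrightarrow> b x u = 0 \<Longrightarrow> adm x a \<Longrightarrow> siegel b u x a \<in> G"
begin

lemma b_swap_zero: "b x y = 0 \<longleftrightarrow> b y x = 0"
  using b_swap[of x y] b_swap[of y x] by auto

definition totally_singular :: "('a ^ 'n) set \<Rightarrow> bool" where
  "totally_singular U \<longleftrightarrow> vec.subspace U \<and> (\<forall>x\<in>U. q x = 0) \<and> (\<forall>x\<in>U. \<forall>y\<in>U. b x y = 0)"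

lemma totally_singular_subset:
  "totally_singular M \<Longrightarrow> vec.subspace U \<Longrightarrow> U \<subseteq> M \<Longrightarrow> totally_singular U"
  by (auto simp: totally_singular_def)

lemma totally_singular_perp: "totally_singular U \<Longrightarrow> U \<subseteq> perp U"
  by (auto simp: totally_singular_def perp_def)

lemma totally_singular_insert:
  assumes M: "totally_singular M" and w: "w \<in> perp M" "q w = 0"
  shows "totally_singular (vec.span (insert w M))"
proof -
  have spn: "vec.span M = M" and M': "vec.subspace M" using M by (auto simp: totally_singular_def)
  have dec: "\<exists>c m. m \<in> M \<and> x = c *s w + m" if x: "x \<in> vec.span (insert w M)" for x
  proof -
    obtain c where "x - c *s w \<in> M" using x vec.span_breakdown_eq spn by metis
    then show ?thesis by (intro exI[of _ c] exI[of _ "x - c *s w"]) simp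
  qed
  have wM: "b w m = 0" "b m w = 0" if "m \<in> M" for m using w that b_swap_zero by (auto simp: perp_def)
  have q0: "q x = 0" if x: "x \<in> vec.span (insert w M)" for x
  proof -
    obtain c m where "m \<in> M" "x = c *s w + m" using dec[OF x] by blast
    then show ?thesis using M w wM by (simp add: q_add q_scale bilin totally_singular_def)
  qed
  moreover have "b x y = 0" if x: "x \<in> vec.span (insert w M)" and y: "y \<in> vec.span (insert w M)" for x y
  proof -
    obtain c m where "m \<in> M" "x = c *s w + m" using dec[OF x] by blast
    moreover obtain d l where "l \<in> M" "y = d *s w + l" using dec[OF y] by blast
    ultimately show ?thesis using M wM q_b[OF w(2)] by (simp add: bilin totally_singular_def)
  qed
  ultimately show ?thesis unfolding totally_singular_def using vec.subspace_span by blast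
qed

text \<open>The functional of \<open>v\<close> vanishes wherever those of a basis of
  \<open>X\<close> do, so it is the functional of an element of \<open>X\<close>; the difference
  lies in the radical.\<close>

lemma perp_perp:
  assumes X: "vec.subspace X" shows "perp (perp X) \<subseteq> plus_radical X"
proof
  fix v assume v: "v \<in> perp (perp X)"
  obtain B where B: "B \<subseteq> X" "vec.independent B" "X \<subseteq> vec.span B"
    using vec.basis_exists by metis
  have "vec.span B = X" using vec.span_minimal[OF B(1) X] B(3) by blast
  moreover have "finite B" using vec.finiteI_independent[OF B(2)] .
  ultimately obtain s where s: "s \<in> X" "\<And>y. b y v = b y s"
  proof -
    have "\<exists>s\<in>vec.span B. \<forall>y. b y v = b y s"
    proof (rule functional_representation[OF \<open>finite B\<close> linear_left])
      fix y assume "\<And>s. s \<in> B \<Longrightarrow> b y s = 0"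
      then have "b y x = 0" if "x \<in> X" for x
        using right.eq_0_on_span[of B y x] B(3) that by blast
      then have "y \<in> perp X" by (simp add: perp_def)
      then show "b y v = 0" using v b_swap_zero by (auto simp: perp_def)
    qed
    then show ?thesis using that \<open>vec.span B = X\<close> by blast
  qed
  then have "b y (v - s) = 0" for y by (simp add: bilin)
  then have "b (v - s) y = 0" for y using b_swap_zero by blast
  then show "v \<in> plus_radical X" using s(1) by (auto simp: plus_radical_def)
qed

text \<open>\<open>q\<close> is additive along the radical and anisotropic on it, so a singular
  vector has no radical component.\<close>

lemma singular_plus_radical:
  assumes X: "totally_singular X" and v: "v \<in> plus_radical X" "q v = 0"
  shows "v \<in> X"
proof -
  obtain x where x: "x \<in> X" "\<And>y. b (v - x) y = 0" using v(1) by (auto simp: plus_radical_def)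
  have "q (v - x + x) = q (v - x) + q x" by (rule q_add) (rule x(2))
  then have "q (v - x) = 0" using v(2) X x(1) by (simp add: totally_singular_def)
  then have "v - x = 0" by (rule radical[OF x(2)])
  then show ?thesis using x(1) by simp
qed

lemma adjoint:
  assumes "H \<subseteq> G" "subgroup H GL" "g \<in> H"
  obtains g' where "g' \<in> H" "g ** g' = mat 1" "g' ** g = mat 1" "\<forall>x y. b (g *v x) y = b x (g' *v y)"
proof -
  obtain g' where g': "g' \<in> H" "g ** g' = mat 1" "g' ** g = mat 1"
    using subgroup_GL_inverse[OF assms(2,3)] by blast
  have "b (g *v x) y = b x (g' *v y)" for x y
    using isometry(1)[of g x "g' *v y"] assms(1,3) g'(2) by (auto simp: mult_inverse_vector)
  then show ?thesis using that g' by blast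
qed

lemma stable_perp:
  assumes H: "H \<subseteq> G" "subgroup H GL" and U: "stable H U"
  shows "stable H (perp U)"
  unfolding stable_def
proof (intro ballI)
  fix g v assume g: "g \<in> H" and v: "v \<in> perp U"
  obtain g' where "g' \<in> H" "g ** g' = mat 1" "g' ** g = mat 1" "\<forall>x y. b (g *v x) y = b x (g' *v y)"
    by (rule adjoint[OF H g])
  then show "g *v v \<in> perp U" using v stableD[OF U] by (auto simp: perp_def)
qed

lemma stable_plus_radical:
  assumes H: "H \<subseteq> G" "subgroup H GL" and U: "stable H U"
  shows "stable H (plus_radical U)"
  unfolding stable_def
proof (intro ballI)
  fix g v assume g: "g \<in> H" and v: "v \<in> plus_radical U"
  obtain x where x: "x \<in> U" "\<And>y. b (v - x) y = 0" using v by (auto simp: plus_radical_def)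
  obtain g' where "g' \<in> H" "g ** g' = mat 1" "g' ** g = mat 1" "\<forall>x y. b (g *v x) y = b x (g' *v y)"
    by (rule adjoint[OF H g])
  then have "b (g *v v - g *v x) y = 0" for y
    using x(2)[of "g' *v y"] by (simp flip: matrix_vector_mult_diff_distrib)
  then show "g *v v \<in> plus_radical U" using stableD[OF U g x(1)] by (auto simp: plus_radical_def)
qed

text \<open>One step of the flag: a line fixed modulo \<open>V + rad\<close> inside \<open>perp V\<close> is forced by the Siegel
  elements to be the one spanned by \<open>u\<close>, unless it is not orthogonal to \<open>u\<close>.\<close>

lemma flag_step:
  assumes H: "subgroup H GL" "connectedin zariski H" "solvable (GL\<lparr>carrier := H\<rparr>)" "H \<subseteq> G"
    and V: "totally_singular V" "stable H V" and u: "u \<notin> V" "totally_singular (vec.span (insert u V))"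
    and S: "\<And>x a. x \<in> perp (vec.span (insert u V)) \<Longrightarrow> adm x a \<Longrightarrow> siegel b u x a \<in> H"
    and exceptional: "\<And>v. v \<in> perp V \<Longrightarrow> b v u \<noteq> 0 \<Longrightarrow>
      (\<And>h. h \<in> H \<Longrightarrow> \<exists>c. h *v v - c *s v \<in> plus_radical V) \<Longrightarrow> stable H (vec.span (insert u V))"
  shows "stable H (vec.span (insert u V))"
proof -
  let ?W = "plus_radical V" and ?V' = "vec.span (insert u V)"
  have Vs: "vec.subspace V" using V by (simp add: totally_singular_def)
  have W: "vec.subspace ?W" "stable H ?W"
    using subspace_plus_radical[OF Vs] stable_plus_radical[OF H(4,1) V(2)] .
  have uV': "u \<in> ?V'" and VV': "V \<subseteq> ?V'" by (auto intro: vec.span_base)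
  have uu: "q u = 0" "b u u = 0" "u \<in> perp V"
    using u(2) uV' VV' by (auto simp: totally_singular_def perp_def)
  have "plus_radical V \<subseteq> perp V"
  proof
    fix w assume "w \<in> plus_radical V"
    then obtain x where "x \<in> V" "\<And>y. b (w - x) y = 0" by (auto simp: plus_radical_def)
    then show "w \<in> perp V" using V(1) by (auto simp: perp_def bilin totally_singular_def)
  qed
  moreover have uW: "u \<notin> ?W" using singular_plus_radical[OF V(1)] uu u(1) by blast
  then have "?W \<noteq> perp V" using uu by blast
  ultimately obtain v where v: "v \<in> perp V" "v \<notin> ?W" "\<And>h. h \<in> H \<Longrightarrow> \<exists>c. h *v v - c *s v \<in> ?W"
    using lie_kolchin[OF H(1-3) subspace_perp stable_perp[OF H(4,1) V(2)] W] by blast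
  show ?thesis
  proof (cases "b v u = 0")
    case False
    then show ?thesis using exceptional[OF v(1) _ v(3)] by blast
  next
    case True
    \<comment> \<open>If some \<open>x\<close> orthogonal to \<open>?V'\<close> is not orthogonal to
      \<open>v\<close>, its Siegel element shifts \<open>v\<close> by a multiple of
      \<open>u\<close>, so the fixed line is that of \<open>u\<close>. Otherwise \<open>v\<close>
      lies in the double orthogonal of \<open>?V'\<close>, that is in \<open>?V'\<close> plus the
      radical.\<close>
    have "\<exists>k. k \<noteq> 0 \<and> v - k *s u \<in> ?W"
    proof (cases "\<exists>x\<in>perp ?V'. b x v \<noteq> 0")
      case True
      then obtain x where x: "x \<in> perp ?V'" "b x v \<noteq> 0" by blast
      obtain a where a: "adm x a" using adm_ex by blast
      have "siegel b u x a *v v = v - b x v *s u"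
        using \<open>b v u = 0\<close> by (simp add: siegel_mult)
      then obtain c where c: "v - b x v *s u - c *s v \<in> ?W" using v(3)[OF S[OF x(1) a]] by auto
      then have c': "(1 - c) *s v - b x v *s u \<in> ?W"
        by (simp add: vec.scale_left_diff_distrib algebra_simps)
      have "c \<noteq> 1"
      proof
        assume "c = 1"
        then have "(- b x v) *s u \<in> ?W" using c' by simp
        then show False using subspace_scale_cancel[OF W(1)] x(2) uW by fastforce
      qed
      have "inverse (1 - c) *s ((1 - c) *s v - b x v *s u) \<in> ?W"
        using c' vec.subspace_scale[OF W(1)] by blast
      then have "v - (b x v / (1 - c)) *s u \<in> ?W"
        unfolding vec.scale_right_diff_distrib vec.scale_scale
        using \<open>c \<noteq> 1\<close> by (simp add: divide_inverse mult.commute)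
      then show ?thesis using x(2) \<open>c \<noteq> 1\<close> by (intro exI[of _ "b x v / (1 - c)"]) simp
    next
      case False
      then have "v \<in> perp (perp ?V')" using b_swap_zero by (auto simp: perp_def)
      then have "v \<in> plus_radical ?V'" using perp_perp[OF vec.subspace_span] by blast
      then obtain x where x: "x \<in> ?V'" "\<And>y. b (v - x) y = 0" by (auto simp: plus_radical_def)
      have spn: "vec.span V = V" using Vs by simp
      obtain k where k: "x - k *s u \<in> V" using x(1) vec.span_breakdown_eq spn by metis
      have mem: "v - k *s u \<in> ?W"
        unfolding plus_radical_def using k x(2) by (auto intro!: bexI[of _ "x - k *s u"])
      moreover have "k \<noteq> 0" using mem v(2) by auto
      ultimately show ?thesis by blast
    qed
    then obtain k where k: "k \<noteq> 0" "v - k *s u \<in> ?W" by blast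
    show ?thesis
    proof (rule stable_span_insert[OF Vs V(2)])
      fix h assume h: "h \<in> H"
      obtain c where c: "h *v v - c *s v \<in> ?W" using v(3)[OF h] by blast
      have "h *v (v - k *s u) \<in> ?W" using stableD[OF W(2) h k(2)] .
      then have "(h *v v - c *s v) - h *v (v - k *s u) + c *s (v - k *s u) \<in> ?W"
        by (rule vec.subspace_add[OF W(1) vec.subspace_diff[OF W(1) c] vec.subspace_scale[OF W(1) k(2)]])
      moreover have "(h *v v - c *s v) - h *v (v - k *s u) + c *s (v - k *s u) = k *s (h *v u - c *s u)"
        by (simp add: matrix_scale_diff vec.scale_right_diff_distrib mult.commute)
      ultimately have hW: "h *v u - c *s u \<in> ?W" using subspace_scale_cancel[OF W(1)] k(1) by simp
      \<comment> \<open>So far the line of \<open>u\<close> is fixed only modulo \<open>V\<close>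
        plus the radical; \<open>h *v u - c *s u\<close> turns out singular, which removes the
        radical component.\<close>
      have q0: "q (h *v u) = 0" using isometry(2)[of h u] h H(4) uu by auto
      have "b (h *v u) u = 0"
      proof -
        obtain x where x: "x \<in> V" "\<And>y. b (h *v u - c *s u - x) y = 0"
          using hW by (auto simp: plus_radical_def)
        then show ?thesis using x(2)[of u] uu b_swap_zero by (auto simp: bilin perp_def)
      qed
      then have "q (h *v u + (- c) *s u) = 0"
        using q_add[of "h *v u" "(- c) *s u"] q0 uu by (simp only: bilin q_scale) simp
      then have "h *v u - c *s u \<in> V"
        using singular_plus_radical[OF V(1) hW] by simp
      then show "\<exists>c. h *v u - c *s u \<in> V" ..
    qed
  qed
qed

lemma siegel_curve_in_identity_component:
  assumes u: "q u = 0" "b x u = 0" "adm x a" and S: "\<And>t. siegel b u (t *s x) (t\<^sup>2 * a) \<in> S"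
  shows "siegel b u x a \<in> identity_component S"
proof -
  let ?\<gamma> = "\<lambda>t. siegel b u (t *s x) (t\<^sup>2 * a)"
  have "?\<gamma> 0 *v v = mat 1 *v v" for v by (simp add: siegel_mult bilin)
  then have "?\<gamma> 0 = mat 1" unfolding matrix_eq by blast
  then have "mat 1 \<in> range ?\<gamma>" by (rule range_eqI[OF sym])
  moreover have "connectedin zariski (range ?\<gamma>)"
    by (rule connectedin_polynomial_curve) (rule siegel_curve_entry)
  ultimately have "range ?\<gamma> \<subseteq> identity_component S"
    using S by (intro identity_component_maximal) auto
  then have "siegel b u (1 *s x) (1\<^sup>2 * a) \<in> identity_component S" by blast
  then show ?thesis by simp
qed

text \<open>Maximal dimension leaves no singular vector of \<open>perp M\<close> outside
  \<open>M\<close>; since two vectors always have a singular combination, \<open>perp M\<close>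
  exceeds \<open>M\<close> by at most a line.\<close>

lemma maximal_totally_singular:
  assumes "totally_singular U"
  obtains M x where "U \<subseteq> M" "totally_singular M" "perp M \<subseteq> vec.span (insert x M)"
proof -
  let ?P = "\<lambda>M. U \<subseteq> M \<and> totally_singular M"
  have "\<exists>M. ?P M \<and> (\<forall>N. ?P N \<longrightarrow> vec.dim N \<le> vec.dim M)"
    using assms
    by (intro ex_has_greatest_nat[of ?P U vec.dim "Suc CARD('n)"])
      (simp_all add: less_Suc_eq_le dim_subset_UNIV_cart_gen)
  then obtain M where M: "U \<subseteq> M" "totally_singular M" "\<And>N. ?P N \<Longrightarrow> vec.dim N \<le> vec.dim M" by blast
  have Ms: "vec.subspace M" using M(2) by (simp add: totally_singular_def)
  have max: "w \<in> M" if w: "w \<in> perp M" "q w = 0" for w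
  proof -
    have sub: "M \<subseteq> vec.span (insert w M)" by (auto intro: vec.span_base)
    then have "vec.dim (vec.span (insert w M)) \<le> vec.dim M"
      using M(1) totally_singular_insert[OF M(2) w] by (intro M(3)) blast
    then have "M = vec.span (insert w M)"
      using sub by (intro vec.subspace_dim_equal Ms vec.subspace_span)
    then show ?thesis using vec.span_base[of w "insert w M"] by blast
  qed
  show ?thesis
  proof (cases "perp M \<subseteq> M")
    case True
    then show ?thesis using that[of M 0] M by (auto simp: vec.span_insert_0 intro: vec.span_base)
  next
    case False
    then obtain x where x: "x \<in> perp M" "x \<notin> M" by blast
    have "perp M \<subseteq> vec.span (insert x M)"
    proof
      fix y assume y: "y \<in> perp M"
      obtain c d where cd: "c \<noteq> 0 \<or> d \<noteq> 0" "q (c *s x + d *s y) = 0" using singular_combination by blast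
      have mem: "c *s x + d *s y \<in> M"
        using x y cd(2) by (intro max vec.subspace_add vec.subspace_scale subspace_perp)
      have "d \<noteq> 0"
      proof
        assume "d = 0"
        then show False using mem cd(1) subspace_scale_cancel[OF Ms, of c x] x(2) by simp
      qed
      have "d *s y = (c *s x + d *s y) - c *s x" by simp
      also have "\<dots> \<in> vec.span (insert x M)"
        using mem by (intro vec.span_diff vec.span_scale vec.span_base) auto
      finally show "y \<in> vec.span (insert x M)"
        using subspace_scale_cancel[OF vec.subspace_span _ \<open>d \<noteq> 0\<close>] by blast
    qed
    then show ?thesis using that M by blast
  qed
qed

end

text \<open>What the two families prove differently. \<open>exceptional\<close> treats a fixed line
  not orthogonal to \<open>u\<close>, contradictory in the symplectic case and a matter of
  connectedness in the orthogonal one; \<open>moves\<close> makes the stabilizers proper.\<close>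

locale classical_form_space = form_space +
  assumes exceptional: "\<lbrakk>subgroup H GL; connectedin zariski H; H \<subseteq> G; totally_singular V; stable H V;
      u \<notin> V; totally_singular (vec.span (insert u V));
      \<And>x a. x \<in> perp (vec.span (insert u V)) \<Longrightarrow> adm x a \<Longrightarrow> siegel b u x a \<in> H;
      v \<in> perp V; b v u \<noteq> 0; \<And>h. h \<in> H \<Longrightarrow> \<exists>c. h *v v - c *s v \<in> plus_radical V\<rbrakk> \<Longrightarrow>
      stable H (vec.span (insert u V))"
    and moves: "totally_singular U \<Longrightarrow> u \<in> U \<Longrightarrow> u \<noteq> 0 \<Longrightarrow> \<exists>g\<in>G. g *v u \<notin> U"
begin

text \<open>The flag climbs through \<open>U\<close> to a maximal totally singular \<open>M\<close>
  and continues with orthogonals, the middle step having dimension at most one. Stability is proved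
  for the lower half and inherited by orthogonals.\<close>

lemma parabolic_stabilizer:
  assumes U: "totally_singular U"
  shows "parabolic_subgroup G (stabilizer G {U})"
proof -
  obtain M x where M: "U \<subseteq> M" "totally_singular M" "perp M \<subseteq> vec.span (insert x M)"
    using maximal_totally_singular[OF U] .
  have Us: "vec.subspace U" and Ms: "vec.subspace M" using U M by (auto simp: totally_singular_def)
  obtain V z k m where flag: "\<forall>i. vec.subspace (V i)" "V 0 = {0}" "V k = U" "k \<le> m"
    "\<forall>i\<ge>m. V i = M" "\<forall>i. V (Suc i) = vec.span (insert (z i) (V i))"
    "\<forall>i j. i \<le> j \<longrightarrow> V i \<subseteq> V j" "\<forall>i. V i \<subseteq> M"
    by (rule flag_through[OF Us Ms M(1)])
  then have V: "\<And>i. vec.subspace (V i)" "V 0 = {0}" "V k = U" "k \<le> m" "\<And>i. i \<ge> m \<Longrightarrow> V i = M"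
    "\<And>i. V (Suc i) = vec.span (insert (z i) (V i))" "\<And>i j. i \<le> j \<Longrightarrow> V i \<subseteq> V j" "\<And>i. V i \<subseteq> M"
    by simp_all
  have Vts: "totally_singular (V i)" for i using totally_singular_subset[OF M(2) V(1,8)] .
  \<comment> \<open>The index shift makes \<open>W m = M\<close> be followed by
    \<open>perp M\<close> and puts \<open>perp (V 0) = UNIV\<close> at
    \<open>2 * m + 1\<close>.\<close>
  define W where "W i = (if i \<le> m then V i else perp (V (2 * m + 1 - i)))" for i
  have "parabolic_subgroup G (stabilizer G {W k})"
  proof (rule parabolic_stabilizerI[where W = W and N = "2 * m + 1"])
    show "subgroup G GL" by (rule subgroup_G)
    show "vec.subspace (W i)" for i using V(1) subspace_perp by (simp add: W_def)
    show "W 0 = {0}" using V(2) by (simp add: W_def)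
    show "W (2 * m + 1) = UNIV" using V(2) by (auto simp: W_def perp_def bilin)
    show "W i \<subseteq> W (Suc i)" for i
    proof -
      consider "Suc i \<le> m" | "i = m" | "i > m" by linarith
      then show ?thesis
      proof cases
        case 1
        then show ?thesis using V(7)[of i "Suc i"] by (simp add: W_def)
      next
        case 2
        then show ?thesis using totally_singular_perp[OF Vts[of m]] by (simp add: W_def)
      next
        case 3
        then show ?thesis
          using perp_antimono[OF V(7), of "2 * m + 1 - Suc i" "2 * m + 1 - i"] by (simp add: W_def)
      qed
    qed
    show "\<exists>x. W (Suc i) \<subseteq> vec.span (insert x (W i))" for i
    proof -
      consider "Suc i \<le> m" | "i = m" | "i > m" "2 * m + 1 - i = Suc (2 * m + 1 - Suc i)"
        | "i > m" "2 * m + 1 - i = 2 * m + 1 - Suc i" by linarith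
      then show ?thesis
      proof cases
        case 1
        then show ?thesis using V(6) by (auto simp: W_def)
      next
        case 2
        then show ?thesis using M(3) V(5)[of m] by (auto simp: W_def)
      next
        case 3
        define j where "j = 2 * m + 1 - Suc i"
        have Wi: "W (Suc i) = perp (V j)" "W i = perp (V (Suc j))" using 3 by (auto simp: W_def j_def)
        have mem: "y \<in> perp (V (Suc j))" if "y \<in> perp (V j)" "b y (z j) = 0" for y
          unfolding V(6) by (rule perp_span_insert[OF that])
        show ?thesis
        proof (cases "\<exists>y\<in>perp (V j). b y (z j) \<noteq> 0")
          case True
          then obtain y where y: "y \<in> perp (V j)" "b y (z j) \<noteq> 0" by blast
          have "w \<in> vec.span (insert y (perp (V (Suc j))))" if w: "w \<in> perp (V j)" for w
          proof -
            have "w - (b w (z j) / b y (z j)) *s y \<in> perp (V (Suc j))"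
              using y w by (intro mem vec.subspace_diff vec.subspace_scale subspace_perp) (auto simp: bilin)
            then show ?thesis
              using vec.span_breakdown_eq[of w y "perp (V (Suc j))"] vec.span_base by blast
          qed
          then show ?thesis unfolding Wi by blast
        next
          case False
          then have "perp (V j) \<subseteq> perp (V (Suc j))" using mem by blast
          then show ?thesis unfolding Wi by (intro exI[of _ 0]) (auto intro: vec.span_base)
        qed
      next
        \<comment> \<open>Beyond index \<open>2 * m\<close> both differences are truncated to 0 and
          the flag is constant.\<close>
        case 4
        then have "W (Suc i) = W i" by (simp add: W_def)
        then show ?thesis by (auto intro: vec.span_base)
      qed
    qed
    fix H i
    assume H: "subgroup H GL" "connectedin zariski H" "solvable (GL\<lparr>carrier := H\<rparr>)" "H \<subseteq> G"
      "identity_component (stabilizer G (range W)) \<subseteq> H"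
    \<comment> \<open>These Siegel elements preserve every \<open>V l\<close>: for
      \<open>l \<le> j\<close> they act trivially on it, and for larger \<open>l\<close> they
      displace by multiples of \<open>u\<close>, which lies in \<open>V l\<close>. So they belong to
      the flag stabilizer, with a curve to 1.\<close>
    have el: "siegel b u x a \<in> H" if u: "u \<in> V j" and x: "x \<in> perp (V j)" and a: "adm x a" for u x a j
    proof -
      have qu: "q u = 0" "b x u = 0" using Vts u x by (auto simp: totally_singular_def perp_def)
      have uM: "u \<in> M" using u V(8) by blast
      have inG: "siegel b u (t *s x) (t\<^sup>2 * a) \<in> G" for t
        using siegel_in[of u "t *s x"] qu adm_scale[OF a] by (simp add: bilin)
      have stV: "siegel b u (t *s x) (t\<^sup>2 * a) *v w \<in> V l" if w: "w \<in> V l" for t w l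
      proof -
        have "w \<in> M" using w V(8) by blast
        then have wu: "b w u = 0" using uM M(2) by (simp add: totally_singular_def)
        then have eq: "siegel b u (t *s x) (t\<^sup>2 * a) *v w = w - (t * b x w) *s u"
          by (simp add: siegel_mult bilin)
        show ?thesis
        proof (cases "l \<le> j")
          case True
          then have "b x w = 0" using x w V(7) by (auto simp: perp_def)
          then show ?thesis using w eq by simp
        next
          case False
          then have "u \<in> V l" using u V(7)[of j l] by auto
          then show ?thesis unfolding eq by (intro vec.subspace_diff[OF V(1) w] vec.subspace_scale[OF V(1)])
        qed
      qed
      have "siegel b u (t *s x) (t\<^sup>2 * a) \<in> stabilizer G (range W)" for t
      proof -
        let ?g = "siegel b u (t *s x) (t\<^sup>2 * a)"
        let ?K = "stabilizer G (range V)"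
        have K: "subgroup ?K GL" "?K \<subseteq> G" "?g \<in> ?K"
          using subgroup_stabilizer[OF subgroup_G, of "range V"] V(1) inG stV
          by (auto simp: stabilizer_def)
        have "stable ?K (V l)" for l by (auto simp: stable_def stabilizer_def)
        then have "stable ?K (W l)" for l using stable_perp[OF K(2,1)] by (simp add: W_def)
        then show ?thesis using K inG by (auto simp: stabilizer_def[of G "range W"] stable_def)
      qed
      then show ?thesis
        using siegel_curve_in_identity_component[OF qu a, of "stabilizer G (range W)"] H(5) by blast
    qed
    have Vst: "stable H (V j)" for j
    proof (induction j)
      case 0
      then show ?case using V(2) by (simp add: stable_def)
    next
      case (Suc j)
      show ?case
      proof (cases "z j \<in> V j")
        case True
        then show ?thesis using Suc V(6)[of j] span_insert_member[OF V(1)] by simp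
      next
        case False
        have ts: "totally_singular (vec.span (insert (z j) (V j)))" using Vts[of "Suc j"] V(6) by simp
        have S: "siegel b (z j) x a \<in> H" if "x \<in> perp (vec.span (insert (z j) (V j)))" "adm x a" for x a
          using el[of "z j" "Suc j" x a] that unfolding V(6) by (simp add: vec.span_base)
        have "stable H (vec.span (insert (z j) (V j)))"
        proof (rule flag_step[OF H(1-4) Vts Suc False ts])
          fix v assume "v \<in> perp (V j)" "b v (z j) \<noteq> 0"
            "\<And>h. h \<in> H \<Longrightarrow> \<exists>c. h *v v - c *s v \<in> plus_radical (V j)"
          then show "stable H (vec.span (insert (z j) (V j)))"
            by (intro exceptional[OF H(1,2,4) Vts Suc False ts, of v] S)
        qed (rule S)
        then show ?thesis unfolding V(6) .
      qed
    qed
    then show "stable H (W i)" using stable_perp[OF H(4,1)] by (simp add: W_def)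
  qed
  then show ?thesis using V(3,4) by (simp add: W_def)
qed

theorem irreducible_totally_singular:
  assumes "irreducible_in G C" "C \<subseteq> G" "totally_singular U" "stable C U"
  shows "U = {0}"
proof (rule ccontr)
  assume "U \<noteq> {0}"
  then obtain u where u: "u \<in> U" "u \<noteq> 0"
    using assms(3) vec.subspace_0 by (auto simp: totally_singular_def)
  then obtain g where "g \<in> G" "g *v u \<notin> U" using moves[OF assms(3)] by blast
  then show False
    using irreducible_not_stable[OF assms(1) parabolic_stabilizer[OF assms(3)] assms(2) _ u(1)] assms(4)
    by blast
qed

end

section \<open>The symplectic and special orthogonal groups\<close>

lemma invertible_if_injective:
  fixes g :: "'a::field ^ 'n ^ 'n"
  assumes "\<And>v. g *v v = 0 \<Longrightarrow> v = 0"
  shows "invertible g"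
proof -
  have "inj ((*v) g)"
    by (rule injI) (metis assms eq_iff_diff_eq_0 matrix_vector_mult_diff_distrib)
  then obtain B where "B ** g = mat 1"
    using matrix_left_invertible_injective by blast
  then show ?thesis
    unfolding invertible_def using matrix_left_right_inverse by blast
qed

lemma subgroup_isometries:
  fixes H :: "('a::field ^ 'n ^ 'n) set"
  assumes one: "mat 1 \<in> H" and mult: "\<And>A B. A \<in> H \<Longrightarrow> B \<in> H \<Longrightarrow> A ** B \<in> H"
    and inv: "\<And>A. A \<in> H \<Longrightarrow> invertible A"
    and "\<And>A B. A \<in> H \<Longrightarrow> A ** B = mat 1 \<Longrightarrow> B ** A = mat 1 \<Longrightarrow> B \<in> H"
  shows "subgroup H GL"
  unfolding subgroup_GL_iff
proof (intro conjI ballI)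
  fix A assume A: "A \<in> H"
  then obtain B where "A ** B = mat 1" "B ** A = mat 1" using inv unfolding invertible_def by blast
  then show "\<exists>B\<in>H. A ** B = mat 1 \<and> B ** A = mat 1" using assms(4) A by blast
qed (use one mult in auto)

locale symplectic_space =
  fixes b :: "'a::alg_closed_field ^ 'n \<Rightarrow> 'a ^ 'n \<Rightarrow> 'a"
  assumes symplectic: "symplectic_form b"
begin

sublocale bilinear_space b
  by unfold_locales (use symplectic in \<open>simp add: symplectic_form_def\<close>)

lemma alternating: "b x x = 0"
  using symplectic by (simp add: symplectic_form_def)

lemma nondegenerate: "(\<And>y. b x y = 0) \<Longrightarrow> x = 0"
  using symplectic by (simp add: symplectic_form_def nondegenerate_on_def)

lemma skew: "b y x = - b x y"
proof -
  have "b (x + y) (x + y) = b x x + b x y + (b y x + b y y)"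
    by (simp only: bilin ac_simps)
  then have "b y x + b x y = 0" by (simp add: alternating add.commute)
  then show ?thesis by (rule eq_neg_iff_add_eq_0[THEN iffD2])
qed

lemma invertible_isometry:
  assumes "\<And>x y. b (g *v x) (g *v y) = b x y"
  shows "invertible g"
proof (rule invertible_if_injective)
  fix v assume "g *v v = 0"
  then have "b v y = 0" for y using assms[of v y] by (simp add: bilin)
  then show "v = 0" by (rule nondegenerate)
qed

lemma Sp_iff: "g \<in> Sp b \<longleftrightarrow> (\<forall>x y. b (g *v x) (g *v y) = b x y)"
  using invertible_isometry unfolding Sp_def by blast

lemma subgroup_Sp: "subgroup (Sp b) GL"
proof (rule subgroup_isometries)
  fix A B assume A: "A \<in> Sp b"
  show "A ** B \<in> Sp b" if "B \<in> Sp b"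
    using A that by (simp add: Sp_iff flip: matrix_vector_mul_assoc)
  show "invertible A" using A by (simp add: Sp_def)
  assume "A ** B = mat 1"
  then have "A *v (B *v x) = x" for x by (rule mult_inverse_vector)
  then show "B \<in> Sp b" using A unfolding Sp_iff by metis
qed (simp add: Sp_iff)

sublocale form_space b "\<lambda>_. 0" "-1" "\<lambda>_ _. True" "Sp b"
proof (intro form_space.intro form_space_axioms.intro bilinear_space_axioms)
  show "b y x = - 1 * b x y" for x y unfolding mult_minus1 by (rule skew)
  show "\<exists>(c :: 'a) (d :: 'a). (c \<noteq> 0 \<or> d \<noteq> 0) \<and> (0::'a) = 0" for x y :: "'a ^ 'n"
    by (intro exI[of _ 1]) simp
  show "subgroup (Sp b) GL" by (rule subgroup_Sp)
  show "siegel b u x a \<in> Sp b" if "b x u = 0" for u x a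
    unfolding Sp_iff siegel_mult
  proof (intro allI)
    fix v w
    show "b (v + b v u *s x - b x v *s u + (a * b v u) *s u) (w + b w u *s x - b x w *s u + (a * b w u) *s u) = b v w"
      using that skew[of x u] skew[of x v] skew[of w u] by (simp add: bilin alternating algebra_simps)
  qed
qed (auto simp: alternating Sp_iff intro: nondegenerate)

sublocale classical_form_space b "\<lambda>_. 0" "-1" "\<lambda>_ _. True" "Sp b"
proof
  fix H V u v
  assume V: "totally_singular V" and u: "u \<notin> V" "totally_singular (vec.span (insert u V))"
    and S: "\<And>x a. x \<in> perp (vec.span (insert u V)) \<Longrightarrow> True \<Longrightarrow> siegel b u x a \<in> H"
    and v: "v \<in> perp V" "b v u \<noteq> 0" "\<And>h. h \<in> H \<Longrightarrow> \<exists>c. h *v v - c *s v \<in> plus_radical V"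
  have pr: "plus_radical V \<subseteq> V"
    using nondegenerate by (force simp: plus_radical_def)
  have Vs: "vec.subspace V" using V by (simp add: totally_singular_def)
  \<comment> \<open>With \<open>x = 0\<close> this is the transvection along \<open>u\<close>.
    Pairing with \<open>u\<close>, which is orthogonal to \<open>V\<close>, shows that its factor on
    \<open>v\<close> is 1, and then \<open>u\<close> would lie in \<open>V\<close>: the case is
    contradictory.\<close>
  have "siegel b u 0 1 \<in> H" by (rule S) (simp_all add: perp_def bilin)
  then obtain c where c: "siegel b u 0 1 *v v - c *s v \<in> V" using v(3) pr by blast
  have bV: "b x u = 0" if "x \<in> V" for x
  proof -
    have "x \<in> vec.span (insert u V)" "u \<in> vec.span (insert u V)" using that by (auto intro: vec.span_base)
    then show ?thesis using u(2) by (simp add: totally_singular_def)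
  qed
  have "(1 - c) * b v u = 0"
    using bV[OF c] by (simp add: siegel_mult bilin alternating algebra_simps)
  then have "c = 1" using v(2) by simp
  then have "b v u *s u \<in> V" using c by (simp add: siegel_mult bilin)
  then have "u \<in> V" using subspace_scale_cancel[OF Vs] v(2) by blast
  then show "stable H (vec.span (insert u V))" using u(1) by blast
next
  fix U u assume U: "totally_singular U" "u \<in> U" "u \<noteq> 0"
  then obtain w where w: "b u w \<noteq> 0" using nondegenerate by blast
  have Us: "vec.subspace U" using U by (simp add: totally_singular_def)
  \<comment> \<open>The transvection along a vector \<open>w\<close> not orthogonal to
    \<open>u\<close> shifts \<open>u\<close> by a multiple of \<open>w\<close>, and \<open>w\<close>
    is outside the isotropic \<open>U\<close>.\<close>
  have "siegel b w 0 1 \<in> Sp b" by (rule siegel_in) (simp_all add: bilin)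
  moreover have "siegel b w 0 1 *v u \<notin> U"
  proof
    assume "siegel b w 0 1 *v u \<in> U"
    then have "siegel b w 0 1 *v u - u \<in> U" using vec.subspace_diff[OF Us] U(2) by blast
    then have "b u w *s w \<in> U" by (simp add: siegel_mult bilin)
    then have "w \<in> U" using subspace_scale_cancel[OF Us] w by blast
    then show False using U w by (simp add: totally_singular_def)
  qed
  ultimately show "\<exists>g\<in>Sp b. g *v u \<notin> U" by blast
qed

end

section \<open>Quadratic spaces in any characteristic\<close>

locale quadratic_space =
  fixes Q :: "'a::alg_closed_field ^ 'n \<Rightarrow> 'a"
  assumes quadratic: "nondegenerate_quadratic_form Q"
begin

abbreviation b where "b \<equiv> polar_form Q"

sublocale bilinear_space b
  by unfold_locales (use quadratic in \<open>simp add: nondegenerate_quadratic_form_def\<close>)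

lemma Q_scale: "Q (c *s x) = c\<^sup>2 * Q x"
  using quadratic by (simp add: nondegenerate_quadratic_form_def)

lemma Q_add: "Q (x + y) = Q x + Q y + b x y"
  by (simp add: polar_form_def)

lemma Q_zero: "Q 0 = 0"
  using Q_scale[of 0 0] by simp

lemma Q_neg: "Q (- x) = Q x"
  using Q_scale[of "-1" x] by simp

lemma Q_diff: "Q (x - y) = Q x + Q y - b x y"
  using Q_add[of x "- y"] by (simp only: Q_neg bilin) simp

lemma polar_commute: "b y x = b x y"
  by (simp add: polar_form_def add.commute)

lemma polar_self: "b x x = 2 * Q x"
proof -
  have "Q (x + x) = 4 * Q x"
    using Q_scale[of 2 x] by (simp flip: mult_2_right vec.scale_left_distrib add: vec.scale_left_distrib[of 1 1, simplified])
  then show ?thesis by (simp add: polar_form_def)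
qed

lemma radical_zero: "(\<And>y. b x y = 0) \<Longrightarrow> Q x = 0 \<Longrightarrow> x = 0"
  using quadratic
  by (simp add: nondegenerate_quadratic_form_def nondegenerate_quadratic_on_def)

lemma polar_isometry:
  assumes "\<And>x. Q (g *v x) = Q x" shows "b (g *v x) (g *v y) = b x y"
  using assms by (simp add: polar_form_def flip: matrix_vector_right_distrib)

lemma invertible_isometry:
  assumes "\<And>x. Q (g *v x) = Q x"
  shows "invertible g"
proof (rule invertible_if_injective)
  fix v assume v: "g *v v = 0"
  show "v = 0"
  proof (rule radical_zero)
    show "b v y = 0" for y using polar_isometry[OF assms, of v y] v by (simp add: bilin)
    show "Q v = 0" using assms[of v] v Q_zero by simp
  qed
qed

lemma GO_iff: "g \<in> GO Q \<longleftrightarrow> (\<forall>x. Q (g *v x) = Q x)"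
  using invertible_isometry unfolding GO_def by blast

lemma subgroup_GO: "subgroup (GO Q) GL"
proof (rule subgroup_isometries)
  fix A B assume A: "A \<in> GO Q"
  show "A ** B \<in> GO Q" if "B \<in> GO Q"
    using A that by (simp add: GO_iff flip: matrix_vector_mul_assoc)
  show "invertible A" using A by (simp add: GO_def)
  assume "A ** B = mat 1"
  then have "A *v (B *v x) = x" for x by (rule mult_inverse_vector)
  then show "B \<in> GO Q" using A unfolding GO_iff by metis
qed (simp add: GO_iff)

lemma SO_subset_GO: "SO Q \<subseteq> GO Q"
  unfolding SO_def using identity_component_subset by auto

lemma subgroup_SO: "subgroup (SO Q) GL"
proof (cases "CHAR('a) = 2")
  case True
  then show ?thesis using subgroup_identity_component[OF subgroup_GO] by (simp add: SO_def)
next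
  case False
  then have SO: "SO Q = {g \<in> GO Q. det g = 1}" by (simp add: SO_def)
  show ?thesis
    unfolding SO
  proof (rule subgroup_isometries)
    fix A B assume A: "A \<in> {g \<in> GO Q. det g = 1}" and AB: "A ** B = mat 1" "B ** A = mat 1"
    have "det A * det B = 1" using AB by (metis det_I det_mul)
    moreover obtain B' where B': "B' \<in> GO Q" "A ** B' = mat 1" "B' ** A = mat 1"
      using subgroup_GL_inverse[OF subgroup_GO] A by blast
    moreover have "B = B'" using AB B' by (metis matrix_mul_assoc matrix_mul_lid matrix_mul_rid)
    ultimately show "B \<in> {g \<in> GO Q. det g = 1}" using A by simp
  qed (use subgroup_GL_one[OF subgroup_GO] subgroup_GL_mult[OF subgroup_GO] in
      \<open>auto simp: det_mul GO_def\<close>)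
qed

lemma siegel_in_GO:
  assumes "Q u = 0" "b x u = 0"
  shows "siegel b u x (- Q x) \<in> GO Q"
  unfolding GO_iff
proof
  fix v
  have "siegel b u x (- Q x) *v v = v + b v u *s x + (- b x v - Q x * b v u) *s u"
    by (simp add: siegel_mult vec.scale_left_diff_distrib)
  then have "Q (siegel b u x (- Q x) *v v) = Q (v + b v u *s x + (- b x v - Q x * b v u) *s u)"
    by simp
  also have "\<dots> = Q v"
    unfolding Q_add Q_scale bilin
    using assms by (simp add: polar_commute[of v x] power2_eq_square algebra_simps)
  finally show "Q (siegel b u x (- Q x) *v v) = Q v" .
qed

text \<open>The curve through 1 serves twice: in characteristic 2 as a connected subset of the
  isometry group, otherwise to keep the determinant constant.\<close>

lemma siegel_in_SO:
  assumes "Q u = 0" "b x u = 0"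
  shows "siegel b u x (- Q x) \<in> SO Q"
proof -
  let ?\<gamma> = "\<lambda>t. siegel b u (t *s x) (t\<^sup>2 * (- Q x))"
  have GO: "?\<gamma> t \<in> GO Q" for t
    using siegel_in_GO[of u "t *s x"] assms by (simp add: bilin Q_scale)
  have "?\<gamma> 0 *v v = mat 1 *v v" for v by (simp add: siegel_mult bilin)
  then have g0: "?\<gamma> 0 = mat 1" unfolding matrix_eq by blast
  have "?\<gamma> 1 \<in> SO Q"
  proof (cases "CHAR('a) = 2")
    case True
    have "mat 1 \<in> range ?\<gamma>" using g0 by (rule range_eqI[OF sym])
    moreover have "connectedin zariski (range ?\<gamma>)"
      by (rule connectedin_polynomial_curve) (rule siegel_curve_entry)
    ultimately have "range ?\<gamma> \<subseteq> identity_component (GO Q)"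
      using GO by (intro identity_component_maximal) auto
    then have "?\<gamma> 1 \<in> identity_component (GO Q)" by blast
    then show ?thesis using True by (simp add: SO_def)
  next
    case False
    have "det (?\<gamma> t) \<noteq> 0" for t using GO[of t] by (simp add: GO_def invertible_det_nz)
    then have "det (?\<gamma> 1) = det (?\<gamma> 0)"
      by (intro det_polynomial_curve_const siegel_curve_entry)
    then show ?thesis using GO[of 1] g0 False by (simp add: SO_def)
  qed
  then show ?thesis by simp
qed

sublocale form_space b Q 1 "\<lambda>x a. a = - Q x" "SO Q"
proof (intro form_space.intro form_space_axioms.intro bilinear_space_axioms)
  show "\<exists>c d. (c \<noteq> 0 \<or> d \<noteq> 0) \<and> Q (c *s x + d *s y) = 0" for x y
  proof (cases "Q x = 0")
    case True
    then show ?thesis by (intro exI[of _ 1] exI[of _ 0]) simp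
  next
    case False
    \<comment> \<open>\<open>Q (c *s x + y)\<close> is a quadratic polynomial in \<open>c\<close>
      with leading coefficient \<open>Q x\<close>.\<close>
    then obtain c where "poly [: Q y, b x y, Q x :] c = 0"
      using alg_closed_imp_poly_has_root[of "[: Q y, b x y, Q x :]"] by auto
    then have "Q (c *s x + 1 *s y) = 0"
      by (simp add: Q_add Q_scale bilin polar_commute[of x y] algebra_simps power2_eq_square)
    then show ?thesis by (intro exI[of _ c] exI[of _ 1]) simp
  qed
  show "subgroup (SO Q) GL" by (rule subgroup_SO)
  show "b (g *v x) (g *v y) = b x y" "Q (g *v x) = Q x" if "g \<in> SO Q" for g x y
    using that SO_subset_GO polar_isometry by (auto simp: GO_iff)
  show "siegel b u x a \<in> SO Q" if "Q u = 0" "b x u = 0" "a = - Q x" for u x a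
    using siegel_in_SO that by simp
qed (auto simp: polar_commute Q_scale Q_add polar_self intro: radical_zero)

text \<open>After scaling to \<open>b u z = 1\<close>, subtracting \<open>Q z\<close> times
  \<open>u\<close> makes \<open>z\<close> singular; no division by 2 occurs.\<close>

lemma hyperbolic_partner:
  assumes "Q u = 0" "b u y \<noteq> 0" "y \<in> X" "u \<in> X" "vec.subspace X"
  obtains f where "f \<in> X" "Q f = 0" "b u f = 1"
proof -
  define z where "z = inverse (b u y) *s y"
  define f where "f = z - Q z *s u"
  have z: "b u z = 1" "z \<in> X" using assms by (auto simp: z_def bilin vec.subspace_scale)
  have "f \<in> X" using z assms by (simp add: f_def vec.subspace_diff vec.subspace_scale)
  moreover have "b u f = 1" using z assms(1) by (simp add: f_def bilin polar_self)
  moreover have "Q f = 0"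
    using z assms(1) polar_commute[of z u] by (simp add: f_def Q_diff Q_scale bilin)
  ultimately show ?thesis using that by blast
qed

end

locale orthogonal_space = quadratic_space Q for Q :: "'a::alg_closed_field ^ 'n \<Rightarrow> 'a" +
  assumes dim_ge_3: "CARD('n) \<ge> 3"
begin

text \<open>A fixed line not orthogonal to \<open>u\<close> forces \<open>perp V\<close> modulo
  \<open>V\<close> to be a hyperbolic plane. Its only singular lines come from \<open>u\<close> and
  \<open>f\<close>, and a connected group containing 1 cannot exchange them.\<close>

sublocale classical_form_space b Q 1 "\<lambda>x a. a = - Q x" "SO Q"
proof
  fix H V u v
  assume H: "subgroup H GL" "connectedin zariski H" "H \<subseteq> SO Q"
    and V: "totally_singular V" "stable H V"
    and u: "u \<notin> V" "totally_singular (vec.span (insert u V))"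
    and S: "\<And>x a. x \<in> perp (vec.span (insert u V)) \<Longrightarrow> a = - Q x \<Longrightarrow> siegel b u x a \<in> H"
    and v: "v \<in> perp V" "b v u \<noteq> 0" "\<And>h. h \<in> H \<Longrightarrow> \<exists>c. h *v v - c *s v \<in> plus_radical V"
  let ?V' = "vec.span (insert u V)"
  have Vs: "vec.subspace V" using V by (simp add: totally_singular_def)
  have W: "vec.subspace (plus_radical V)" by (rule subspace_plus_radical[OF Vs])
  have uV': "u \<in> ?V'" "V \<subseteq> ?V'" by (auto intro: vec.span_base)
  have uu: "Q u = 0" "b u u = 0" "u \<in> perp V"
    using u(2) uV' by (auto simp: totally_singular_def perp_def)
  \<comment> \<open>Pairing with \<open>u\<close> forces the factor of the Siegel element on
    \<open>v\<close> to be 1; what is left of its action is this membership.\<close>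
  have ident: "b v u *s x - (b x v + Q x * b v u) *s u \<in> plus_radical V" if x: "x \<in> perp ?V'" for x
  proof -
    obtain c where c: "siegel b u x (- Q x) *v v - c *s v \<in> plus_radical V" using v(3)[OF S[OF x]] by blast
    have xu: "b x u = 0" using x uV' by (auto simp: perp_def)
    obtain w where w: "w \<in> V" "\<And>y. b (siegel b u x (- Q x) *v v - c *s v - w) y = 0"
      using c by (auto simp: plus_radical_def)
    have "b w u = 0" using w(1) uu(3) polar_commute[of w u] by (simp add: perp_def)
    then have "(1 - c) * b v u = 0"
      using w(2)[of u] xu uu by (simp add: siegel_mult bilin algebra_simps)
    then have "c = 1" using v(2) by simp
    then show ?thesis using c by (simp add: siegel_mult algebra_simps vec.scale_left_distrib)
  qed
  \<comment> \<open>For \<open>x = r\<close> in the radical, the relation puts a nonzero multiple of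
    \<open>u\<close> into \<open>plus_radical V\<close>, which a singular \<open>u\<close> outside
    \<open>V\<close> excludes.\<close>
  have rad: "r = 0" if r: "\<And>y. b r y = 0" for r
  proof (rule ccontr)
    assume "r \<noteq> 0"
    then have Qr: "Q r \<noteq> 0" using radical_zero r by blast
    have "b v u *s r - (b r v + Q r * b v u) *s u \<in> plus_radical V"
      by (rule ident) (simp add: perp_def r)
    then have "b v u *s r - (b v u *s r - (b r v + Q r * b v u) *s u) \<in> plus_radical V"
    proof (rule vec.subspace_diff[OF W, rotated])
      show "b v u *s r \<in> plus_radical V"
        using vec.subspace_0[OF Vs] r by (auto simp: plus_radical_def bilin intro!: bexI[of _ 0])
    qed
    then have "(Q r * b v u) *s u \<in> plus_radical V" using r by simp
    then have "u \<in> plus_radical V" using subspace_scale_cancel[OF W] Qr v(2) by simp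
    then show False using singular_plus_radical[OF V(1) _ uu(1)] u(1) by blast
  qed
  have pr: "plus_radical V \<subseteq> V" using rad by (force simp: plus_radical_def)
  have perpV': "perp ?V' \<subseteq> ?V'"
  proof
    fix x assume x: "x \<in> perp ?V'"
    have "b v u *s x = (b v u *s x - (b x v + Q x * b v u) *s u) + (b x v + Q x * b v u) *s u" by simp
    also have "\<dots> \<in> ?V'"
      using ident[OF x] pr uV' by (intro vec.span_add vec.span_scale) auto
    finally show "x \<in> ?V'" using subspace_scale_cancel[OF vec.subspace_span] v(2) by blast
  qed
  obtain f where f: "f \<in> perp V" "Q f = 0" "b u f = 1"
    using hyperbolic_partner[OF uu(1) _ v(1) uu(3) subspace_perp] v(2) polar_commute[of v u] by metis
  \<comment> \<open>Modulo \<open>V\<close> the vector \<open>g *v u\<close> is a combination of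
    \<open>u\<close> and \<open>f\<close> with coefficients \<open>b (g *v u) f\<close> and
    \<open>b (g *v u) u\<close>. Singularity makes their product zero, invertibility of
    \<open>g\<close> keeps one of them nonzero.\<close>
  have gu: "b (g *v u) u * b (g *v u) f = 0 \<and> (b (g *v u) u = 0 \<longrightarrow> g *v u \<in> ?V')
      \<and> \<not> (b (g *v u) u = 0 \<and> b (g *v u) f = 0)" if g: "g \<in> H" for g
  proof -
    have gp: "g *v u \<in> perp V" using stableD[OF stable_perp[OF H(3,1) V(2)] g uu(3)] .
    let ?y = "g *v u - b (g *v u) u *s f"
    have "?y \<in> perp V" using gp f by (intro vec.subspace_diff vec.subspace_scale subspace_perp)
    moreover have "b ?y u = 0" using f(3) polar_commute[of u f] by (simp add: bilin)
    ultimately have "?y \<in> ?V'" using perp_span_insert perpV' by blast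
    moreover have "vec.span V = V" using Vs by simp
    ultimately obtain k where k: "?y - k *s u \<in> V" using vec.span_breakdown_eq by metis
    define w where "w = ?y - k *s u"
    have eq: "g *v u = w + k *s u + b (g *v u) u *s f" by (simp add: w_def)
    have w: "w \<in> V" "Q w = 0" "b w u = 0" "b w f = 0"
      using k V(1) uu(3) f(1) polar_commute[of w] by (auto simp: w_def[symmetric] totally_singular_def perp_def)
    have bf: "b (g *v u) f = k"
      using w f by (subst eq) (simp add: bilin polar_self)
    have "Q (g *v u) = 0" using isometry(2)[of g u] g H(3) uu by auto
    moreover have "Q (g *v u) = k * b (g *v u) u"
      using w f uu by (subst eq) (simp add: Q_add Q_scale bilin)
    ultimately have "b (g *v u) u * b (g *v u) f = 0" using bf by auto
    moreover have "g *v u \<in> ?V'" if "b (g *v u) u = 0"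
    proof -
      have "g *v u = w + k *s u" using eq that by simp
      also have "\<dots> \<in> ?V'" using w(1) uV' by (intro vec.span_add vec.span_scale) auto
      finally show ?thesis .
    qed
    moreover have False if "b (g *v u) u = 0" "b (g *v u) f = 0"
    proof -
      have "g *v u = w" using eq that bf by simp
      then have "g *v u \<in> V" using w by simp
      then show False using stable_cancel[OF H(1) V(2) g] u(1) by blast
    qed
    ultimately show ?thesis by blast
  qed
  have closed: "zariski_closed {g. b (g *v u) y = 0}" for y
    by (intro zariski_closed_zero poly_fun_functional linear_left)
  have "H \<subseteq> {g. b (g *v u) u = 0}"
  proof (rule connectedin_zariski_two[OF H(2) closed closed])
    show "H \<subseteq> {g. b (g *v u) u = 0} \<union> {g. b (g *v u) f = 0}" using gu by auto
    show "H \<inter> {g. b (g *v u) u = 0} \<inter> {g. b (g *v u) f = 0} = {}" using gu by auto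
    show "H \<inter> {g. b (g *v u) u = 0} \<noteq> {}" using subgroup_GL_one[OF H(1)] uu(2) by force
  qed
  then have guV': "g *v u \<in> ?V'" if "g \<in> H" for g using gu that by blast
  show "stable H ?V'"
  proof (rule stable_span_insert[OF Vs V(2)])
    fix h assume "h \<in> H"
    moreover have "vec.span V = V" using Vs by simp
    ultimately show "\<exists>c. h *v u - c *s u \<in> V" using guV'[of h] vec.span_breakdown_eq by metis
  qed
next
  fix U u assume U: "totally_singular U" "u \<in> U" "u \<noteq> 0"
  have Qu: "Q u = 0" "b u u = 0" using U by (auto simp: totally_singular_def)
  then obtain y where "b u y \<noteq> 0" using radical_zero U(3) by blast
  then obtain f where f: "Q f = 0" "b u f = 1"
    using hyperbolic_partner[OF Qu(1) _ UNIV_I UNIV_I vec.subspace_UNIV] by blast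
  have ff: "b f f = 0" using f by (simp add: polar_self)
  define pr where "pr v = v - b v f *s u - b v u *s f" for v
  have pr: "b (pr v) u = 0" "b (pr v) f = 0" for v
    using Qu f ff polar_commute[of f u] by (simp_all add: pr_def bilin)
  \<comment> \<open>Dimension at least 3 enters here: if all vectors orthogonal to the pair
    \<open>u\<close>, \<open>f\<close> were singular, they would be zero and the pair would span the
    space.\<close>
  have "\<exists>x. b x u = 0 \<and> b x f = 0 \<and> Q x \<noteq> 0"
  proof (rule ccontr)
    assume none: "\<not> ?thesis"
    have "x = 0" if x: "b x u = 0" "b x f = 0" for x
    proof (rule radical_zero)
      show "Q x = 0" using none x by blast
      fix y
      have "Q (x + pr y) = 0" "Q (pr y) = 0" using none x pr by (auto simp: bilin)
      then have "b x (pr y) = 0" using \<open>Q x = 0\<close> by (simp add: Q_add)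
      moreover have "y = pr y + b y f *s u + b y u *s f" by (simp add: pr_def)
      ultimately show "b x y = 0" using x by (metis right.add right.scale add_0 mult_zero_right)
    qed
    then have "pr v = 0" for v using pr by blast
    then have "v = b v f *s u + b v u *s f" for v
      using pr_def[of v] by (simp add: algebra_simps)
    then have "v \<in> vec.span {u, f}" for v
      by (subst \<open>\<And>v. v = b v f *s u + b v u *s f\<close>)
        (intro vec.span_add vec.span_scale vec.span_base; simp)
    then have "vec.dim (UNIV :: ('a ^ 'n) set) \<le> card {u, f}"
      by (intro vec.span_card_ge_dim) auto
    also have "\<dots> \<le> 2" by (simp add: card_insert_if)
    finally show False using dim_ge_3 vec_dim_card[where 'a = 'a and 'n = 'n] by simp
  qed
  then obtain x where x: "b x u = 0" "b x f = 0" "Q x \<noteq> 0" by blast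
  \<comment> \<open>It sends \<open>u\<close> to \<open>u + x - Q x *s f\<close>, whose product with
    \<open>u\<close> is \<open>- Q x\<close>.\<close>
  let ?g = "siegel b f x (- Q x)"
  have "b u (?g *v u) = - Q x"
    using Qu f x polar_commute[of u x] by (simp add: siegel_mult bilin)
  then have "?g *v u \<notin> U" using U x(3) by (auto simp: totally_singular_def)
  moreover have "?g \<in> SO Q" using siegel_in_SO f x by blast
  ultimately show "\<exists>g\<in>SO Q. g *v u \<notin> U" by blast
qed

end

section \<open>The finite subgroup consists of involutions\<close>

lemma char_two: "CHAR('a::field) = 2 \<Longrightarrow> (2::'a) = 0"
  using of_nat_CHAR[where 'a = 'a] by simp

lemma char_not_two: "CHAR('a::field) \<noteq> 2 \<Longrightarrow> (2::'a) \<noteq> 0"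
proof
  assume "CHAR('a) \<noteq> 2" "(2::'a) = 0"
  then have "of_nat 2 = (0::'a)" by simp
  then have "CHAR('a) dvd 2" by (simp only: of_nat_eq_0_iff_char_dvd)
  then have "CHAR('a) = 1 \<or> CHAR('a) = 2" using two_is_prime_nat unfolding prime_nat_iff by blast
  then have "CHAR('a) = 1" using \<open>CHAR('a) \<noteq> 2\<close> by blast
  then show False using of_nat_CHAR[where 'a = 'a] by simp
qed

lemma square_root_exists:
  fixes c :: "'a::alg_closed_field"
  obtains s where "s\<^sup>2 = c"
proof -
  obtain s where "poly [: -c, 0, 1 :] s = 0"
    using alg_closed_imp_poly_has_root[of "[: -c, 0, 1 :]"] by auto
  then show ?thesis using that[of s] by (simp add: power2_eq_square)
qed

lemma centralizer_component:
  "identity_component (centralizer G F) \<subseteq> G"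
  "g \<in> identity_component (centralizer G F) \<Longrightarrow> f \<in> F \<Longrightarrow> g *v (f *v v) = f *v (g *v v)"
  using identity_component_subset[of "centralizer G F"]
  by (auto simp: centralizer_def matrix_vector_mul_assoc)

lemma subgroup_centralizer:
  fixes G F :: "('a::field ^ 'n ^ 'n) set"
  assumes G: "subgroup G GL"
  shows "subgroup (centralizer G F) GL"
  unfolding subgroup_GL_iff
proof (intro conjI ballI)
  show "mat 1 \<in> centralizer G F" using subgroup_GL_one[OF G] by (simp add: centralizer_def)
  fix A assume A: "A \<in> centralizer G F"
  show "A ** B \<in> centralizer G F" if "B \<in> centralizer G F" for B
  proof -
    have "A ** B ** f = f ** (A ** B)" if "f \<in> F" for f
    proof -
      have "A ** B ** f = A ** (B ** f)" by (simp add: matrix_mul_assoc)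
      also have "\<dots> = A ** f ** B" using \<open>B \<in> _\<close> that by (simp add: centralizer_def matrix_mul_assoc)
      also have "\<dots> = f ** (A ** B)" using A that by (simp add: centralizer_def matrix_mul_assoc)
      finally show ?thesis .
    qed
    then show ?thesis using A \<open>B \<in> _\<close> subgroup_GL_mult[OF G] by (simp add: centralizer_def)
  qed
  obtain B where B: "B \<in> G" "A ** B = mat 1" "B ** A = mat 1"
    using A subgroup_GL_inverse[OF G] unfolding centralizer_def by blast
  have "B ** f = f ** B" if "f \<in> F" for f
  proof -
    have Af: "A ** f = f ** A" using A that by (simp add: centralizer_def)
    have "B ** f = B ** f ** (A ** B)" using B by simp
    also have "\<dots> = B ** (f ** A) ** B" by (simp add: matrix_mul_assoc)
    also have "\<dots> = B ** A ** f ** B" unfolding Af[symmetric] by (simp add: matrix_mul_assoc)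
    finally show ?thesis using B by simp
  qed
  then show "\<exists>B\<in>centralizer G F. A ** B = mat 1 \<and> B ** A = mat 1"
    using B by (auto simp: centralizer_def)
qed

text \<open>The intersection of the kernel and the image of \<open>h - 1\<close>.\<close>

definition fixed_image :: "'a::field ^ 'n ^ 'n \<Rightarrow> ('a ^ 'n) set" where
  "fixed_image h = {w. h *v w = w \<and> (\<exists>v. w = h *v v - v)}"

lemma fixed_imageI: "h *v w = w \<Longrightarrow> w = h *v v - v \<Longrightarrow> w \<in> fixed_image h"
  by (auto simp: fixed_image_def)

lemma subspace_fixed_image: "vec.subspace (fixed_image h)"
proof (rule vec.subspaceI)
  show "0 \<in> fixed_image h" by (auto simp: fixed_image_def intro: exI[of _ 0])
  fix x assume "x \<in> fixed_image h"
  then obtain v where x: "h *v x = x" "x = h *v v - v" by (auto simp: fixed_image_def)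
  have "c *s x = h *v (c *s v) - c *s v" for c
    by (simp add: x(2) vector_scalar_commute vec.scale_right_diff_distrib)
  then show "c *s x \<in> fixed_image h" for c
    by (rule fixed_imageI[rotated]) (simp only: vector_scalar_commute x(1))
  fix y assume "y \<in> fixed_image h"
  then obtain w where y: "h *v y = y" "y = h *v w - w" by (auto simp: fixed_image_def)
  have "x + y = h *v (v + w) - (v + w)"
    by (simp add: x(2) y(2) matrix_vector_right_distrib)
  then show "x + y \<in> fixed_image h"
    by (rule fixed_imageI[rotated]) (simp only: matrix_vector_right_distrib x(1) y(1))
qed

lemma stable_fixed_image:
  assumes "\<And>g v. g \<in> C \<Longrightarrow> g *v (h *v v) = h *v (g *v v)"
  shows "stable C (fixed_image h)"
  unfolding stable_def
proof (intro ballI)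
  fix g x assume g: "g \<in> C" and "x \<in> fixed_image h"
  then obtain v where x: "h *v x = x" "x = h *v v - v" by (auto simp: fixed_image_def)
  have "h *v (g *v x) = g *v x" using assms[OF g, of x] x(1) by simp
  moreover have "g *v x = h *v (g *v v) - g *v v"
    unfolding x(2) matrix_vector_mult_diff_distrib using assms[OF g] by simp
  ultimately show "g *v x \<in> fixed_image h" by (auto simp: fixed_image_def)
qed

text \<open>The image of \<open>h - 1\<close> is nonzero and stable under \<open>h\<close>; an
  eigenvector of \<open>h\<close> in it has eigenvalue 1, so it lies in the kernel too.\<close>

lemma fixed_image_nontrivial:
  fixes h :: "'a::alg_closed_field ^ 'n ^ 'n"
  assumes "h \<noteq> mat 1" and eig: "\<And>c v. v \<noteq> 0 \<Longrightarrow> h *v v = c *s v \<Longrightarrow> c = 1"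
  shows "\<exists>w\<in>fixed_image h. w \<noteq> 0"
proof -
  define X where "X = range (\<lambda>v. h *v v - v)"
  obtain v0 where v0: "h *v v0 - v0 \<noteq> 0"
    using assms(1) unfolding matrix_eq by auto
  have act: "(h - mat 1) *v v = h *v v - v" for v by (simp add: matrix_vector_mult_diff_rdistrib)
  have "X = (*v) (h - mat 1) ` UNIV" by (auto simp: X_def act)
  then have X: "vec.subspace X"
    by (simp only:) (rule vec.linear_subspace_image[OF matrix_vector_mul_linear_gen vec.subspace_UNIV])
  have hX: "h *v x \<in> X" if x: "x \<in> X" for x
  proof -
    obtain v where "x = h *v v - v" using x unfolding X_def by blast
    then have "h *v x = h *v (h *v v) - h *v v" by (simp add: matrix_vector_mult_diff_distrib)
    then show ?thesis unfolding X_def by blast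
  qed
  have v0X: "h *v v0 - v0 \<in> X" by (simp add: X_def)
  have v0': "h *v v0 - v0 \<notin> {0}" using v0 by simp
  obtain w c where w: "w \<in> X" "w \<notin> {0}" "h *v w - c *s w \<in> {0}"
    by (rule eigenvector_mod[OF X hX vec.subspace_single_0 v0X v0'])
  then have "c = 1" using eig[of w c] by simp
  then have "w \<in> fixed_image h" using w by (auto simp: fixed_image_def X_def)
  then show ?thesis using w by blast
qed

lemma (in form_space) totally_singular_line:
  assumes "q v = 0" shows "totally_singular (vec.span {v})"
proof -
  have "q x = 0" "b x y = 0" if "x \<in> vec.span {v}" "y \<in> vec.span {v}" for x y
    using that assms q_b[OF assms] by (auto simp: vec.span_singleton q_scale bilin)
  then show ?thesis using vec.subspace_span unfolding totally_singular_def by blast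
qed

lemma stable_line:
  assumes "\<And>g. g \<in> C \<Longrightarrow> \<exists>c. g *v v = c *s v" shows "stable C (vec.span {v})"
proof -
  have "g *v (k *s v) \<in> range (\<lambda>k. k *s v)" if g: "g \<in> C" for g k
  proof -
    obtain c where "g *v v = c *s v" using assms[OF g] by blast
    then have "g *v (k *s v) = (k * c) *s v" by (simp add: vector_scalar_commute)
    then show ?thesis by blast
  qed
  then show ?thesis by (auto simp: stable_def vec.span_singleton)
qed

context classical_form_space
begin

context
  fixes F
  assumes F: "subgroup F GL" "F \<subseteq> G"
    and irr: "irreducible_in G (identity_component (centralizer G F))"
begin

abbreviation "C \<equiv> identity_component (centralizer G F)"

lemma totally_singular_trivial:
  assumes "totally_singular U" "stable C U" shows "U = {0}"
  using irreducible_totally_singular[OF irr centralizer_component(1) assms] .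

text \<open>On the eigenspace an isometry multiplies \<open>q\<close> and \<open>b\<close> by the
  square of \<open>c\<close>, so the eigenspace is totally singular unless that square is 1.\<close>

lemma eigenvalue_square_one:
  assumes f: "f \<in> F" and v: "v \<noteq> 0" "f *v v = c *s v"
  shows "c\<^sup>2 = 1"
proof (rule ccontr)
  assume c: "c\<^sup>2 \<noteq> 1"
  define U where "U = {v \<in> UNIV. f *v v - c *s v \<in> {0}}"
  have "vec.subspace U" unfolding U_def by (rule subspace_eigenspace_mod) auto
  moreover have "q x = 0" if "x \<in> U" for x
  proof -
    have "f *v x = c *s x" using that by (simp add: U_def)
    then have "q x = c\<^sup>2 * q x" using isometry(2)[of f x] f F(2) q_scale by auto
    then show ?thesis using c by simp
  qed
  moreover have "b x y = 0" if "x \<in> U" "y \<in> U" for x y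
  proof -
    have "f *v x = c *s x" "f *v y = c *s y" using that by (simp_all add: U_def)
    then have "b x y = c\<^sup>2 * b x y"
      using isometry(1)[of f x y] f F(2) by (auto simp: bilin power2_eq_square)
    then show ?thesis using c by simp
  qed
  ultimately have ts: "totally_singular U" by (simp add: totally_singular_def)
  have "stable C U"
    unfolding stable_def
  proof (intro ballI)
    fix g x assume g: "g \<in> C" and x: "x \<in> U"
    have "f *v (g *v x) = g *v (f *v x)" using centralizer_component(2)[OF g f] by simp
    then show "g *v x \<in> U" using x by (simp add: U_def vector_scalar_commute)
  qed
  then have "U = {0}" using totally_singular_trivial[OF ts] by blast
  then show False using v by (auto simp: U_def)
qed

text \<open>For fixed \<open>y\<close> invariance gives \<open>b (h *v v) y = b v y\<close>, so the
  image of \<open>h - 1\<close> is orthogonal to all fixed vectors.\<close>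

lemma isotropic_fixed_image:
  assumes h: "h \<in> F" and x: "x \<in> fixed_image h" and y: "y \<in> fixed_image h"
  shows "b x y = 0"
proof -
  obtain v where v: "x = h *v v - v" using x by (auto simp: fixed_image_def)
  have "h *v y = y" using y by (simp add: fixed_image_def)
  then have "b (h *v v) y = b v y" using isometry(1)[of h v y] h F(2) by auto
  then show ?thesis by (simp add: v bilin)
qed

text \<open>The premise \<open>q\<close> turns isotropic into singular. It holds for symplectic
  groups and, outside characteristic 2, for orthogonal ones; in characteristic 2 every vector is
  isotropic for the polar form, whence the separate argument in
  \<open>char_two_trivial\<close>.\<close>

lemma fixed_image_trivial:
  assumes h: "h \<in> F" and q: "\<And>x. b x x = 0 \<Longrightarrow> q x = 0"
    and eig: "\<And>c v. v \<noteq> 0 \<Longrightarrow> h *v v = c *s v \<Longrightarrow> c = 1"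
  shows "h = mat 1"
proof (rule ccontr)
  assume "h \<noteq> mat 1"
  then obtain w where w: "w \<in> fixed_image h" "w \<noteq> 0" using fixed_image_nontrivial eig by blast
  have "totally_singular (fixed_image h)"
    using subspace_fixed_image isotropic_fixed_image[OF h] q by (simp add: totally_singular_def)
  moreover have "stable C (fixed_image h)"
    using centralizer_component(2) h by (intro stable_fixed_image) blast
  ultimately have "fixed_image h = {0}" by (rule totally_singular_trivial)
  then show False using w by blast
qed

lemma involution:
  assumes f: "f \<in> F" and q: "\<And>x. b x x = 0 \<Longrightarrow> q x = 0"
  shows "f ** f = mat 1"
proof (rule fixed_image_trivial[OF subgroup_GL_mult[OF F(1) f f] q])
  fix c v assume v: "v \<noteq> 0" "(f ** f) *v v = c *s v"
  \<comment> \<open>Eigenvalues of \<open>f ** f\<close> come from those of \<open>f\<close>: either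
    \<open>v\<close> itself has eigenvalue \<open>- s\<close>, or \<open>f *v v + s *s v\<close> is
    an eigenvector for \<open>s\<close>.\<close>
  obtain s where s: "s\<^sup>2 = c" using square_root_exists by blast
  show "c = 1"
  proof (cases "f *v v + s *s v = 0")
    case True
    then have "f *v v = (- s) *s v" by (simp add: eq_neg_iff_add_eq_0)
    then have "(- s)\<^sup>2 = 1" using eigenvalue_square_one[OF f v(1)] by blast
    then show ?thesis using s by simp
  next
    case False
    have "f *v (f *v v + s *s v) = s *s (f *v v + s *s v)"
      using v(2) s
      by (simp add: matrix_vector_right_distrib vector_scalar_commute vec.scale_right_distrib
          power2_eq_square add.commute flip: matrix_vector_mul_assoc)
    then show ?thesis using eigenvalue_square_one[OF f False] s by blast
  qed
qed

end

end

section \<open>Characteristic two\<close>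

text \<open>Off-diagonal terms cancel in pairs. Applied to \<open>P i j = T j i * S i j\<close> it
  says that a product of two alternating matrices has trace zero in characteristic 2.\<close>

lemma symmetric_sum_zero:
  fixes P :: "nat \<Rightarrow> nat \<Rightarrow> 'a::field"
  assumes two: "(2::'a) = 0" and "\<And>i j. i < m \<Longrightarrow> j < m \<Longrightarrow> P i j = P j i" "\<And>i. i < m \<Longrightarrow> P i i = 0"
  shows "(\<Sum>i<m. \<Sum>j<m. P i j) = 0"
  using assms(2,3)
proof (induction m)
  case (Suc m)
  have "(\<Sum>i<Suc m. \<Sum>j<Suc m. P i j)
      = (\<Sum>i<m. \<Sum>j<m. P i j) + (\<Sum>i<m. P i m) + (\<Sum>j<m. P m j) + P m m"
    by (simp add: sum.distrib)
  also have "(\<Sum>j<m. P m j) = (\<Sum>i<m. P i m)" using Suc.prems by (intro sum.cong) auto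
  also have "(\<Sum>i<m. \<Sum>j<m. P i j) = 0" using Suc.prems by (intro Suc.IH) auto
  also have "0 + (\<Sum>i<m. P i m) + (\<Sum>i<m. P i m) + P m m = 2 * (\<Sum>i<m. P i m)"
    using Suc.prems(2)[of m] by simp
  finally show ?case using two by simp
qed simp

context quadratic_space
begin

definition hyperbolic_basis :: "('a ^ 'n) set \<Rightarrow> nat \<Rightarrow> (nat \<Rightarrow> 'a ^ 'n) \<Rightarrow> (nat \<Rightarrow> 'a ^ 'n) \<Rightarrow> bool" where
  "hyperbolic_basis W m e f \<longleftrightarrow>
     (\<forall>i<m. e i \<in> W \<and> f i \<in> W \<and> Q (e i) = 0 \<and> Q (f i) = 0) \<and>
     (\<forall>i<m. \<forall>j<m. b (e i) (e j) = 0 \<and> b (f i) (f j) = 0 \<and> b (e i) (f j) = (if i = j then 1 else 0)) \<and>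
     (\<forall>v\<in>W. v = (\<Sum>i<m. b v (f i) *s e i + b v (e i) *s f i) \<and> Q v = (\<Sum>i<m. b v (e i) * b v (f i)))"

text \<open>Hyperbolic planes are split off one at a time. Two vectors with
  \<open>b x y \<noteq> 0\<close> have a nontrivial singular combination \<open>e\<close>; it is
  nonzero because \<open>b\<close>, alternating here, recovers its coefficients from
  \<open>b e y\<close> and \<open>b x e\<close>.\<close>

lemma hyperbolic_basis_exists:
  assumes two: "(2::'a) = 0" and "vec.subspace W" "\<And>x. x \<in> W \<Longrightarrow> (\<And>y. y \<in> W \<Longrightarrow> b x y = 0) \<Longrightarrow> x = 0"
  shows "\<exists>m e f. hyperbolic_basis W m e f"
  using assms(2,3)
proof (induction "vec.dim W" arbitrary: W rule: less_induct)
  case less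
  have alt: "b x x = 0" for x using two polar_self[of x] by simp
  show ?case
  proof (cases "W = {0}")
    case True
    then have "hyperbolic_basis W 0 (\<lambda>_. 0) (\<lambda>_. 0)" by (simp add: hyperbolic_basis_def Q_zero)
    then show ?thesis by blast
  next
    case False
    then obtain x where x: "x \<in> W" "x \<noteq> 0" using vec.subspace_0[OF less.prems(1)] by blast
    then obtain y where y: "y \<in> W" "b x y \<noteq> 0" using less.prems(2) by blast
    obtain c d where cd: "c \<noteq> 0 \<or> d \<noteq> 0" "Q (c *s x + d *s y) = 0" using singular_combination by blast
    define e where "e = c *s x + d *s y"
    have e: "e \<in> W" "Q e = 0"
      using cd(2) x y by (auto simp: e_def vec.subspace_add[OF less.prems(1)] vec.subspace_scale[OF less.prems(1)])
    have "b e y = c * b x y" "b x e = d * b x y" by (simp_all add: e_def bilin alt)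
    then have "e \<noteq> 0" using cd(1) y(2) by (auto simp: bilin)
    then obtain z where "z \<in> W" "b e z \<noteq> 0" using less.prems(2) e(1) by blast
    then obtain f where f: "f \<in> W" "Q f = 0" "b e f = 1"
      using hyperbolic_partner[OF e(2) _ _ e(1) less.prems(1)] by blast
    define W' where "W' = {v\<in>W. b v e = 0 \<and> b v f = 0}"
    have W': "vec.subspace W'"
      using less.prems(1) by (auto simp: W'_def vec.subspace_def bilin)
    define pr where "pr v = v - b v f *s e - b v e *s f" for v
    have pr: "pr v \<in> W'" if "v \<in> W" for v
      using that e f alt polar_commute[of f e] less.prems(1)
      by (simp add: W'_def pr_def bilin vec.subspace_diff vec.subspace_scale)
    have dec: "v = pr v + b v f *s e + b v e *s f" for v by (simp add: pr_def)
    have "\<exists>m e f. hyperbolic_basis W' m e f"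
    proof (rule less.hyps[OF _ W'])
      have "e \<notin> W'" using f(3) by (simp add: W'_def)
      then have "W' \<subset> W" using e(1) by (auto simp: W'_def)
      then show "vec.dim W' < vec.dim W"
        by (intro vec.dim_psubset)
          (simp only: vec.span_eq_iff[THEN iffD2, OF W'] vec.span_eq_iff[THEN iffD2, OF less.prems(1)])
      fix x assume x: "x \<in> W'" "\<And>y. y \<in> W' \<Longrightarrow> b x y = 0"
      show "x = 0"
      proof (rule less.prems(2))
        show "x \<in> W" using x by (simp add: W'_def)
        fix y assume "y \<in> W"
        then have "b x (pr y) = 0" using x(2) pr by blast
        then show "b x y = 0" using x(1) by (subst dec[of y]) (simp add: bilin W'_def)
      qed
    qed
    then obtain m e' f' where hb: "hyperbolic_basis W' m e' f'" by blast
    have W'b: "e' i \<in> W'" "f' i \<in> W'" if "i < m" for i using hb that by (auto simp: hyperbolic_basis_def)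
    have orth: "b (e' i) e = 0" "b (e' i) f = 0" "b (f' i) e = 0" "b (f' i) f = 0"
      "b e (e' i) = 0" "b f (e' i) = 0" "b e (f' i) = 0" "b f (f' i) = 0" if "i < m" for i
      using W'b[OF that] polar_commute[of "e' i"] polar_commute[of "f' i"] by (auto simp: W'_def)
    define E where "E = e'(m := e)"
    define F where "F = f'(m := f)"
    have EF: "E i = e' i" "F i = f' i" if "i < m" for i using that by (auto simp: E_def F_def)
    have EFm: "E m = e" "F m = f" by (auto simp: E_def F_def)
    have "hyperbolic_basis W (Suc m) E F"
      unfolding hyperbolic_basis_def
    proof (intro conjI allI ballI impI)
      fix i assume "i < Suc m"
      then have "i < m \<or> i = m" by auto
      then show "E i \<in> W" "F i \<in> W" "Q (E i) = 0" "Q (F i) = 0"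
        using hb e f W'b[of i] by (auto simp: EF EFm W'_def hyperbolic_basis_def)
      fix j assume "j < Suc m"
      then have "j < m \<or> j = m" by auto
      with \<open>i < m \<or> i = m\<close> show "b (E i) (E j) = 0" "b (F i) (F j) = 0" "b (E i) (F j) = (if i = j then 1 else 0)"
        using hb orth alt f(3) by (auto simp: EF EFm hyperbolic_basis_def)
    next
      fix v assume v: "v \<in> W"
      have bpr: "b (pr v) (e' i) = b v (e' i)" "b (pr v) (f' i) = b v (f' i)" if "i < m" for i
        using orth[OF that] by (simp_all add: pr_def bilin)
      have "pr v = (\<Sum>i<m. b v (F i) *s E i + b v (E i) *s F i)"
      proof -
        have "pr v = (\<Sum>i<m. b (pr v) (f' i) *s e' i + b (pr v) (e' i) *s f' i)"
          using hb pr[OF v] by (auto simp: hyperbolic_basis_def)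
        also have "\<dots> = (\<Sum>i<m. b v (F i) *s E i + b v (E i) *s F i)"
          by (rule sum.cong) (simp_all add: bpr EF)
        finally show ?thesis .
      qed
      then show "v = (\<Sum>i<Suc m. b v (F i) *s E i + b v (E i) *s F i)"
        using dec[of v] by (simp add: EFm add.assoc)
      have "Q (pr v) = (\<Sum>i<m. b v (E i) * b v (F i))"
      proof -
        have "Q (pr v) = (\<Sum>i<m. b (pr v) (e' i) * b (pr v) (f' i))"
          using hb pr[OF v] by (auto simp: hyperbolic_basis_def)
        also have "\<dots> = (\<Sum>i<m. b v (E i) * b v (F i))"
          by (rule sum.cong) (simp_all add: bpr EF)
        finally show ?thesis .
      qed
      moreover have "Q v = Q (pr v) + b v e * b v f"
        using pr[OF v] e f by (subst dec[of v]) (simp add: Q_add Q_scale bilin W'_def)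
      ultimately show "Q v = (\<Sum>i<Suc m. b v (E i) * b v (F i))" by (simp add: EFm)
    qed
    then show ?thesis by blast
  qed
qed

text \<open>Dickson's invariant. It takes only the values 0 and 1 because
  \<open>t\<^sup>2 - t\<close> is the trace of a product of two alternating matrices.\<close>

lemma dickson_invariant_idempotent:
  assumes two: "(2::'a) = 0" and hb: "hyperbolic_basis UNIV m e f" and g: "g \<in> GO Q"
  defines "t \<equiv> \<Sum>i<m. \<Sum>j<m. b (g *v e i) (e j) * b (g *v f i) (f j)"
  shows "t\<^sup>2 = t"
proof -
  have neg: "- x = x" for x :: 'a using two by (metis add.inverse_unique mult_2 mult_zero_left)
  have cancel: "x = y" if "x + y = 0" for x y :: 'a
    using eq_neg_iff_add_eq_0[THEN iffD2, OF that] neg by simp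
  \<comment> \<open>The blocks of \<open>g\<close> in the hyperbolic basis. In matrix notation
    \<open>M = \<beta> \<gamma>^T\<close> with trace \<open>t\<close>,
    \<open>T = \<delta>^T \<beta>\<close> and \<open>S = \<gamma>^T \<alpha>\<close>; the last two
    turn out to be alternating.\<close>
  define \<alpha> where "\<alpha> i j = b (g *v e i) (f j)" for i j
  define \<beta> where "\<beta> i j = b (g *v e i) (e j)" for i j
  define \<gamma> where "\<gamma> i j = b (g *v f i) (f j)" for i j
  define \<delta> where "\<delta> i j = b (g *v f i) (e j)" for i j
  define M where "M i k = (\<Sum>j<m. \<beta> i j * \<gamma> k j)" for i k
  define T where "T j k = (\<Sum>i<m. \<delta> i j * \<beta> i k)" for j k
  define S where "S j k = (\<Sum>i<m. \<gamma> i j * \<alpha> i k)" for j k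
  obtain g' where g': "g' \<in> GO Q" "g ** g' = mat 1" "g' ** g = mat 1"
    using subgroup_GL_inverse[OF subgroup_GO g] by blast
  have iso: "b (g *v x) (g *v y) = b x y" for x y using polar_isometry g by (simp add: GO_iff)
  have iso': "b x (g *v y) = b (g' *v x) y" for x y
    using iso[of "g' *v x" y] g'(2) by (simp add: mult_inverse_vector)
  have expand: "b v w = (\<Sum>i<m. b v (f i) * b (e i) w + b v (e i) * b (f i) w)" for v w
  proof -
    have "v = (\<Sum>i<m. b v (f i) *s e i + b v (e i) *s f i)"
      using hb by (simp add: hyperbolic_basis_def)
    then have "b v w = b (\<Sum>i<m. b v (f i) *s e i + b v (e i) *s f i) w" by simp
    then show ?thesis by (simp add: left.sum bilin)
  qed
  have expand': "b v w = (\<Sum>i<m. b v (g *v f i) * b (g *v e i) w + b v (g *v e i) * b (g *v f i) w)" for v w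
  proof -
    have "b v w = b (g' *v v) (g' *v w)"
      using g'(1) polar_isometry by (simp add: GO_iff)
    also have "\<dots> = (\<Sum>i<m. b (g' *v v) (f i) * b (e i) (g' *v w) + b (g' *v v) (e i) * b (f i) (g' *v w))"
      by (rule expand)
    finally show ?thesis by (simp add: iso' polar_commute[of "g *v _" w] polar_commute[of "g' *v w"])
  qed
  have Q_expand': "Q v = (\<Sum>i<m. b v (g *v e i) * b v (g *v f i))" for v
  proof -
    have "Q v = Q (g' *v v)" using g'(1) by (simp add: GO_iff)
    then show ?thesis using hb by (simp add: hyperbolic_basis_def iso')
  qed
  \<comment> \<open>The products of \<open>g *v e i\<close> with \<open>g *v f k\<close>, read as
    \<open>1 = \<alpha> \<delta>^T + M\<close>.\<close>
  have M: "(if i = k then 1 else 0) = (\<Sum>l<m. \<alpha> i l * \<delta> k l) + M i k" if "i < m" "k < m" for i k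
  proof -
    have "(if i = k then 1 else 0) = b (g *v e i) (g *v f k)"
      using hb that by (simp add: iso hyperbolic_basis_def)
    also have "\<dots> = (\<Sum>l<m. \<alpha> i l * \<delta> k l + \<beta> i l * \<gamma> k l)"
      unfolding \<alpha>_def \<beta>_def \<gamma>_def \<delta>_def
      by (subst expand) (simp add: polar_commute[of "e _" "g *v _"] polar_commute[of "f _" "g *v _"])
    finally show ?thesis by (simp add: M_def sum.distrib)
  qed
  \<comment> \<open>The images under \<open>g\<close> form a hyperbolic basis as well. Expanding
    \<open>Q (e j)\<close> and \<open>b (e j) (e k)\<close> in it gives the zero diagonal and the
    symmetry of \<open>T\<close>; the vectors \<open>f j\<close> do the same for
    \<open>S\<close>.\<close>
  have TS: "T j j = 0" "S j j = 0" "T j k = T k j" "S j k = S k j" if "j < m" "k < m" for j k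
  proof -
    have ef: "b (e j) (e k) = 0" "b (f j) (f k) = 0" "Q (e j) = 0" "Q (f j) = 0"
      using hb that by (simp_all add: hyperbolic_basis_def)
    show "T j j = 0" using Q_expand'[of "e j"] ef(3)
      by (simp add: T_def \<beta>_def \<delta>_def polar_commute[of "e j"] mult.commute)
    show "S j j = 0" using Q_expand'[of "f j"] ef(4)
      by (simp add: S_def \<alpha>_def \<gamma>_def polar_commute[of "f j"] mult.commute)
    have "b (e j) (e k) = (\<Sum>i<m. \<delta> i j * \<beta> i k + \<beta> i j * \<delta> i k)"
      unfolding expand'[of "e j" "e k"] \<beta>_def \<delta>_def by (simp only: polar_commute[of "e j"])
    also have "\<dots> = T j k + T k j"
      unfolding T_def sum.distrib by (simp only: mult.commute)
    finally have "T j k + T k j = b (e j) (e k)" by (rule HOL.sym)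
    then have "T j k + T k j = 0" using ef(1) by simp
    then show "T j k = T k j" by (rule cancel)
    have "b (f j) (f k) = (\<Sum>i<m. \<gamma> i j * \<alpha> i k + \<alpha> i j * \<gamma> i k)"
      unfolding expand'[of "f j" "f k"] \<alpha>_def \<gamma>_def by (simp only: polar_commute[of "f j"])
    also have "\<dots> = S j k + S k j"
      unfolding S_def sum.distrib by (simp only: mult.commute)
    finally have "S j k + S k j = b (f j) (f k)" by (rule HOL.sym)
    then have "S j k + S k j = 0" using ef(2) by simp
    then show "S j k = S k j" by (rule cancel)
  qed
  have t: "t = (\<Sum>i<m. M i i)" by (simp add: t_def M_def \<beta>_def \<gamma>_def)
  \<comment> \<open>In characteristic 2 the square of the trace is the trace of the square: their
    sum is a symmetric double sum with zero diagonal.\<close>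
  have "(\<Sum>i<m. \<Sum>k<m. M i i * M k k + M i k * M k i) = 0"
  proof (rule symmetric_sum_zero[OF two])
    show "M i i * M i i + M i i * M i i = 0" for i using two by (metis mult_2 mult_zero_left)
  qed (simp add: mult.commute)
  then have "t\<^sup>2 + (\<Sum>i<m. \<Sum>k<m. M i k * M k i) = 0"
    by (simp add: t power2_eq_square sum_product sum.distrib)
  then have t2: "t\<^sup>2 = (\<Sum>i<m. \<Sum>k<m. M i k * M k i)" by (rule cancel)
  \<comment> \<open>One factor is replaced by \<open>1 - \<alpha> \<delta>^T\<close>. The first part
    has trace \<open>t\<close>; the second regroups into the trace of \<open>T S\<close>, which
    vanishes.\<close>
  have "(\<Sum>i<m. \<Sum>k<m. M i k * M k i) = (\<Sum>i<m. \<Sum>k<m. M i k * (if k = i then 1 else 0))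
      - (\<Sum>i<m. \<Sum>k<m. M i k * (\<Sum>l<m. \<alpha> k l * \<delta> i l))"
    unfolding sum_subtractf[symmetric] right_diff_distrib[symmetric]
    by (intro sum.cong refl arg_cong2[where f = "(*)"]) (simp add: M)
  also have "(\<Sum>i<m. \<Sum>k<m. M i k * (if k = i then 1 else 0)) = t"
    by (simp add: t if_distrib[of "(*) _"] cong: if_cong)
  also have "(\<Sum>i<m. \<Sum>k<m. M i k * (\<Sum>l<m. \<alpha> k l * \<delta> i l)) = (\<Sum>j<m. \<Sum>l<m. T l j * S j l)"
  proof -
    have "(\<Sum>i<m. \<Sum>k<m. M i k * (\<Sum>l<m. \<alpha> k l * \<delta> i l))
        = (\<Sum>i<m. \<Sum>k<m. \<Sum>j<m. \<Sum>l<m. (\<delta> i l * \<beta> i j) * (\<gamma> k j * \<alpha> k l))"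
      unfolding M_def sum_product by (intro sum.cong refl) (simp only: mult_ac)
    also have "\<dots> = (\<Sum>i<m. \<Sum>j<m. \<Sum>k<m. \<Sum>l<m. (\<delta> i l * \<beta> i j) * (\<gamma> k j * \<alpha> k l))"
      by (intro sum.cong refl sum.swap)
    also have "\<dots> = (\<Sum>j<m. \<Sum>i<m. \<Sum>k<m. \<Sum>l<m. (\<delta> i l * \<beta> i j) * (\<gamma> k j * \<alpha> k l))"
      by (rule sum.swap)
    also have "\<dots> = (\<Sum>j<m. \<Sum>i<m. \<Sum>l<m. \<Sum>k<m. (\<delta> i l * \<beta> i j) * (\<gamma> k j * \<alpha> k l))"
      by (intro sum.cong refl sum.swap)
    also have "\<dots> = (\<Sum>j<m. \<Sum>l<m. \<Sum>i<m. \<Sum>k<m. (\<delta> i l * \<beta> i j) * (\<gamma> k j * \<alpha> k l))"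
      by (intro sum.cong refl sum.swap)
    also have "\<dots> = (\<Sum>j<m. \<Sum>l<m. T l j * S j l)"
      by (simp add: T_def S_def sum_product)
    finally show ?thesis .
  qed
  also have "(\<Sum>j<m. \<Sum>l<m. T l j * S j l) = 0"
    by (rule symmetric_sum_zero[OF two]) (use TS in auto)
  finally show ?thesis using t2 by simp
qed

text \<open>Dickson's invariant is polynomial, takes only the values 0 and 1 on isometries and
  vanishes at 1, so it vanishes on the identity component; on the reflection along \<open>w\<close>
  it is the square of \<open>Q w\<close>, which is 1.\<close>

lemma reflection_not_in_identity_component:
  assumes two: "(2::'a) = 0" and nondeg: "\<And>x. (\<And>y. b x y = 0) \<Longrightarrow> x = 0"
    and w: "Q w = 1" and u: "\<And>x. u *v x = x + b x w *s w"
  shows "u \<notin> identity_component (GO Q)"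
proof
  assume uC: "u \<in> identity_component (GO Q)"
  obtain m e f where hb: "hyperbolic_basis UNIV m e f"
    using hyperbolic_basis_exists[OF two vec.subspace_UNIV] nondeg by blast
  define D where "D g = (\<Sum>i<m. \<Sum>j<m. b (g *v e i) (e j) * b (g *v f i) (f j))" for g
  have poly: "poly_fun D" unfolding D_def
    by (intro poly_fun_sum poly_fun.mult poly_fun_functional linear_left)
  have closed: "zariski_closed {g. D g = 0}" "zariski_closed {g. D g - 1 = 0}"
    by (intro zariski_closed_zero poly poly_fun_diff poly_fun.const)+
  have "identity_component (GO Q) \<subseteq> {g. D g = 0}"
  proof (rule connectedin_zariski_two[OF connectedin_identity_component closed])
    have "D g = 0 \<or> D g = 1" if "g \<in> GO Q" for g
      using dickson_invariant_idempotent[OF two hb that] by (simp add: D_def power2_eq_square)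
    then show "identity_component (GO Q) \<subseteq> {g. D g = 0} \<union> {g. D g - 1 = 0}"
      using identity_component_subset by force
    have "D (mat 1) = 0"
      using hb by (simp add: D_def hyperbolic_basis_def)
    then show "identity_component (GO Q) \<inter> {g. D g = 0} \<noteq> {}"
      using identity_component_one[OF subgroup_GL_one[OF subgroup_GO]] by blast
  qed auto
  then have "D u = 0" using uC by blast
  moreover have "D u = (\<Sum>i<m. b w (e i) * b w (f i)) * (\<Sum>j<m. b w (e j) * b w (f j))"
  proof -
    have "D u = (\<Sum>i<m. \<Sum>j<m. (b w (e i) * b w (f i)) * (b w (e j) * b w (f j)))"
      unfolding D_def u
      by (intro sum.cong refl)
        (use hb in \<open>simp add: bilin hyperbolic_basis_def polar_commute[of "e _" w] polar_commute[of "f _" w]\<close>)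
    then show ?thesis by (simp add: sum_product)
  qed
  moreover have "(\<Sum>i<m. b w (e i) * b w (f i)) = 1"
    using hb w by (simp add: hyperbolic_basis_def)
  ultimately show False by simp
qed

end

context orthogonal_space
begin

text \<open>An involution of \<open>F\<close> must be a reflection, because the singular vectors in the image of
  \<open>u - 1\<close> form a totally singular subspace. If the polar form has a radical, the reflection vector
  can be corrected by a radical vector to a singular vector fixed by the centralizer; otherwise the
  reflection is not in \<open>SO Q\<close>.\<close>

lemma char_two_trivial:
  assumes char2: "CHAR('a) = 2" and F: "subgroup F GL" "F \<subseteq> SO Q" "finite F"
    and irr: "irreducible_in (SO Q) (identity_component (centralizer (SO Q) F))"
  shows "F = {mat 1}"
proof (rule ccontr)
  let ?C = "identity_component (centralizer (SO Q) F)"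
  have two: "(2::'a) = 0" by (rule char_two[OF char2])
  have dbl: "x + x = 0" for x :: 'a using two by (metis mult_2 mult_zero_left)
  have neg: "- x = x" for x :: 'a using dbl by (metis add.inverse_unique)
  have vneg: "- x = x" for x :: "'a ^ 'n" by (simp add: vec_eq_iff neg)
  have alt: "b x x = 0" for x using two polar_self by simp
  have sq1: "c = 1" if "c\<^sup>2 = 1" for c :: 'a
  proof -
    have "(c + 1)\<^sup>2 = 0" using that two by (simp add: power2_sum dbl)
    then have "c + 1 = 0" by simp
    then have "c = - 1" by (rule eq_neg_iff_add_eq_0[THEN iffD2])
    then show ?thesis using neg[of 1] by simp
  qed
  note ts_trivial = totally_singular_trivial[OF F(1,2) irr]
  assume "F \<noteq> {mat 1}"
  then obtain f where f: "f \<in> F" "f \<noteq> mat 1" using subgroup_GL_one[OF F(1)] by blast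
  have nontriv: "\<exists>w\<in>fixed_image h. w \<noteq> 0" if h: "h \<in> F" "h \<noteq> mat 1" for h
    by (rule fixed_image_nontrivial[OF h(2)]) (use eigenvalue_square_one[OF F(1,2) irr h(1)] sq1 in blast)
  \<comment> \<open>\<open>s k\<close> is the power of \<open>f\<close> with exponent
    \<open>2 ^ k\<close>; in characteristic 2, \<open>s (Suc k) - 1\<close> is the square of
    \<open>s k - 1\<close>.\<close>
  define s where "s k = ((\<lambda>A. A ** A) ^^ k) f" for k
  have s_Suc: "s (Suc k) = s k ** s k" for k by (simp add: s_def)
  have sF: "s k \<in> F" for k
    by (induction k) (use f subgroup_GL_mult[OF F(1)] in \<open>auto simp: s_Suc s_def\<close>)
  have step: "s (Suc k) *v v - v = s k *v (s k *v v - v) - (s k *v v - v)" for k v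
  proof -
    have "s k *v (s k *v v - v) - (s k *v v - v) = s (Suc k) *v v + v - (s k *v v + s k *v v)"
      by (simp add: s_Suc matrix_vector_mult_diff_distrib algebra_simps flip: matrix_vector_mul_assoc)
    also have "s k *v v + s k *v v = 0" using two by (simp add: vec_eq_iff)
    finally show ?thesis using vneg[of v] by (metis diff_zero diff_minus_eq_add)
  qed
  \<comment> \<open>Finiteness of \<open>F\<close> gives a repetition \<open>s i = s j\<close>. A
    nonzero \<open>w = (s i - 1) v\<close> fixed by \<open>s i\<close> is killed at the next
    squaring, so all later powers fix \<open>v\<close>, among them \<open>s j = s i\<close>, against
    \<open>w \<noteq> 0\<close>.\<close>
  have "\<exists>k. s k = mat 1"
  proof (rule ccontr)
    assume none: "\<nexists>k. s k = mat 1"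
    have "\<not> inj s"
      using sF F(3) by (metis finite_imageD finite_subset image_subsetI infinite_UNIV_nat)
    then obtain i j where ij: "i < j" "s i = s j" by (metis injI linorder_neqE_nat)
    obtain w where w: "w \<in> fixed_image (s i)" "w \<noteq> 0" using nontriv[OF sF] none by blast
    obtain v where v: "w = s i *v v - v" "s i *v w = w" using w by (auto simp: fixed_image_def)
    have "s (Suc i + k) *v v - v = 0" for k
    proof (induction k)
      case 0
      then show ?case using step[of i v] v by simp
    next
      case (Suc k)
      then show ?case using step[of "Suc i + k" v] by simp
    qed
    from this[of "j - Suc i"] have "s j *v v - v = 0" using ij by simp
    then show False using v(1) w(2) ij(2) by simp
  qed
  then obtain k0 where "s k0 = mat 1" ..
  define k where "k = (LEAST k. s k = mat 1)"
  have k: "s k = mat 1" unfolding k_def by (rule LeastI[of "\<lambda>k. s k = mat 1", OF \<open>s k0 = mat 1\<close>])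
  have k_least: "s i \<noteq> mat 1" if "i < k" for i
    using not_less_Least[of i "\<lambda>k. s k = mat 1"] that unfolding k_def by blast
  have "s 0 \<noteq> mat 1" using f(2) by (simp add: s_def)
  then have "k \<noteq> 0" using k by (intro notI) simp
  then obtain l where l: "k = Suc l" using not0_implies_Suc by blast
  define u where "u = s l"
  have u: "u \<in> F" "u \<noteq> mat 1" "u ** u = mat 1"
    using k k_least[of l] l sF by (auto simp: u_def s_Suc)
  have uu: "u *v (u *v x) = x" for x using mult_inverse_vector[OF u(3)] .
  have uQ: "Q (u *v x) = Q x" for x using isometry(2) u(1) F(2) by blast
  let ?W = "fixed_image u"
  \<comment> \<open>The square of \<open>u - 1\<close> is zero, so its whole image consists of fixed
    vectors.\<close>
  have im: "u *v x - x \<in> ?W" for x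
  proof -
    have "u *v (u *v x - x) = u *v x - x"
      using vneg[of "u *v x - x"] by (simp add: matrix_vector_mult_diff_distrib uu)
    then show ?thesis by (auto simp: fixed_image_def)
  qed
  have W: "vec.subspace ?W" "\<And>x y. x \<in> ?W \<Longrightarrow> y \<in> ?W \<Longrightarrow> b x y = 0"
    using subspace_fixed_image isotropic_fixed_image[OF F(1,2) irr u(1)] by blast+
  have stW: "stable ?C ?W"
    using centralizer_component(2) u(1) by (intro stable_fixed_image) blast
  \<comment> \<open>\<open>b\<close> vanishes on the image, so \<open>Q\<close> is additive there
    and its zeros form a subspace.\<close>
  define W0 where "W0 = {w\<in>?W. Q w = 0}"
  have "vec.subspace W0"
    using W by (auto simp: W0_def vec.subspace_def Q_zero Q_scale Q_add)
  then have "totally_singular W0" using W(2) by (auto simp: W0_def totally_singular_def)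
  moreover have "stable ?C W0"
    using stW isometry(2) centralizer_component(1) by (force simp: stable_def W0_def)
  ultimately have "W0 = {0}" by (rule ts_trivial)
  then have W0: "x = 0" if "x \<in> ?W" "Q x = 0" for x using that by (auto simp: W0_def)
  obtain w0 where w0: "w0 \<in> ?W" "w0 \<noteq> 0" using nontriv[OF u(1,2)] by blast
  then have Qw0: "Q w0 \<noteq> 0" using W0 by blast
  obtain a where a: "a\<^sup>2 = inverse (Q w0)" using square_root_exists by blast
  define w where "w = a *s w0"
  have w: "w \<in> ?W" "Q w = 1"
    using w0 Qw0 a by (auto simp: w_def Q_scale vec.subspace_scale[OF W(1)])
  \<comment> \<open>On the image \<open>Q\<close> is additive and \<open>Q w = 1\<close>;
    subtracting from \<open>x\<close> the square root of \<open>Q x\<close> times \<open>w\<close>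
    leaves a singular vector, hence zero.\<close>
  have line: "\<exists>c. x = c *s w" if x: "x \<in> ?W" for x
  proof -
    obtain c where c: "c\<^sup>2 = Q x" using square_root_exists by blast
    have "x - c *s w \<in> ?W" using x w vec.subspace_diff[OF W(1)] vec.subspace_scale[OF W(1)] by blast
    moreover have "Q (x - c *s w) = 0"
      using c w W(2)[OF x w(1)] by (simp add: Q_diff Q_scale bilin dbl)
    ultimately show ?thesis using W0 by (intro exI[of _ c]) (metis eq_iff_diff_eq_0)
  qed
  have alternative: "u *v x - x = 0 \<or> u *v x - x = b x w *s w" for x
  proof -
    obtain c where c: "u *v x - x = c *s w" using line[OF im] by blast
    then have "u *v x = x + c *s w" by (simp add: algebra_simps)
    then have "Q x = Q x + c\<^sup>2 + c * b x w" using uQ[of x] w by (simp add: Q_add Q_scale bilin)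
    then have "c * (c + b x w) = 0" by (simp add: power2_eq_square algebra_simps)
    then have "c = 0 \<or> c = b x w" using neg by (metis add_eq_0_iff mult_eq_0_iff)
    then show ?thesis using c by auto
  qed
  have wnz: "w \<noteq> 0" using w Q_zero by auto
  obtain x1 where x1: "u *v x1 - x1 \<noteq> 0" using w wnz by (auto simp: fixed_image_def)
  then have bx1: "u *v x1 - x1 = b x1 w *s w" "b x1 w \<noteq> 0" using alternative[of x1] by auto
  have refl: "u *v x = x + b x w *s w" for x
  proof (cases "u *v x - x = 0")
    \<comment> \<open>Adding \<open>x1\<close>, which is certainly moved, turns the case of a fixed
      \<open>x\<close> into a comparison of displacements along \<open>w\<close> and yields
      \<open>b x w = 0\<close>.\<close>
    case True
    have "u *v (x + x1) - (x + x1) = b x1 w *s w"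
      using True bx1 by (simp add: matrix_vector_right_distrib algebra_simps)
    moreover have "b x1 w *s w \<noteq> 0" using bx1 x1 by simp
    ultimately have "b x1 w *s w = b (x + x1) w *s w" using alternative[of "x + x1"] by auto
    then have "b x w *s w = 0" by (simp add: bilin vec.scale_left_distrib)
    then show ?thesis using True by simp
  next
    case False
    then show ?thesis using alternative[of x] by (simp add: algebra_simps)
  qed
  show False
  proof (cases "\<exists>r. r \<noteq> 0 \<and> (\<forall>y. b r y = 0)")
    case True
    then obtain r where r: "r \<noteq> 0" "\<And>y. b r y = 0" by blast
    then have Qr: "Q r \<noteq> 0" using radical_zero by blast
    obtain c where c: "c\<^sup>2 = inverse (Q r)" using square_root_exists by blast
    \<comment> \<open>\<open>c\<close> makes \<open>Q (c *s r) = 1 = Q w\<close>, so the sum is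
      singular in characteristic 2. The centralizer component fixes \<open>w\<close>, since its
      factor squares to 1, and \<open>r\<close>, since the radical is anisotropic.\<close>
    define v where "v = w + c *s r"
    have br: "b y r = 0" for y using r polar_commute by metis
    have Qv: "Q v = 0" using w c Qr by (simp add: v_def Q_add Q_scale bilin br dbl)
    have "b x1 v \<noteq> 0" using bx1 by (simp add: v_def bilin br)
    then have vnz: "v \<noteq> 0" by (auto simp: bilin)
    have fixed_v: "g *v v = v" if g: "g \<in> ?C" for g
    proof -
      have gS: "g \<in> SO Q" using g centralizer_component(1) by blast
      obtain d where d: "g *v w = d *s w" using line stableD[OF stW g w(1)] by blast
      then have "d\<^sup>2 = 1" using isometry(2)[OF gS, of w] w by (simp add: Q_scale)
      then have "d = 1" by (rule sq1)
      then have gw: "g *v w = w" using d by simp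
      obtain g' where g': "g ** g' = mat 1"
        using subgroup_GL_inverse[OF subgroup_SO gS] by blast
      have grad: "b (g *v r) y = 0" for y
        using isometry(1)[OF gS, of r "g' *v y"] r(2) by (simp add: mult_inverse_vector[OF g'])
      have "g *v r - r = 0"
      proof (rule radical_zero)
        show "b (g *v r - r) y = 0" for y using grad r(2) by (simp add: bilin)
        show "Q (g *v r - r) = 0" using isometry(2)[OF gS, of r] grad by (simp add: Q_diff dbl)
      qed
      then show ?thesis using gw by (simp add: v_def matrix_vector_right_distrib vector_scalar_commute)
    qed
    have "totally_singular (vec.span {v})" by (rule totally_singular_line[OF Qv])
    moreover have "stable ?C (vec.span {v})"
      by (rule stable_line) (metis fixed_v vec.scale_one)
    ultimately have "vec.span {v} = {0}" by (rule ts_trivial)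
    then show False using vnz vec.span_base[of v "{v}"] by blast
  next
    case False
    then have nondeg: "x = 0" if "\<And>y. b x y = 0" for x using that by blast
    have "u \<in> identity_component (GO Q)" using u(1) F(2) char2 by (auto simp: SO_def)
    then show False
      using reflection_not_in_identity_component[OF two nondeg w(2) refl] by blast
  qed
qed

end

section \<open>Determinants of rank-one perturbations\<close>

lemma rank_one_det_unit:
  fixes z :: "'a::alg_closed_field ^ 'n"
  assumes \<phi>: "Vector_Spaces.linear (*s) (*) \<phi>" "\<phi> z = 0"
  shows "det (mat 1 + rank_one z \<phi>) = 1"
  using transvection_curve(1)[OF \<phi>, of 1] by (simp add: SL_def)

text \<open>The matrix factors into a transvection along the basis vector and the diagonal matrix
  \<open>D\<close>, which carries the determinant; \<open>\<eta>\<close> is the part of the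
  functional that vanishes on that vector.\<close>

lemma det_rank_one_axis:
  fixes \<phi> :: "'a::alg_closed_field ^ 'n \<Rightarrow> 'a"
  assumes \<phi>: "Vector_Spaces.linear (*s) (*) \<phi>"
  shows "det (mat 1 + rank_one (c *s axis k 1) \<phi>) = 1 + c * \<phi> (axis k 1)"
proof -
  interpret Vector_Spaces.linear "(*s)" "(*)" \<phi> by (rule \<phi>)
  let ?d = "c * \<phi> (axis k 1)"
  define D :: "'a ^ 'n ^ 'n" where "D = (\<chi> i j. if i = j then (if i = k then 1 + ?d else 1) else 0)"
  define \<eta> where "\<eta> x = c * \<phi> x - ?d * x $ k" for x
  have \<eta>: "Vector_Spaces.linear (*s) (*) \<eta>"
    by unfold_locales (simp_all add: \<eta>_def add scale algebra_simps)
  have D: "D *v x = x + (?d * x $ k) *s axis k 1" for x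
  proof -
    have "(\<Sum>j\<in>UNIV. (if i = j then (if i = k then 1 + ?d else 1) else 0) * x $ j)
        = (if i = k then 1 + ?d else 1) * x $ i" for i
      by (simp add: if_distrib[of "\<lambda>y. y * _"] cong: if_cong)
    then show ?thesis
      by (simp add: vec_eq_iff D_def matrix_vector_mult_def axis_def algebra_simps)
  qed
  have \<eta>0: "\<eta> (axis k 1) = 0" by (simp add: \<eta>_def)
  have "mat 1 + rank_one (c *s axis k 1) \<phi> = (mat 1 + rank_one (axis k 1) \<eta>) ** D"
    unfolding matrix_eq
  proof
    fix x
    have "\<eta> (D *v x) = c * \<phi> x - ?d * x $ k"
      unfolding D \<eta>_def by (simp add: add scale algebra_simps)
    then show "(mat 1 + rank_one (c *s axis k 1) \<phi>) *v x = ((mat 1 + rank_one (axis k 1) \<eta>) ** D) *v x"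
      by (simp add: matrix_vector_mult_add_rdistrib rank_one_mult[OF \<phi>] rank_one_mult[OF \<eta>] D
          vec.scale_left_diff_distrib mult.commute flip: matrix_vector_mul_assoc)
  qed
  moreover have "det D = 1 + ?d"
  proof -
    have "det D = (\<Prod>i\<in>UNIV. D $ i $ i)" by (rule det_diagonal) (simp add: D_def)
    also have "\<dots> = (\<Prod>i\<in>UNIV. if i = k then 1 + ?d else 1)" by (simp add: D_def)
    finally show ?thesis by simp
  qed
  ultimately show ?thesis using rank_one_det_unit[OF \<eta> \<eta>0] by (simp add: det_mul)
qed

text \<open>Conjugating by a transvection moves \<open>z\<close> to a multiple of a basis vector.\<close>

lemma det_rank_one:
  fixes \<phi> :: "'a::alg_closed_field ^ 'n \<Rightarrow> 'a"
  assumes \<phi>: "Vector_Spaces.linear (*s) (*) \<phi>"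
  shows "det (mat 1 + rank_one z \<phi>) = 1 + \<phi> z"
proof (cases "z = 0")
  case True
  interpret Vector_Spaces.linear "(*s)" "(*)" \<phi> by (rule \<phi>)
  have "mat 1 + rank_one z \<phi> = mat 1" using True by (simp add: rank_one_def vec_eq_iff)
  then show ?thesis using True by (simp add: zero)
next
  case False
  interpret Vector_Spaces.linear "(*s)" "(*)" \<phi> by (rule \<phi>)
  obtain k where k: "z $ k \<noteq> 0" using False by (auto simp: vec_eq_iff)
  define y where "y = inverse (z $ k) *s z - axis k 1"
  have \<psi>: "Vector_Spaces.linear (*s) (*) (\<lambda>x :: 'a ^ 'n. x $ k)"
    by unfold_locales simp_all
  have y0: "y $ k = 0" using k by (simp add: y_def)
  define L where "L = mat 1 + rank_one y (\<lambda>x. x $ k)"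
  have L: "L *v x = x + (x $ k) *s y" for x
    by (simp add: L_def matrix_vector_mult_add_rdistrib rank_one_mult[OF \<psi>])
  have detL: "det L = 1" unfolding L_def by (rule rank_one_det_unit[OF \<psi> y0])
  define \<phi>' where "\<phi>' x = \<phi> (L *v x)" for x
  have \<phi>': "Vector_Spaces.linear (*s) (*) \<phi>'"
    by unfold_locales (simp_all add: \<phi>'_def matrix_vector_right_distrib vector_scalar_commute add scale)
  have Lk: "L *v axis k 1 = inverse (z $ k) *s z" by (simp add: L y_def axis_def)
  have Lz: "L *v ((a * z $ k) *s axis k 1) = a *s z" for a
    using k by (simp add: vector_scalar_commute Lk)
  have "(mat 1 + rank_one z \<phi>) ** L = L ** (mat 1 + rank_one (z $ k *s axis k 1) \<phi>')"
    unfolding matrix_eq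
    by (simp add: matrix_vector_mult_add_rdistrib rank_one_mult[OF \<phi>] rank_one_mult[OF \<phi>']
        matrix_vector_right_distrib Lz \<phi>'_def[symmetric]
        flip: matrix_vector_mul_assoc)
  then have "det (mat 1 + rank_one z \<phi>) * det L = det L * det (mat 1 + rank_one (z $ k *s axis k 1) \<phi>')"
    by (metis det_mul)
  then have "det (mat 1 + rank_one z \<phi>) = 1 + z $ k * \<phi>' (axis k 1)"
    using detL det_rank_one_axis[OF \<phi>'] by simp
  then show ?thesis using k by (simp add: \<phi>'_def Lk scale)
qed

section \<open>Weight spaces\<close>

lemma subspace_weight_space: "vec.subspace (weight_space F \<phi>)"
  by (auto simp: weight_space_def vec.subspace_def matrix_vector_right_distrib vector_scalar_commute
      vec.scale_right_distrib mult.commute)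

context form_space
begin

definition isometries_on :: "('a ^ 'n) set \<Rightarrow> ('a ^ 'n ^ 'n) set" where
  "isometries_on W = {g \<in> G. \<forall>v. (\<forall>w\<in>W. b v w = 0) \<longrightarrow> g *v v = v}"

text \<open>The space is the sum of \<open>W\<close> and its orthogonal. With a nondegenerate
  \<open>b\<close> this form of nondegeneracy yields \<open>perp (perp W) \<subseteq> W\<close> and
  projections without counting dimensions.\<close>

definition splits :: "('a ^ 'n) set \<Rightarrow> bool" where
  "splits W \<longleftrightarrow> vec.subspace W \<and> (\<forall>v. \<exists>w\<in>W. v - w \<in> perp W)"

lemma isometries_on_iff: "g \<in> isometries_on W \<longleftrightarrow> g \<in> G \<and> (\<forall>v\<in>perp W. g *v v = v)"
  by (auto simp: isometries_on_def perp_def)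

lemma splitsD: "splits W \<Longrightarrow> vec.subspace W" "splits W \<Longrightarrow> \<exists>w\<in>W. v - w \<in> perp W"
  by (simp_all add: splits_def)

lemma splits_UNIV: "splits UNIV"
  by (auto simp: splits_def perp_def bilin vec.subspace_UNIV)

lemma subgroup_isometries_on: "subgroup (isometries_on W) GL"
  unfolding subgroup_GL_iff
proof (intro conjI ballI)
  show "mat 1 \<in> isometries_on W" using subgroup_GL_one[OF subgroup_G] by (simp add: isometries_on_iff)
  fix A assume A: "A \<in> isometries_on W"
  show "A ** B \<in> isometries_on W" if "B \<in> isometries_on W" for B
    using A that subgroup_GL_mult[OF subgroup_G]
    by (simp add: isometries_on_iff flip: matrix_vector_mul_assoc)
  obtain B where B: "B \<in> G" "A ** B = mat 1" "B ** A = mat 1"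
    using A subgroup_GL_inverse[OF subgroup_G] unfolding isometries_on_iff by blast
  have "B *v v = v" if "v \<in> perp W" for v
    using A that mult_inverse_vector[OF B(3), of v] by (simp add: isometries_on_iff)
  then show "\<exists>B\<in>isometries_on W. A ** B = mat 1 \<and> B ** A = mat 1"
    using B by (auto simp: isometries_on_iff)
qed

end

section \<open>Orthogonal projections and restrictions to a subspace\<close>

locale nondegenerate_space = form_space b q \<epsilon> adm G
  for b :: "'a::alg_closed_field ^ 'n \<Rightarrow> 'a ^ 'n \<Rightarrow> 'a" and q \<epsilon> adm and G +
  assumes nondegenerate: "(\<And>y. b x y = 0) \<Longrightarrow> x = 0"
begin

lemma splits_nondegenerate:
  assumes W: "splits W" and x: "x \<in> W" "\<And>y. y \<in> W \<Longrightarrow> b x y = 0"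
  shows "x = 0"
proof (rule nondegenerate)
  fix y
  obtain w where w: "w \<in> W" "y - w \<in> perp W" using splitsD(2)[OF W] by blast
  then have "b (y - w) x = 0" using x(1) by (simp add: perp_def)
  then have "b x (y - w) = 0" using b_swap_zero by blast
  then show "b x y = 0" using x(2)[OF w(1)] by (simp add: bilin)
qed

lemma splits_perp_perp:
  assumes W: "splits W" and x: "x \<in> perp (perp W)"
  shows "x \<in> W"
proof -
  obtain w where w: "w \<in> W" "x - w \<in> perp W" using splitsD(2)[OF W] by blast
  have "x - w = 0"
  proof (rule nondegenerate)
    fix y
    obtain z where z: "z \<in> W" "y - z \<in> perp W" using splitsD(2)[OF W] by blast
    have "b (x - w) z = 0" using w(2) z(1) by (simp add: perp_def)
    moreover have "b x (y - z) = 0" using x z(2) by (simp add: perp_def)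
    moreover have "b w (y - z) = 0" using z(2) w(1) b_swap_zero by (simp add: perp_def)
    ultimately show "b (x - w) y = 0" by (simp add: bilin)
  qed
  then show ?thesis using w(1) by simp
qed

lemma isometries_on_maps:
  assumes W: "splits W" and g: "g \<in> G" "\<And>v. v \<in> perp W \<Longrightarrow> g *v v = v" and w: "w \<in> W"
  shows "g *v w \<in> W"
proof (rule splits_perp_perp[OF W])
  have "b (g *v w) z = 0" if z: "z \<in> perp W" for z
  proof -
    have "b (g *v w) z = b w z" using isometry(1)[OF g(1), of w z] g(2)[OF z] by simp
    then show ?thesis using z w b_swap_zero by (auto simp: perp_def)
  qed
  then show "g *v w \<in> perp (perp W)" by (simp add: perp_def[of "perp W"])
qed

definition proj :: "('a ^ 'n) set \<Rightarrow> 'a ^ 'n \<Rightarrow> 'a ^ 'n" where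
  "proj W v = (SOME w. w \<in> W \<and> v - w \<in> perp W)"

lemma proj:
  assumes "splits W" shows "proj W v \<in> W" "v - proj W v \<in> perp W"
  using someI_ex[of "\<lambda>w. w \<in> W \<and> v - w \<in> perp W"] splitsD(2)[OF assms, of v]
  unfolding proj_def by blast+

lemma proj_eqI:
  assumes W: "splits W" and w: "w \<in> W" "v - w \<in> perp W"
  shows "proj W v = w"
proof -
  have "proj W v - w = 0"
  proof (rule splits_nondegenerate[OF W])
    show "proj W v - w \<in> W" using proj(1)[OF W] w(1) vec.subspace_diff[OF splitsD(1)[OF W]] by blast
    have "(v - w) - (v - proj W v) \<in> perp W"
      using proj(2)[OF W] w(2) vec.subspace_diff[OF subspace_perp] by blast
    then show "b (proj W v - w) y = 0" if "y \<in> W" for y using that by (simp add: perp_def)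
  qed
  then show ?thesis by simp
qed

lemma proj_matrix:
  assumes W: "splits W" shows "matrix (proj W) *v v = proj W v"
proof (rule matrix_works)
  note Ws = splitsD(1)[OF W]
  show "Vector_Spaces.linear (*s) (*s) (proj W)"
  proof unfold_locales
    fix x y c
    have "x + y - (proj W x + proj W y) = (x - proj W x) + (y - proj W y)" by simp
    also have "\<dots> \<in> perp W" by (intro vec.subspace_add[OF subspace_perp] proj(2)[OF W])
    finally show "proj W (x + y) = proj W x + proj W y"
      by (intro proj_eqI[OF W] vec.subspace_add[OF Ws] proj(1)[OF W])
    have "c *s x - c *s proj W x = c *s (x - proj W x)" by (simp add: vec.scale_right_diff_distrib)
    also have "\<dots> \<in> perp W" by (intro vec.subspace_scale[OF subspace_perp] proj(2)[OF W])
    finally show "proj W (c *s x) = c *s proj W x"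
      by (intro proj_eqI[OF W] vec.subspace_scale[OF Ws] proj(1)[OF W])
  qed
qed

text \<open>Acts as \<open>g\<close> on \<open>W\<close> and trivially on its orthogonal. Being
  affine in \<open>g\<close> and defined for every matrix, it makes the determinant of the
  restriction a polynomial function, ready for connectedness arguments.\<close>

definition restrict_to :: "('a ^ 'n) set \<Rightarrow> 'a ^ 'n ^ 'n \<Rightarrow> 'a ^ 'n ^ 'n" where
  "restrict_to W g = g ** matrix (proj W) + (mat 1 - matrix (proj W))"

lemma poly_map_restrict_to: "poly_map (restrict_to W)"
  unfolding restrict_to_def by (intro poly_map_add poly_map_mult poly_map_id poly_map_const)

lemma restrict_to_mult:
  assumes "splits W" shows "restrict_to W g *v v = g *v proj W v + (v - proj W v)"
  by (simp add: restrict_to_def matrix_vector_mult_add_rdistrib matrix_vector_mult_diff_rdistrib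
      proj_matrix[OF assms] flip: matrix_vector_mul_assoc)

lemma restrict_to_on:
  assumes W: "splits W" "w \<in> W" shows "restrict_to W g *v w = g *v w"
  using proj_eqI[OF W(1), of w w] W(2) vec.subspace_0[OF subspace_perp]
  by (simp add: restrict_to_mult[OF W(1)])

lemma restrict_to_perp:
  assumes W: "splits W" "v \<in> perp W" shows "restrict_to W g *v v = v"
  using proj_eqI[OF W(1), of 0 v] W(2) vec.subspace_0[OF splitsD(1)[OF W(1)]]
  by (simp add: restrict_to_mult[OF W(1)])

lemma restrict_to_isometry:
  assumes W: "splits W" and g: "g \<in> G" "\<And>w. w \<in> W \<Longrightarrow> g *v w \<in> W"
  shows "b (restrict_to W g *v x) (restrict_to W g *v y) = b x y"
    "q (restrict_to W g *v x) = q x"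
proof -
  have perp0: "b w z = 0" "b z w = 0" if "w \<in> W" "z \<in> perp W" for w z
    using that b_swap_zero by (auto simp: perp_def)
  have gp: "g *v proj W v \<in> W" for v using g(2) proj(1)[OF W] by blast
  have "b (restrict_to W g *v x) (restrict_to W g *v y)
      = b (g *v proj W x) (g *v proj W y) + b (x - proj W x) (y - proj W y)"
    unfolding restrict_to_mult[OF W] left.add right.add
    using perp0[OF gp[of x] proj(2)[OF W, of y]] perp0[OF gp[of y] proj(2)[OF W, of x]]
    by (simp only: add_0_left add_0_right)
  also have "\<dots> = b (proj W x) (proj W y) + b (x - proj W x) (y - proj W y)"
    using isometry(1)[OF g(1)] by simp
  also have "\<dots> = b (proj W x + (x - proj W x)) (proj W y + (y - proj W y))"
    unfolding left.add right.add
    using perp0[OF proj(1)[OF W, of x] proj(2)[OF W, of y]] perp0[OF proj(1)[OF W, of y] proj(2)[OF W, of x]]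
    by (simp only: add_0_left add_0_right)
  finally show "b (restrict_to W g *v x) (restrict_to W g *v y) = b x y" by simp
  have "q (restrict_to W g *v x) = q (g *v proj W x) + q (x - proj W x)"
    unfolding restrict_to_mult[OF W] by (rule q_add) (rule perp0(1)[OF gp proj(2)[OF W]])
  also have "\<dots> = q (proj W x) + q (x - proj W x)" using isometry(2)[OF g(1)] by simp
  also have "\<dots> = q (proj W x + (x - proj W x))"
    by (rule q_add[symmetric]) (rule perp0(1)[OF proj(1)[OF W] proj(2)[OF W]])
  finally show "q (restrict_to W g *v x) = q x" by simp
qed

end

section \<open>Weight decomposition for a finite group of involutions\<close>

locale involution_group = nondegenerate_space b q \<epsilon> adm G
  for b :: "'a::alg_closed_field ^ 'n \<Rightarrow> 'a ^ 'n \<Rightarrow> 'a" and q \<epsilon> adm and G +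
  fixes F
  assumes two: "(2::'a) \<noteq> 0"
    and F: "subgroup F GL" "F \<subseteq> G" "finite F"
    and involutions: "\<And>f. f \<in> F \<Longrightarrow> f ** f = mat 1"
begin

lemma F_commute:
  assumes "f \<in> F" "g \<in> F" shows "f ** g = g ** f"
proof -
  have "(f ** g) ** (f ** g) = mat 1" using involutions subgroup_GL_mult[OF F(1)] assms by blast
  then have "f ** ((f ** g) ** (f ** g)) ** g = f ** g" by simp
  moreover have "f ** ((f ** g) ** (f ** g)) ** g = (f ** f) ** g ** f ** (g ** g)"
    by (simp add: matrix_mul_assoc)
  ultimately show ?thesis using involutions assms by simp
qed

lemma elementary_abelian: "elementary_abelian_2 F"
  unfolding elementary_abelian_2_def
proof (intro conjI ballI involutions)
  have "group (GL\<lparr>carrier := F\<rparr>)" using F(1) group_GL subgroup.subgroup_is_group by blast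
  then show "comm_group (GL\<lparr>carrier := F\<rparr>)"
    by (rule group.group_comm_groupI) (simp add: GL_def F_commute)
qed

text \<open>A further involution \<open>g\<close> splits a common eigenvector \<open>w\<close> as
  half of the sum of \<open>w + g *v w\<close> and \<open>w - g *v w\<close>; here 2 must be
  invertible.\<close>

lemma span_common_eigenvectors:
  assumes "finite A" "A \<subseteq> F"
  shows "v \<in> vec.span {w. \<forall>f\<in>A. f *v w = w \<or> f *v w = - w}"
  using assms
proof (induction A arbitrary: v rule: finite_induct)
  case (insert g A)
  let ?E = "\<lambda>A. {w. \<forall>f\<in>A. f *v w = w \<or> f *v w = - w}"
  have gF: "g \<in> F" using insert.prems by simp
  have gg: "g *v (g *v x) = x" for x using mult_inverse_vector[OF involutions[OF gF]] .
  have "?E A \<subseteq> vec.span (?E (insert g A))"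
  proof
    fix w assume w: "w \<in> ?E A"
    have comm: "f *v (g *v w) = g *v (f *v w)" if "f \<in> A" for f
      using F_commute[of f g] gF insert.prems that by (auto simp: matrix_vector_mul_assoc)
    have 1: "w + g *v w \<in> ?E (insert g A)"
    proof -
      have "f *v (w + g *v w) = w + g *v w \<or> f *v (w + g *v w) = - (w + g *v w)" if "f \<in> A" for f
        using w that comm[OF that] by (auto simp: matrix_vector_right_distrib vec.neg)
      moreover have "g *v (w + g *v w) = w + g *v w"
        by (simp add: matrix_vector_right_distrib gg add.commute)
      ultimately show ?thesis by blast
    qed
    have 2: "w - g *v w \<in> ?E (insert g A)"
    proof -
      have "f *v (w - g *v w) = w - g *v w \<or> f *v (w - g *v w) = - (w - g *v w)" if "f \<in> A" for f
        using w that comm[OF that] by (auto simp: matrix_vector_mult_diff_distrib vec.neg)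
      moreover have "g *v (w - g *v w) = - (w - g *v w)"
        by (simp add: matrix_vector_mult_diff_distrib gg)
      ultimately show ?thesis by blast
    qed
    have "2 *s w = (w + g *v w) + (w - g *v w)"
      by (simp add: vec_eq_iff)
    also have "\<dots> \<in> vec.span (?E (insert g A))"
      by (intro vec.span_add vec.span_base 1 2)
    finally show "w \<in> vec.span (?E (insert g A))"
      using subspace_scale_cancel[OF vec.subspace_span _ two] by blast
  qed
  then have "vec.span (?E A) \<subseteq> vec.span (?E (insert g A))"
    by (rule vec.span_minimal[OF _ vec.subspace_span])
  moreover have "v \<in> vec.span (?E A)" using insert.IH insert.prems by blast
  ultimately show ?case by blast
qed simp

lemma weight_cases: "W \<in> weight_spaces F \<Longrightarrow> \<exists>\<phi>. (\<forall>f\<in>F. \<phi> f = 1 \<or> \<phi> f = -1) \<and> W = weight_space F \<phi>"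
  unfolding weight_spaces_def by blast

lemma weight_subspace: "W \<in> weight_spaces F \<Longrightarrow> vec.subspace W"
  using weight_cases subspace_weight_space by blast

lemma common_eigenvector_in_weight_space:
  assumes w: "w \<noteq> 0" "\<forall>f\<in>F. f *v w = w \<or> f *v w = - w"
  shows "\<exists>W\<in>weight_spaces F. w \<in> W"
proof -
  define \<phi> where "\<phi> f = (if f *v w = w then 1 else -1 :: 'a)" for f
  have act: "f *v w = \<phi> f *s w" if "f \<in> F" for f
    using w(2) that by (auto simp: \<phi>_def)
  have mem: "w \<in> weight_space F \<phi>" using act by (simp add: weight_space_def)
  have "\<phi> (f ** g) = \<phi> f * \<phi> g" if "f \<in> F" "g \<in> F" for f g
  proof -
    have "(f ** g) *v w = (\<phi> f * \<phi> g) *s w"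
      using act that by (simp add: vector_scalar_commute mult.commute flip: matrix_vector_mul_assoc)
    then have "\<phi> (f ** g) *s w = (\<phi> f * \<phi> g) *s w" using act subgroup_GL_mult[OF F(1) that] by simp
    then show ?thesis using w(1) by simp
  qed
  moreover have "\<forall>f\<in>F. \<phi> f \<in> {1, -1}" by (simp add: \<phi>_def)
  moreover have "weight_space F \<phi> \<noteq> {0}" using mem w(1) by blast
  ultimately have "weight_space F \<phi> \<in> weight_spaces F" unfolding weight_spaces_def by blast
  then show ?thesis using mem by blast
qed

lemma span_weight_spaces: "vec.span (\<Union>(weight_spaces F)) = UNIV"
proof -
  have "{w. \<forall>f\<in>F. f *v w = w \<or> f *v w = - w} \<subseteq> vec.span (\<Union>(weight_spaces F))"
  proof
    fix w assume w: "w \<in> {w. \<forall>f\<in>F. f *v w = w \<or> f *v w = - w}"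
    show "w \<in> vec.span (\<Union>(weight_spaces F))"
    proof (cases "w = 0")
      case False
      moreover have "\<forall>f\<in>F. f *v w = w \<or> f *v w = - w" using w by simp
      ultimately obtain W where "W \<in> weight_spaces F" "w \<in> W"
        using common_eigenvector_in_weight_space by meson
      then show ?thesis by (intro vec.span_base UnionI)
    qed (simp add: vec.span_zero)
  qed
  then have "vec.span {w. \<forall>f\<in>F. f *v w = w \<or> f *v w = - w} \<subseteq> vec.span (\<Union>(weight_spaces F))"
    by (rule vec.span_minimal[OF _ vec.subspace_span])
  then show ?thesis using span_common_eigenvectors[OF F(3) subset_refl] by blast
qed

text \<open>Different characters have opposite signs at some \<open>f\<close>, and invariance under
  \<open>f\<close> gives \<open>b x y = - b x y\<close>.\<close>

lemma weight_spaces_orthogonal: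
  assumes W: "W \<in> weight_spaces F" "W' \<in> weight_spaces F" "W \<noteq> W'" and x: "x \<in> W" and y: "y \<in> W'"
  shows "b x y = 0"
proof -
  obtain \<phi> where \<phi>: "\<forall>f\<in>F. \<phi> f = 1 \<or> \<phi> f = -1" "W = weight_space F \<phi>" using weight_cases[OF W(1)] by blast
  obtain \<psi> where \<psi>: "\<forall>f\<in>F. \<psi> f = 1 \<or> \<psi> f = -1" "W' = weight_space F \<psi>" using weight_cases[OF W(2)] by blast
  have "\<exists>f\<in>F. \<phi> f \<noteq> \<psi> f"
  proof (rule ccontr)
    assume "\<not> ?thesis"
    then have "W = W'" unfolding \<phi>(2) \<psi>(2) weight_space_def by auto
    then show False using W(3) by blast
  qed
  then obtain f where f: "f \<in> F" "\<phi> f \<noteq> \<psi> f" by blast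
  then have fg: "\<phi> f * \<psi> f = -1" using \<phi>(1) \<psi>(1) by fastforce
  have fxy: "f *v x = \<phi> f *s x" "f *v y = \<psi> f *s y"
    using x y f(1) \<phi>(2) \<psi>(2) by (auto simp: weight_space_def)
  have "b x y = b (f *v x) (f *v y)" using isometry(1)[of f x y] f(1) F(2) by auto
  also have "\<dots> = (\<phi> f * \<psi> f) * b x y" unfolding fxy by (simp only: bilin mult_ac)
  finally have "b x y = (\<phi> f * \<psi> f) * b x y" .
  then have "2 * b x y = 0" unfolding fg by (simp add: eq_neg_iff_add_eq_0)
  then show ?thesis using two by simp
qed

lemma weight_perp: "W \<in> weight_spaces F \<Longrightarrow> W' \<in> weight_spaces F \<Longrightarrow> W \<noteq> W' \<Longrightarrow> W' \<subseteq> perp W"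
  using weight_spaces_orthogonal by (auto simp: perp_def)

text \<open>The vectors decomposable along \<open>W\<close> form a subspace. It contains
  \<open>W\<close> and the other weight spaces, which are orthogonal to \<open>W\<close>, and
  together these span.\<close>

lemma weight_splits:
  assumes W: "W \<in> weight_spaces F" shows "splits W"
proof -
  note Ws = weight_subspace[OF W]
  define X where "X = {v. \<exists>w\<in>W. v - w \<in> perp W}"
  have "vec.subspace X"
  proof (rule vec.subspaceI)
    show "0 \<in> X"
      using vec.subspace_0[OF Ws] vec.subspace_0[OF subspace_perp] by (auto simp: X_def intro!: bexI[of _ 0])
    fix x assume "x \<in> X"
    then obtain w where w: "w \<in> W" "x - w \<in> perp W" by (auto simp: X_def)
    show "c *s x \<in> X" for c
      using vec.subspace_scale[OF Ws w(1), of c] vec.subspace_scale[OF subspace_perp w(2), of c]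
      by (auto simp: X_def vec.scale_right_diff_distrib)
    fix y assume "y \<in> X"
    then obtain z where z: "z \<in> W" "y - z \<in> perp W" by (auto simp: X_def)
    have eq: "x + y - (w + z) = (x - w) + (y - z)" by simp
    have "x + y - (w + z) \<in> perp W" unfolding eq by (rule vec.subspace_add[OF subspace_perp w(2) z(2)])
    then show "x + y \<in> X" using vec.subspace_add[OF Ws w(1) z(1)] by (auto simp: X_def)
  qed
  moreover have "\<Union>(weight_spaces F) \<subseteq> X"
  proof
    fix x assume "x \<in> \<Union>(weight_spaces F)"
    then obtain W' where W': "W' \<in> weight_spaces F" "x \<in> W'" by blast
    show "x \<in> X"
    proof (cases "W' = W")
      case True
      then show ?thesis using W' vec.subspace_0[OF subspace_perp] by (auto simp: X_def intro!: bexI[of _ x])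
    next
      case False
      then show ?thesis using weight_perp[OF W W'(1)] W'(2) vec.subspace_0[OF Ws]
        by (auto simp: X_def intro!: bexI[of _ 0])
    qed
  qed
  ultimately have "vec.span (\<Union>(weight_spaces F)) \<subseteq> X" by (intro vec.span_minimal)
  then show ?thesis using Ws unfolding span_weight_spaces by (auto simp: splits_def X_def)
qed

lemma weight_nondegenerate:
  "W \<in> weight_spaces F \<Longrightarrow> x \<in> W \<Longrightarrow> (\<And>y. y \<in> W \<Longrightarrow> b x y = 0) \<Longrightarrow> x = 0"
  using splits_nondegenerate[OF weight_splits] by blast

text \<open>A weight space depends on its character only through the values on the finite
  \<open>F\<close>.\<close>

lemma finite_weight_spaces: "finite (weight_spaces F)"
proof -
  have "weight_spaces F \<subseteq> (\<lambda>\<phi>. weight_space F \<phi>) ` (F \<rightarrow>\<^sub>E {1, -1})"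
  proof
    fix W assume "W \<in> weight_spaces F"
    then obtain \<phi> where \<phi>: "\<forall>f\<in>F. \<phi> f = 1 \<or> \<phi> f = -1" "W = weight_space F \<phi>"
      using weight_cases by blast
    then have "W = weight_space F (restrict \<phi> F)" by (auto simp: weight_space_def)
    moreover have "restrict \<phi> F \<in> F \<rightarrow>\<^sub>E {1, -1}" using \<phi>(1) by (auto simp: PiE_iff)
    ultimately show "W \<in> (\<lambda>\<phi>. weight_space F \<phi>) ` (F \<rightarrow>\<^sub>E {1, -1})" by blast
  qed
  then show ?thesis by (rule finite_subset) (simp add: finite_PiE F(3))
qed

text \<open>The sum is direct: \<open>W\<close> meets the span of the others in vectors of
  \<open>W\<close> orthogonal to \<open>W\<close>, which are zero.\<close>

lemma sum_dim_weight_spaces: "(\<Sum>W\<in>weight_spaces F. vec.dim W) = CARD('n)"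
proof -
  have "finite \<W> \<Longrightarrow> \<W> \<subseteq> weight_spaces F \<Longrightarrow> (\<Sum>W\<in>\<W>. vec.dim W) = vec.dim (vec.span (\<Union>\<W>))" for \<W>
  proof (induction \<W> rule: finite_induct)
    case empty
    then show ?case by simp
  next
    case (insert W \<W>)
    then have W: "W \<in> weight_spaces F" by blast
    have spW: "vec.span W = W" using weight_subspace[OF W] by simp
    have "vec.span (\<Union>\<W>) \<subseteq> perp W"
      by (rule vec.span_minimal[OF _ subspace_perp])
        (use insert weight_perp[OF W] in blast)
    then have "W \<inter> vec.span (\<Union>\<W>) \<subseteq> {0}"
      using weight_nondegenerate[OF W] by (auto simp: perp_def)
    then have int: "vec.dim (W \<inter> vec.span (\<Union>\<W>)) = 0"
      using vec.dim_subset[of "W \<inter> vec.span (\<Union>\<W>)" "{0}"] by simp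
    have "vec.span (\<Union>(insert W \<W>)) = {x + y |x y. x \<in> W \<and> y \<in> vec.span (\<Union>\<W>)}"
      by (simp add: vec.span_Un spW)
    then have "vec.dim (vec.span (\<Union>(insert W \<W>))) = vec.dim W + vec.dim (vec.span (\<Union>\<W>))"
      using vec.dim_sums_Int[OF weight_subspace[OF W] vec.subspace_span[of "\<Union>\<W>"]] int by simp
    then show ?case using insert by simp
  qed
  from this[OF finite_weight_spaces subset_refl] show ?thesis
    unfolding span_weight_spaces using vec_dim_card by simp
qed

lemma matrix_eq_on_weight_spaces:
  assumes "\<And>W w. W \<in> weight_spaces F \<Longrightarrow> w \<in> W \<Longrightarrow> A *v w = B *v w"
  shows "A = B"
proof -
  have "vec.subspace {v. A *v v = B *v v}"
    by (auto simp: vec.subspace_def matrix_vector_right_distrib vector_scalar_commute)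
  then have "vec.span (\<Union>(weight_spaces F)) \<subseteq> {v. A *v v = B *v v}"
    using assms by (intro vec.span_minimal) auto
  then show ?thesis unfolding span_weight_spaces matrix_eq by blast
qed

lemma stable_weight_space:
  assumes W: "W \<in> weight_spaces F" shows "stable (centralizer G F) W"
  unfolding stable_def
proof (intro ballI)
  fix g w assume g: "g \<in> centralizer G F" and w: "w \<in> W"
  obtain \<phi> where \<phi>: "W = weight_space F \<phi>" using weight_cases[OF W] by blast
  have "f *v (g *v w) = \<phi> f *s (g *v w)" if "f \<in> F" for f
  proof -
    have "f *v (g *v w) = g *v (f *v w)" using g that by (auto simp: centralizer_def matrix_vector_mul_assoc)
    then show ?thesis using w that by (simp add: \<phi> weight_space_def vector_scalar_commute)
  qed
  then show "g *v w \<in> W" by (simp add: \<phi> weight_space_def)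
qed

lemma isometries_on_weight_space:
  assumes W: "W \<in> weight_spaces F" and g: "g \<in> isometries_on W" and W': "W' \<in> weight_spaces F" and w: "w \<in> W'"
  shows "g *v w \<in> W'" "W' \<noteq> W \<Longrightarrow> g *v w = w"
proof -
  have "W' \<noteq> W \<Longrightarrow> w \<in> perp W" using weight_perp[OF W W'] w by blast
  then show "W' \<noteq> W \<Longrightarrow> g *v w = w" using g by (simp add: isometries_on_iff)
  then show "g *v w \<in> W'"
    using w isometries_on_maps[OF weight_splits[OF W]] g by (cases "W' = W") (auto simp: isometries_on_iff)
qed

lemma isometries_on_centralize:
  assumes W: "W \<in> weight_spaces F"
  shows "isometries_on W \<subseteq> centralizer G F"
proof
  fix g assume g: "g \<in> isometries_on W"
  have "g ** f = f ** g" if f: "f \<in> F" for f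
  proof (rule matrix_eq_on_weight_spaces)
    fix W' w assume W': "W' \<in> weight_spaces F" and w: "w \<in> W'"
    obtain \<phi> where \<phi>: "W' = weight_space F \<phi>" using weight_cases[OF W'] by blast
    have "g *v w \<in> W'" using isometries_on_weight_space(1)[OF W g W' w] .
    then show "(g ** f) *v w = (f ** g) *v w"
      using w f by (simp add: \<phi> weight_space_def vector_scalar_commute flip: matrix_vector_mul_assoc)
  qed
  then show "g \<in> centralizer G F" using g by (simp add: centralizer_def isometries_on_iff)
qed

lemma generate_fixes:
  assumes "g \<in> generate GL S" "S \<subseteq> G" "\<And>s. s \<in> S \<Longrightarrow> s *v w = w"
  shows "g *v w = w"
proof -
  have "subgroup {g \<in> G. g *v w = w} GL"
    unfolding subgroup_GL_iff
  proof (intro conjI ballI)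
    fix A assume A: "A \<in> {g \<in> G. g *v w = w}"
    then obtain B where B: "B \<in> G" "A ** B = mat 1" "B ** A = mat 1"
      using subgroup_GL_inverse[OF subgroup_G] by blast
    then have "B *v w = w" using mult_inverse_vector[OF B(3), of w] A by simp
    then show "\<exists>B\<in>{g \<in> G. g *v w = w}. A ** B = mat 1 \<and> B ** A = mat 1" using B by blast
  qed (auto simp: subgroup_GL_one[OF subgroup_G] subgroup_GL_mult[OF subgroup_G] simp flip: matrix_vector_mul_assoc)
  then have "generate GL S \<subseteq> {g \<in> G. g *v w = w}"
    using assms(2,3) by (intro group.generate_subgroup_incl[OF group_GL]) auto
  then show ?thesis using assms(1) by blast
qed

text \<open>One weight space is peeled off at a time: multiplying \<open>g\<close> by the inverse of
  its restriction to \<open>W\<close> makes it trivial on \<open>W\<close> and leaves its action on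
  the other weight spaces unchanged.\<close>

lemma in_generate_isometries_on:
  assumes "finite \<W>" "\<W> \<subseteq> weight_spaces F" "g \<in> centralizer G F"
    and "\<And>W w. W \<in> weight_spaces F - \<W> \<Longrightarrow> w \<in> W \<Longrightarrow> g *v w = w"
    and "\<And>W. W \<in> \<W> \<Longrightarrow> restrict_to W g \<in> G"
  shows "g \<in> generate GL (\<Union>W\<in>\<W>. isometries_on W)"
  using assms
proof (induction \<W> arbitrary: g rule: finite_induct)
  case empty
  have "g = mat 1" by (rule matrix_eq_on_weight_spaces) (use empty.prems in simp)
  then have "g = \<one>\<^bsub>GL\<^esub>" by (simp add: GL_def)
  then show ?case using generate.one[of GL] by simp
next
  case (insert W \<W>)
  have W: "W \<in> weight_spaces F" using insert.prems by blast
  note sp = weight_splits[OF W]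
  define h where "h = restrict_to W g"
  have h: "h \<in> isometries_on W"
    using insert.prems(4)[of W] restrict_to_perp[OF sp] by (simp add: h_def isometries_on_iff)
  then obtain h' where h': "h' \<in> isometries_on W" "h ** h' = mat 1" "h' ** h = mat 1"
    using subgroup_GL_inverse[OF subgroup_isometries_on] by blast
  have st: "g *v w \<in> W'" if "W' \<in> weight_spaces F" "w \<in> W'" for W' w
    using stableD[OF stable_weight_space[OF that(1)] insert.prems(2) that(2)] .
  have on_other: "(h' ** g) *v w = g *v w" if "W' \<in> weight_spaces F" "w \<in> W'" "W' \<noteq> W" for W' w
    using isometries_on_weight_space(2)[OF W h'(1) that(1) st[OF that(1,2)] that(3)]
    by (simp flip: matrix_vector_mul_assoc)
  have on_W: "(h' ** g) *v w = w" if "w \<in> W" for w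
    using restrict_to_on[OF sp that, of g] mult_inverse_vector[OF h'(3), of w]
    by (simp add: h_def flip: matrix_vector_mul_assoc)
  have "h' ** g \<in> generate GL (\<Union>W\<in>\<W>. isometries_on W)"
  proof (rule insert.IH)
    show "h' ** g \<in> centralizer G F"
      using isometries_on_centralize[OF W] h'(1) insert.prems(2)
        subgroup_GL_mult[OF subgroup_centralizer[OF subgroup_G]] by blast
    show "(h' ** g) *v w = w" if W': "W' \<in> weight_spaces F - \<W>" and w: "w \<in> W'" for W' w
    proof (cases "W' = W")
      case False
      then have "g *v w = w" using insert.prems(3)[of W' w] W' w by blast
      then show ?thesis using on_other[of W' w] W' w False by simp
    qed (use on_W w in simp)
    show "restrict_to W' (h' ** g) \<in> G" if W': "W' \<in> \<W>" for W'
    proof -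
      have W'2: "W' \<in> weight_spaces F" "W' \<noteq> W" using W' insert by auto
      have "restrict_to W' (h' ** g) = restrict_to W' g"
        unfolding matrix_eq restrict_to_mult[OF weight_splits[OF W'2(1)]]
        using on_other[OF W'2(1) proj(1)[OF weight_splits[OF W'2(1)]] W'2(2)] by simp
      then show ?thesis using insert.prems(4) W' by simp
    qed
  qed (use insert.prems in blast)
  then have "h' ** g \<in> generate GL (\<Union>W\<in>insert W \<W>. isometries_on W)"
    using group.mono_generate[OF group_GL, of "\<Union>W\<in>\<W>. isometries_on W" "\<Union>W\<in>insert W \<W>. isometries_on W"]
    by blast
  moreover have "h \<in> generate GL (\<Union>W\<in>insert W \<W>. isometries_on W)"
    by (rule generate.incl) (use h in blast)
  ultimately have "h \<otimes>\<^bsub>GL\<^esub> (h' ** g) \<in> generate GL (\<Union>W\<in>insert W \<W>. isometries_on W)"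
    by (rule generate.eng[rotated])
  moreover have "h \<otimes>\<^bsub>GL\<^esub> (h' ** g) = g"
    using h'(2) by (simp add: GL_def matrix_mul_assoc)
  ultimately show ?case by simp
qed

text \<open>The common end of both cases. \<open>\<W>\<close> will be all weight spaces for
  symplectic groups and those of dimension at least 3 for orthogonal ones; on the rest the component
  acts trivially. Premise \<open>restr\<close> is where determinants of restrictions matter.\<close>

lemma internal_direct_product_isometries_on:
  assumes \<W>: "\<W> \<subseteq> weight_spaces F"
    and sub: "\<And>W. W \<in> \<W> \<Longrightarrow> isometries_on W \<subseteq> identity_component (centralizer G F)"
    and triv: "\<And>g W w. g \<in> identity_component (centralizer G F) \<Longrightarrow> W \<in> weight_spaces F - \<W> \<Longrightarrow> w \<in> W \<Longrightarrow> g *v w = w"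
    and restr: "\<And>g W. g \<in> identity_component (centralizer G F) \<Longrightarrow> W \<in> \<W> \<Longrightarrow> restrict_to W g \<in> G"
  shows "internal_direct_product (identity_component (centralizer G F)) isometries_on \<W>"
  unfolding internal_direct_product_def
proof (intro conjI ballI impI)
  show "subgroup (isometries_on W) GL" for W by (rule subgroup_isometries_on)
  show "x ** y = y ** x" if W: "W \<in> \<W>" "W' \<in> \<W>" "W \<noteq> W'" and x: "x \<in> isometries_on W" and y: "y \<in> isometries_on W'"
    for W W' x y
  proof (rule matrix_eq_on_weight_spaces)
    fix U w assume U: "U \<in> weight_spaces F" and w: "w \<in> U"
    have WW: "W \<in> weight_spaces F" "W' \<in> weight_spaces F" using W \<W> by auto
    note ix = isometries_on_weight_space[OF WW(1) x U] and iy = isometries_on_weight_space[OF WW(2) y U]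
    show "(x ** y) *v w = (y ** x) *v w"
    proof (cases "U = W")
      case True
      then have "U \<noteq> W'" using W by blast
      then show ?thesis using iy(2)[OF w] iy(2)[OF ix(1)[OF w]] by (simp flip: matrix_vector_mul_assoc)
    next
      case False
      then show ?thesis using ix(2)[OF w] ix(2)[OF iy(1)[OF w]] by (simp flip: matrix_vector_mul_assoc)
    qed
  qed
  show "isometries_on W \<inter> generate GL (\<Union>W'\<in>\<W> - {W}. isometries_on W') = {mat 1}" if W: "W \<in> \<W>" for W
  proof
    show "isometries_on W \<inter> generate GL (\<Union>W'\<in>\<W> - {W}. isometries_on W') \<subseteq> {mat 1}"
    proof
      fix g assume g: "g \<in> isometries_on W \<inter> generate GL (\<Union>W'\<in>\<W> - {W}. isometries_on W')"
      have WW: "W \<in> weight_spaces F" using W \<W> by blast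
      have "g = mat 1"
      proof (rule matrix_eq_on_weight_spaces)
        fix U w assume U: "U \<in> weight_spaces F" and w: "w \<in> U"
        show "g *v w = mat 1 *v w"
        proof (cases "U = W")
          case True
          have "g *v w = w"
          proof (rule generate_fixes)
            show "g \<in> generate GL (\<Union>W'\<in>\<W> - {W}. isometries_on W')" using g by blast
            show "(\<Union>W'\<in>\<W> - {W}. isometries_on W') \<subseteq> G" by (auto simp: isometries_on_iff)
            fix s assume "s \<in> (\<Union>W'\<in>\<W> - {W}. isometries_on W')"
            then obtain W' where W': "W' \<in> \<W>" "W' \<noteq> W" "s \<in> isometries_on W'" by blast
            then have "W' \<in> weight_spaces F" using \<W> by blast
            then show "s *v w = w"
              using isometries_on_weight_space(2)[OF _ W'(3) WW, of w] w True W'(2) by auto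
          qed
          then show ?thesis by simp
        next
          case False
          then show ?thesis using isometries_on_weight_space(2)[OF WW _ U w, of g] g by simp
        qed
      qed
      then show "g \<in> {mat 1}" by simp
    qed
    have "mat 1 \<in> generate GL (\<Union>W'\<in>\<W> - {W}. isometries_on W')"
      using generate.one[of GL] by (simp add: GL_def)
    then show "{mat 1} \<subseteq> isometries_on W \<inter> generate GL (\<Union>W'\<in>\<W> - {W}. isometries_on W')"
      using subgroup_GL_one[OF subgroup_isometries_on] by blast
  qed
  show "identity_component (centralizer G F) = generate GL (\<Union>W\<in>\<W>. isometries_on W)"
  proof
    show "identity_component (centralizer G F) \<subseteq> generate GL (\<Union>W\<in>\<W>. isometries_on W)"
    proof
      fix g assume g: "g \<in> identity_component (centralizer G F)"
      show "g \<in> generate GL (\<Union>W\<in>\<W>. isometries_on W)"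
      proof (rule in_generate_isometries_on)
        show "finite \<W>" using \<W> finite_weight_spaces finite_subset by blast
        show "g \<in> centralizer G F" using g identity_component_subset by blast
      qed (use \<W> triv[OF g] restr[OF g] in auto)
    qed
    show "generate GL (\<Union>W\<in>\<W>. isometries_on W) \<subseteq> identity_component (centralizer G F)"
      by (rule group.generate_subgroup_incl[OF group_GL])
        (use sub subgroup_identity_component[OF subgroup_centralizer[OF subgroup_G]] in auto)
  qed
qed

end

section \<open>Symplectic groups\<close>

context symplectic_space
begin

sublocale nondegenerate_space b "\<lambda>_. 0" "-1" "\<lambda>_ _. True" "Sp b"
  by unfold_locales (rule nondegenerate)

lemma transvection_mult: "siegel b u 0 a *v v = v + (a * b v u) *s u"
  by (simp add: siegel_mult bilin)

lemma transvection_maps: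
  assumes "b x y \<noteq> 0"
  shows "siegel b (y - x) 0 (inverse (b x y)) *v x = y"
  using assms by (simp add: transvection_mult bilin alternating)

lemma transvection_in_isometries_on:
  assumes "u \<in> W"
  shows "siegel b u 0 a \<in> isometries_on W"
proof -
  have "siegel b u 0 a \<in> Sp b" by (rule siegel_in) (simp_all add: bilin)
  then show ?thesis using assms by (auto simp: isometries_on_iff perp_def transvection_mult)
qed

text \<open>Splits off the hyperbolic pair \<open>x\<close>, \<open>y\<close>. The last claim holds
  because \<open>perp W'\<close> is spanned by \<open>perp W\<close>, \<open>x\<close> and
  \<open>y\<close>.\<close>

lemma symplectic_complement:
  assumes W: "splits W" and x: "x \<in> W" "y \<in> W" "b x y = 1"
  defines "W' \<equiv> {w\<in>W. b w x = 0 \<and> b w y = 0}"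
  shows "splits W'" "W' \<subseteq> W" "vec.dim W = vec.dim W' + 2"
    "\<And>g. (\<And>v. v \<in> perp W \<Longrightarrow> g *v v = v) \<Longrightarrow> g *v x = x \<Longrightarrow> g *v y = y \<Longrightarrow> (\<And>v. v \<in> perp W' \<Longrightarrow> g *v v = v)"
proof -
  note Ws = splitsD(1)[OF W]
  have yx: "b y x = -1" using skew[of y x] x(3) by simp
  define pr where "pr w = w - b w y *s x + b w x *s y" for w
  have pr: "pr w \<in> W'" if "w \<in> W" for w
    using that x yx vec.subspace_add[OF Ws vec.subspace_diff[OF Ws that vec.subspace_scale[OF Ws x(1)]]
        vec.subspace_scale[OF Ws x(2)], of "b w y" "b w x"]
    by (simp add: W'_def pr_def bilin alternating)
  have dec: "w = pr w + b w y *s x - b w x *s y" for w by (simp add: pr_def)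
  have W's: "vec.subspace W'" using Ws by (auto simp: W'_def vec.subspace_def bilin)
  show W'W: "W' \<subseteq> W" by (auto simp: W'_def)
  have key: "\<exists>w'\<in>W'. \<exists>c d. \<exists>z\<in>perp W. v = w' + c *s x + d *s y + z" for v
  proof -
    obtain w where w: "w \<in> W" "v - w \<in> perp W" using splitsD(2)[OF W] by blast
    have "v = pr w + b w y *s x + (- b w x) *s y + (v - w)"
      by (simp add: pr_def)
    then show ?thesis using pr[OF w(1)] w(2) by blast
  qed
  have xyp: "x \<in> perp W'" "y \<in> perp W'"
    by (simp_all add: W'_def perp_def b_swap_zero[of x] b_swap_zero[of y])
  have WpW'p: "perp W \<subseteq> perp W'" by (rule perp_antimono[OF W'W])
  show sp: "splits W'"
    unfolding splits_def
  proof (intro conjI W's allI)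
    fix v
    obtain w' c d z where k: "w' \<in> W'" "z \<in> perp W" "v = w' + c *s x + d *s y + z" using key[of v] by blast
    have "v - w' = c *s x + d *s y + z" using k(3) by simp
    also have "\<dots> \<in> perp W'"
      using xyp k(2) WpW'p by (intro vec.subspace_add[OF subspace_perp] vec.subspace_scale[OF subspace_perp]) auto
    finally show "\<exists>w\<in>W'. v - w \<in> perp W'" using k(1) by blast
  qed
  show "g *v v = v" if g: "\<And>v. v \<in> perp W \<Longrightarrow> g *v v = v" "g *v x = x" "g *v y = y" and v: "v \<in> perp W'" for g v
  proof -
    obtain w' c d z where k: "w' \<in> W'" "z \<in> perp W" "v = w' + c *s x + d *s y + z" using key[of v] by blast
    have "w' = v - (c *s x + d *s y + z)" using k(3) by simp
    also have "\<dots> \<in> perp W'"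
      using xyp k(2) WpW'p v
      by (intro vec.subspace_diff[OF subspace_perp v] vec.subspace_add[OF subspace_perp] vec.subspace_scale[OF subspace_perp]) auto
    finally have "b w' u = 0" if "u \<in> W'" for u using that by (simp add: perp_def)
    then have "w' = 0" using splits_nondegenerate[OF sp k(1)] by blast
    then show ?thesis using k(3) g k(2)
      by (simp add: matrix_vector_right_distrib vector_scalar_commute)
  qed
  have "y \<notin> vec.span W'"
  proof
    assume "y \<in> vec.span W'"
    then have "y \<in> W'" using vec.span_eq_iff[THEN iffD2, OF W's] by blast
    then show False using yx by (simp add: W'_def)
  qed
  moreover have "x \<notin> vec.span (insert y W')"
  proof
    assume "x \<in> vec.span (insert y W')"
    then obtain k where "x - k *s y \<in> W'"
      using vec.span_breakdown_eq vec.span_eq_iff[THEN iffD2, OF W's] by metis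
    then show False using x(3) by (simp add: W'_def bilin alternating)
  qed
  ultimately have "vec.dim (insert x (insert y W')) = vec.dim W' + 2"
    by (simp add: vec.dim_insert)
  moreover have "vec.span (insert x (insert y W')) = W"
  proof
    show "vec.span (insert x (insert y W')) \<subseteq> W"
      using x W'W by (intro vec.span_minimal Ws) auto
    show "W \<subseteq> vec.span (insert x (insert y W'))"
    proof
      fix w assume "w \<in> W"
      then have "pr w \<in> insert x (insert y W')" using pr by blast
      then have "pr w + b w y *s x - b w x *s y \<in> vec.span (insert x (insert y W'))"
        by (intro vec.span_diff vec.span_add vec.span_scale) (auto intro: vec.span_base)
      then show "w \<in> vec.span (insert x (insert y W'))" using dec[of w] by simp
    qed
  qed
  ultimately show "vec.dim W = vec.dim W' + 2" using vec.dim_span by metis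
qed

lemma hyperbolic_pair_exists:
  assumes W: "splits W" and "x \<in> W" "x \<noteq> 0"
  obtains y where "y \<in> W" "b x y = 1"
proof -
  obtain z where z: "z \<in> W" "b x z \<noteq> 0" using splits_nondegenerate[OF W] assms by blast
  have "inverse (b x z) *s z \<in> W" "b x (inverse (b x z) *s z) = 1"
    using z vec.subspace_scale[OF splitsD(1)[OF W]] by (auto simp: bilin)
  then show ?thesis using that by blast
qed

lemma even_dim_splits:
  assumes "splits W" shows "even (vec.dim W)"
  using assms
proof (induction "vec.dim W" arbitrary: W rule: less_induct)
  case less
  show ?case
  proof (cases "W = {0}")
    case False
    then obtain x where x: "x \<in> W" "x \<noteq> 0" using vec.subspace_0[OF splitsD(1)[OF less.prems]] by blast
    then obtain y where y: "y \<in> W" "b x y = 1" using hyperbolic_pair_exists[OF less.prems] by blast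
    note c = symplectic_complement[OF less.prems x(1) y]
    show ?thesis using less.hyps[OF _ c(1)] c(3) by simp
  qed simp
qed

text \<open>One or two transvections carry \<open>g *v x\<close> back to \<open>x\<close>, one or
  two more carry the image of \<open>y\<close> back to \<open>y\<close> while fixing
  \<open>x\<close>, and what remains acts on the complement of the pair.\<close>

lemma transvections_generate:
  assumes K: "subgroup K GL" "K \<subseteq> Sp b"
    and "splits W" "\<And>u a. u \<in> W \<Longrightarrow> siegel b u 0 a \<in> K" "g \<in> isometries_on W"
  shows "g \<in> K"
  using assms(3-)
proof (induction "vec.dim W" arbitrary: W g rule: less_induct)
  case less
  note W = less.prems(1) and T = less.prems(2) and g = less.prems(3)
  note Ws = splitsD(1)[OF W]
  show ?case
  proof (cases "W = {0}")
    case True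
    then have "g *v v = v" for v using g by (simp add: isometries_on_iff perp_def bilin)
    then have "g = mat 1" unfolding matrix_eq by simp
    then show ?thesis using subgroup_GL_one[OF K(1)] by simp
  next
    case False
    then obtain x where x: "x \<in> W" "x \<noteq> 0" using vec.subspace_0[OF Ws] by blast
    then obtain y where y: "y \<in> W" "b x y = 1" using hyperbolic_pair_exists[OF W] by blast
    have gG: "g \<in> Sp b" and gfix: "\<And>v. v \<in> perp W \<Longrightarrow> g *v v = v" using g by (auto simp: isometries_on_iff)
    have move: "\<exists>k\<in>K. k \<in> isometries_on W \<and> k *v u = v \<and> (\<forall>w. b w (v - u) = 0 \<longrightarrow> k *v w = w)"
      if "u \<in> W" "v \<in> W" "b u v \<noteq> 0" for u v
    proof (rule bexI[of _ "siegel b (v - u) 0 (inverse (b u v))"])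
      have vu: "v - u \<in> W" using that vec.subspace_diff[OF Ws] by blast
      show "siegel b (v - u) 0 (inverse (b u v)) \<in> K" using T[OF vu] .
      show "siegel b (v - u) 0 (inverse (b u v)) \<in> isometries_on W \<and>
          siegel b (v - u) 0 (inverse (b u v)) *v u = v \<and>
          (\<forall>w. b w (v - u) = 0 \<longrightarrow> siegel b (v - u) 0 (inverse (b u v)) *v w = w)"
        using transvection_in_isometries_on[OF vu] transvection_maps[OF that(3)] by (simp add: transvection_mult)
    qed
    have on_mult: "A ** B \<in> isometries_on W" if "A \<in> isometries_on W" "B \<in> isometries_on W" for A B
      using subgroup_GL_mult[OF subgroup_isometries_on that] .
    note K_mult = subgroup_GL_mult[OF K(1)]
    have gx: "g *v x \<in> W" using isometries_on_maps[OF W gG gfix x(1)] .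
    have gx0: "g *v x \<noteq> 0"
      using stable_cancel[OF subgroup_Sp, of "{0}" g x] gG x(2) by (auto simp: stable_def)
    have "\<exists>k\<in>K. k \<in> isometries_on W \<and> k *v (g *v x) = x"
    proof (cases "b (g *v x) x = 0")
      case False
      then show ?thesis using move[OF gx x(1)] by blast
    next
      case True
      obtain z1 where z1: "z1 \<in> W" "b (g *v x) z1 \<noteq> 0" using splits_nondegenerate[OF W gx] gx0 by blast
      obtain z2 where z2: "z2 \<in> W" "b x z2 \<noteq> 0" using splits_nondegenerate[OF W x(1)] x(2) by blast
      \<comment> \<open>Two proper hyperplanes do not cover \<open>W\<close>: if neither
        \<open>z1\<close> nor \<open>z2\<close> avoids both, their sum does.\<close>
      have "\<exists>z\<in>W. b (g *v x) z \<noteq> 0 \<and> b x z \<noteq> 0"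
      proof (cases "b x z1 = 0 \<and> b (g *v x) z2 = 0")
        case True
        then show ?thesis using z1 z2 vec.subspace_add[OF Ws z1(1) z2(1)]
          by (intro bexI[of _ "z1 + z2"]) (simp_all add: bilin)
      qed (use z1 z2 in blast)
      then obtain z where z: "z \<in> W" "b (g *v x) z \<noteq> 0" "b z x \<noteq> 0" using b_swap_zero by blast
      obtain k1 where k1: "k1 \<in> K" "k1 \<in> isometries_on W" "k1 *v (g *v x) = z"
        using move[OF gx z(1,2)] by blast
      obtain k2 where k2: "k2 \<in> K" "k2 \<in> isometries_on W" "k2 *v z = x"
        using move[OF z(1) x(1) z(3)] by blast
      have "(k2 ** k1) *v (g *v x) = x" using k1 k2 by (simp flip: matrix_vector_mul_assoc)
      then show ?thesis using K_mult[OF k2(1) k1(1)] on_mult[OF k2(2) k1(2)] by blast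
    qed
    then obtain k where k: "k \<in> K" "k \<in> isometries_on W" "k *v (g *v x) = x" by blast
    define y' where "y' = k *v (g *v y)"
    have kg: "k ** g \<in> isometries_on W" using on_mult[OF k(2) g] .
    then have kg': "k ** g \<in> Sp b" "\<And>v. v \<in> perp W \<Longrightarrow> (k ** g) *v v = v" by (auto simp: isometries_on_iff)
    have y': "y' \<in> W" "b x y' = 1"
    proof -
      show "y' \<in> W"
        using isometries_on_maps[OF W kg' y(1)] by (simp add: y'_def matrix_vector_mul_assoc)
      have "b ((k ** g) *v x) ((k ** g) *v y) = b x y" using isometry(1)[OF kg'(1)] .
      then show "b x y' = 1" using k(3) y(2) by (simp add: y'_def flip: matrix_vector_mul_assoc)
    qed
    have "\<exists>l\<in>K. l \<in> isometries_on W \<and> l *v x = x \<and> l *v y' = y"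
    proof (cases "b y' y = 0")
      case False
      moreover have "b x (y - y') = 0" using y(2) y'(2) by (simp add: bilin)
      ultimately show ?thesis using move[OF y'(1) y(1)] by blast
    next
      case True
      \<comment> \<open>The detour through \<open>y' + x\<close> keeps \<open>x\<close> fixed: the
        two displacement vectors \<open>x\<close> and \<open>y - y' - x\<close> are orthogonal to
        \<open>x\<close>.\<close>
      let ?z = "y' + x"
      have z: "?z \<in> W" using vec.subspace_add[OF Ws y'(1) x(1)] .
      have "b y' ?z \<noteq> 0" using y'(2) skew[of y' x] by (simp add: bilin alternating)
      then obtain l1 where l1: "l1 \<in> K" "l1 \<in> isometries_on W" "l1 *v y' = ?z" "\<forall>w. b w (?z - y') = 0 \<longrightarrow> l1 *v w = w"
        using move[OF y'(1) z] by blast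
      have "b ?z y \<noteq> 0" using True y(2) by (simp add: bilin)
      then obtain l2 where l2: "l2 \<in> K" "l2 \<in> isometries_on W" "l2 *v ?z = y" "\<forall>w. b w (y - ?z) = 0 \<longrightarrow> l2 *v w = w"
        using move[OF z y(1)] by blast
      have "l1 *v x = x" using l1(4) by (simp add: alternating)
      moreover have "l2 *v x = x" using l2(4) y(2) y'(2) by (simp add: bilin alternating)
      ultimately have "(l2 ** l1) *v x = x" "(l2 ** l1) *v y' = y"
        using l1(3) l2(3) by (simp_all flip: matrix_vector_mul_assoc)
      then show ?thesis using K_mult[OF l2(1) l1(1)] on_mult[OF l2(2) l1(2)] by blast
    qed
    then obtain l where l: "l \<in> K" "l \<in> isometries_on W" "l *v x = x" "l *v y' = y" by blast
    let ?h = "l ** (k ** g)"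
    have h: "?h \<in> isometries_on W" using on_mult[OF l(2) kg] .
    then have h': "?h \<in> Sp b" "\<And>v. v \<in> perp W \<Longrightarrow> ?h *v v = v" by (auto simp: isometries_on_iff)
    have hx: "?h *v x = x" "?h *v y = y"
      using l k(3) by (simp_all add: y'_def flip: matrix_vector_mul_assoc)
    note c = symplectic_complement[OF W x(1) y]
    have hK: "?h \<in> K"
    proof (rule less.hyps[OF _ c(1)])
      show "vec.dim {w \<in> W. b w x = 0 \<and> b w y = 0} < vec.dim W" using c(3) by simp
      show "siegel b u 0 a \<in> K" if "u \<in> {w \<in> W. b w x = 0 \<and> b w y = 0}" for u a using T that by simp
      show "?h \<in> isometries_on {w \<in> W. b w x = 0 \<and> b w y = 0}"
        using c(4)[OF h'(2) hx] h'(1) by (simp add: isometries_on_iff)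
    qed
    obtain m where m: "m \<in> K" "m ** (l ** k) = mat 1"
      using subgroup_GL_inverse[OF K(1) K_mult[OF l(1) k(1)]] by blast
    have "m ** ?h = (m ** (l ** k)) ** g" by (simp add: matrix_mul_assoc)
    then have "g = m ** ?h" using m(2) by simp
    then show ?thesis using K_mult[OF m(1) hK] by simp
  qed
qed

section \<open>The centralizer in a symplectic group\<close>

theorem centralizer_structure:
  assumes F: "subgroup F GL" "F \<subseteq> Sp b" "finite F"
    and irr: "irreducible_in (Sp b) (identity_component (centralizer (Sp b) F))"
    and char2: "CHAR('a) = 2 \<Longrightarrow> F \<noteq> {mat 1}"
  shows "CHAR('a) \<noteq> 2 \<and> elementary_abelian_2 F \<and>
    internal_direct_product (identity_component (centralizer (Sp b) F)) (Sp_on b) (weight_spaces F) \<and>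
    (\<forall>W\<in>weight_spaces F. nondegenerate_on b W \<and> even (vec.dim W)) \<and>
    2 * (\<Sum>W\<in>weight_spaces F. vec.dim W div 2) = CARD('n)"
proof -
  have inv: "f ** f = mat 1" if "f \<in> F" for f using involution[OF F(1,2) irr that] by simp
  have char: "CHAR('a) \<noteq> 2"
  proof
    assume "CHAR('a) = 2"
    then have two: "(2::'a) = 0" and "F \<noteq> {mat 1}" using char_two char2 by blast+
    then obtain f where f: "f \<in> F" "f \<noteq> mat 1" using subgroup_GL_one[OF F(1)] by blast
    \<comment> \<open>In characteristic 2 the argument applies to \<open>f\<close> itself rather
      than to its square, since an eigenvalue with square 1 is already 1.\<close>
    have "f = mat 1"
    proof (rule fixed_image_trivial[OF F(1,2) irr f(1)])
      fix c v assume "v \<noteq> 0" "f *v v = c *s v"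
      then have "c\<^sup>2 = 1" by (rule eigenvalue_square_one[OF F(1,2) irr f(1)])
      then have "(c - 1)\<^sup>2 = 2 - 2 * c" by (simp add: power2_diff)
      then show "c = 1" using two by simp
    qed simp
    then show False using f(2) by blast
  qed
  have two: "(2::'a) \<noteq> 0" by (rule char_not_two[OF char])
  interpret involution_group b "\<lambda>_. 0" "-1" "\<lambda>_ _. True" "Sp b" F
    by (intro involution_group.intro involution_group_axioms.intro nondegenerate_space_axioms two F inv)
  have on: "isometries_on = Sp_on b" by (simp add: fun_eq_iff isometries_on_def Sp_on_def)
  let ?C = "identity_component (centralizer (Sp b) F)"
  have "internal_direct_product ?C isometries_on (weight_spaces F)"
  proof (rule internal_direct_product_isometries_on)
    show "isometries_on W \<subseteq> ?C" if W: "W \<in> weight_spaces F" for W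
    proof
      fix g assume g: "g \<in> isometries_on W"
      show "g \<in> ?C"
      proof (rule transvections_generate[OF _ _ weight_splits[OF W] _ g])
        show "subgroup ?C GL" by (rule subgroup_identity_component[OF subgroup_centralizer[OF subgroup_Sp]])
        show "?C \<subseteq> Sp b" by (rule centralizer_component(1))
        fix u a assume u: "u \<in> W"
        show "siegel b u 0 a \<in> ?C"
        proof (rule siegel_curve_in_identity_component)
          show "siegel b u (t *s 0) (t\<^sup>2 * a) \<in> centralizer (Sp b) F" for t
            using transvection_in_isometries_on[OF u, of "t\<^sup>2 * a"] isometries_on_centralize[OF W] by auto
        qed (simp_all add: bilin)
      qed
    qed
    fix g W assume g: "g \<in> ?C" and W: "W \<in> weight_spaces F"
    have gC: "g \<in> centralizer (Sp b) F" using g identity_component_subset by blast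
    then have gSp: "g \<in> Sp b" by (simp add: centralizer_def)
    have "b (restrict_to W g *v x) (restrict_to W g *v y) = b x y" for x y
      by (rule restrict_to_isometry(1)[OF weight_splits[OF W] gSp])
        (rule stableD[OF stable_weight_space[OF W] gC])
    then show "restrict_to W g \<in> Sp b" by (simp add: Sp_iff)
  qed auto
  moreover have nd: "nondegenerate_on b W \<and> even (vec.dim W)" if W: "W \<in> weight_spaces F" for W
    using weight_nondegenerate[OF W] even_dim_splits[OF weight_splits[OF W]] by (auto simp: nondegenerate_on_def)
  moreover have "2 * (\<Sum>W\<in>weight_spaces F. vec.dim W div 2) = CARD('n)"
  proof -
    have "2 * (\<Sum>W\<in>weight_spaces F. vec.dim W div 2) = (\<Sum>W\<in>weight_spaces F. vec.dim W)"
      unfolding sum_distrib_left using nd by (intro sum.cong) auto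
    then show ?thesis using sum_dim_weight_spaces by simp
  qed
  ultimately show ?thesis using char elementary_abelian on by simp
qed

end

section \<open>Orthogonal groups\<close>

lemma poly_quadratic: "poly [: a, b, c :] (t :: 'a::comm_ring_1) = a + t\<^sup>2 * c + t * b"
  by (simp add: power2_eq_square algebra_simps)

context quadratic_space
begin

definition reflection :: "'a ^ 'n \<Rightarrow> 'a ^ 'n ^ 'n" where
  "reflection u = mat 1 + rank_one ((- inverse (Q u)) *s u) (\<lambda>v. b v u)"

lemma reflection_mult: "reflection u *v v = v - (b v u / Q u) *s u"
  by (simp add: reflection_def matrix_vector_mult_add_rdistrib rank_one_mult[OF linear_left] divide_inverse)

lemma reflection_isometry:
  assumes "Q u \<noteq> 0" shows "Q (reflection u *v v) = Q v"
  using assms by (simp add: reflection_mult Q_diff Q_scale bilin power2_eq_square)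

lemma reflection_in_GO: "Q u \<noteq> 0 \<Longrightarrow> reflection u \<in> GO Q"
  by (simp add: GO_iff reflection_isometry)

lemma reflection_square:
  assumes "Q u \<noteq> 0" shows "reflection u ** reflection u = mat 1"
proof -
  have "reflection u *v (reflection u *v v) = v" for v
  proof -
    have "b (reflection u *v v) u = - b v u"
      using assms by (simp add: reflection_mult bilin polar_self)
    then have "reflection u *v (reflection u *v v) = reflection u *v v + (b v u / Q u) *s u"
      unfolding reflection_mult[of u "reflection u *v v"] by simp
    then show ?thesis by (simp add: reflection_mult)
  qed
  then show ?thesis unfolding matrix_eq by (simp flip: matrix_vector_mul_assoc)
qed

lemma reflection_maps:
  assumes "Q x = Q y" "Q (x - y) \<noteq> 0" shows "reflection (x - y) *v x = y"
proof -
  have "b x (x - y) = Q (x - y)" using assms(1) by (simp add: Q_diff bilin polar_self)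
  then show ?thesis using assms(2) by (simp add: reflection_mult)
qed

lemma det_reflection:
  assumes "Q u \<noteq> 0" shows "det (reflection u) = -1"
  unfolding reflection_def
  using assms by (subst det_rank_one[OF linear_left]) (simp add: bilin polar_self field_simps)

lemma reflection_fixes: "u \<in> W \<Longrightarrow> v \<in> perp W \<Longrightarrow> reflection u *v v = v"
  by (simp add: perp_def reflection_mult)

text \<open>Counterpart of the symplectic splitting with one nonsingular vector. A vector of
  \<open>perp W'\<close> is in the span of \<open>perp W\<close> and \<open>u\<close> up to a vector
  of \<open>W'\<close> orthogonal to \<open>W'\<close>, which the inner premise of the last claim
  makes zero.\<close>

lemma orthogonal_complement:
  assumes W: "splits W" and u: "u \<in> W" "Q u \<noteq> 0" and two: "(2::'a) \<noteq> 0"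
  defines "W' \<equiv> {w\<in>W. b w u = 0}"
  shows "splits W'" "W' \<subset> W"
    "\<And>g. (\<And>v. v \<in> perp W \<Longrightarrow> g *v v = v) \<Longrightarrow> g *v u = u \<Longrightarrow>
      (\<And>x. x \<in> W' \<Longrightarrow> (\<And>y. y \<in> W' \<Longrightarrow> b x y = 0) \<Longrightarrow> x = 0) \<Longrightarrow> (\<And>v. v \<in> perp W' \<Longrightarrow> g *v v = v)"
proof -
  note Ws = splitsD(1)[OF W]
  have uu: "b u u \<noteq> 0" using u(2) two by (simp add: polar_self)
  define pr where "pr w = w - (b w u / b u u) *s u" for w
  have pr: "pr w \<in> W'" if "w \<in> W" for w
    using that uu vec.subspace_diff[OF Ws that vec.subspace_scale[OF Ws u(1)], of "b w u / b u u"]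
    by (simp add: W'_def pr_def bilin)
  have W's: "vec.subspace W'" using Ws by (auto simp: W'_def vec.subspace_def bilin)
  have W'W: "W' \<subseteq> W" by (auto simp: W'_def)
  then show "W' \<subset> W" using u(1) uu by (auto simp: W'_def)
  have key: "\<exists>w'\<in>W'. \<exists>c. \<exists>z\<in>perp W. v = w' + c *s u + z" for v
  proof -
    obtain w where w: "w \<in> W" "v - w \<in> perp W" using splitsD(2)[OF W] by blast
    have "v = pr w + (b w u / b u u) *s u + (v - w)" by (simp add: pr_def)
    then show ?thesis using pr[OF w(1)] w(2) by blast
  qed
  have up: "u \<in> perp W'" using polar_commute[of u] by (simp add: W'_def perp_def)
  have WpW'p: "perp W \<subseteq> perp W'" by (rule perp_antimono[OF W'W])
  show sp: "splits W'"
    unfolding splits_def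
  proof (intro conjI W's allI)
    fix v
    obtain w' c z where k: "w' \<in> W'" "z \<in> perp W" "v = w' + c *s u + z" using key[of v] by blast
    have "v - w' = c *s u + z" using k(3) by simp
    also have "\<dots> \<in> perp W'"
      using up k(2) WpW'p by (intro vec.subspace_add[OF subspace_perp] vec.subspace_scale[OF subspace_perp]) auto
    finally show "\<exists>w\<in>W'. v - w \<in> perp W'" using k(1) by blast
  qed
  show "g *v v = v" if g: "\<And>v. v \<in> perp W \<Longrightarrow> g *v v = v" "g *v u = u"
    and nd: "\<And>x. x \<in> W' \<Longrightarrow> (\<And>y. y \<in> W' \<Longrightarrow> b x y = 0) \<Longrightarrow> x = 0" and v: "v \<in> perp W'" for g v
  proof -
    obtain w' c z where k: "w' \<in> W'" "z \<in> perp W" "v = w' + c *s u + z" using key[of v] by blast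
    have "w' = v - (c *s u + z)" using k(3) by simp
    also have "\<dots> \<in> perp W'"
      using up k(2) WpW'p v
      by (intro vec.subspace_diff[OF subspace_perp v] vec.subspace_add[OF subspace_perp] vec.subspace_scale[OF subspace_perp]) auto
    finally have "w' = 0" using nd[OF k(1)] by (simp add: perp_def)
    then show ?thesis using k(3) g k(2) by (simp add: matrix_vector_right_distrib vector_scalar_commute)
  qed
qed

end

section \<open>Generation by reflections when 2 is invertible\<close>

locale quadratic_space_odd = quadratic_space Q for Q :: "'a::alg_closed_field ^ 'n \<Rightarrow> 'a" +
  assumes two: "(2::'a) \<noteq> 0"
begin

sublocale nondegenerate_space b Q 1 "\<lambda>x a. a = - Q x" "SO Q"
proof unfold_locales
  fix x assume "\<And>y. b x y = 0"
  then show "x = 0" using radical_zero[of x] polar_self[of x] two by auto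
qed

lemma isotropic_singular: "b x x = 0 \<Longrightarrow> Q x = 0"
  using polar_self[of x] two by simp

text \<open>Polarization: if \<open>Q\<close> vanished on \<open>W\<close>, so would
  \<open>b\<close>.\<close>

lemma nonsingular_exists:
  assumes W: "splits W" "W \<noteq> {0}" obtains u where "u \<in> W" "Q u \<noteq> 0"
proof -
  obtain x where x: "x \<in> W" "x \<noteq> 0" using W vec.subspace_0[OF splitsD(1)[OF W(1)]] by blast
  then obtain y where y: "y \<in> W" "b x y \<noteq> 0" using splits_nondegenerate[OF W(1)] by blast
  then have "Q (x + y) - Q x - Q y \<noteq> 0" by (simp add: Q_add)
  then have "Q (x + y) \<noteq> 0 \<or> Q x \<noteq> 0 \<or> Q y \<noteq> 0" by auto
  then show ?thesis
    using that x(1) y(1) vec.subspace_add[OF splitsD(1)[OF W(1)] x(1) y(1)] by blast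
qed

text \<open>A weak form of the Cartan--Dieudonne theorem.\<close>

lemma reflections_generate:
  assumes K: "subgroup K GL"
    and "splits W" "\<And>u v. u \<in> W \<Longrightarrow> v \<in> W \<Longrightarrow> Q u \<noteq> 0 \<Longrightarrow> Q v \<noteq> 0 \<Longrightarrow> reflection u ** reflection v \<in> K"
    and "g \<in> GO Q" "\<And>v. v \<in> perp W \<Longrightarrow> g *v v = v"
  shows "g \<in> K \<or> (\<exists>u\<in>W. Q u \<noteq> 0 \<and> reflection u ** g \<in> K)"
  using assms(2-)
proof (induction "vec.dim W" arbitrary: W g rule: less_induct)
  case less
  note W = less.prems(1) and T = less.prems(2) and g = less.prems(3,4)
  note Ws = splitsD(1)[OF W] and K_mult = subgroup_GL_mult[OF K]
  show ?case
  proof (cases "W = {0}")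
    case True
    then have "g *v v = v" for v using g(2) by (simp add: perp_def bilin)
    then have "g = mat 1" unfolding matrix_eq by simp
    then show ?thesis using subgroup_GL_one[OF K] by simp
  next
    case False
    then obtain u where u: "u \<in> W" "Q u \<noteq> 0" using nonsingular_exists[OF W] by blast
    have gQ: "Q (g *v x) = Q x" for x using g(1) by (simp add: GO_iff)
    have gu: "g *v u \<in> W"
    proof (rule splits_perp_perp[OF W])
      have "b (g *v u) z = 0" if "z \<in> perp W" for z
        using polar_isometry[OF gQ, of u z] g(2)[OF that] that u(1) polar_commute[of u z] by (simp add: perp_def)
      then show "g *v u \<in> perp (perp W)" by (simp add: perp_def[of "perp W"])
    qed
    let ?W' = "{w\<in>W. b w u = 0}"
    note c = orthogonal_complement[OF W u two]
    have dim: "vec.dim ?W' < vec.dim W"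
    proof (rule vec.dim_psubset)
      show "vec.span ?W' \<subset> vec.span W"
        unfolding vec.span_eq_iff[THEN iffD2, OF Ws] vec.span_eq_iff[THEN iffD2, OF splitsD(1)[OF c(1)]]
        by (rule c(2))
    qed
    have IH: "h \<in> K \<or> (\<exists>v\<in>W. Q v \<noteq> 0 \<and> reflection v ** h \<in> K)"
      if h: "h \<in> GO Q" "\<And>v. v \<in> perp W \<Longrightarrow> h *v v = v" "h *v u = u" for h
    proof -
      have "h \<in> K \<or> (\<exists>v\<in>?W'. Q v \<noteq> 0 \<and> reflection v ** h \<in> K)"
      proof (rule less.hyps[OF dim c(1)])
        show "reflection u ** reflection v \<in> K" if "u \<in> ?W'" "v \<in> ?W'" "Q u \<noteq> 0" "Q v \<noteq> 0" for u v
          using T that by blast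
        show "h *v v = v" if "v \<in> perp ?W'" for v
          using c(3)[OF h(2,3) splits_nondegenerate[OF c(1)] that] by blast
      qed (rule h(1))
      then show ?thesis by blast
    qed
    have refl_GO: "reflection v ** h \<in> GO Q" if "Q v \<noteq> 0" "h \<in> GO Q" for v h
      using that reflection_in_GO subgroup_GL_mult[OF subgroup_GO] by blast
    have cancel: "reflection v ** (reflection v ** h) = h" if "Q v \<noteq> 0" for v h
      using reflection_square[OF that] by (simp add: matrix_mul_assoc)
    \<comment> \<open>Parallelogram identity: one of the two differences is nonsingular because
      \<open>4 * Q u\<close> is nonzero, so \<open>g *v u\<close> can be reflected to
      \<open>u\<close> or to \<open>- u\<close>.\<close>
    have "Q (g *v u - u) + Q (g *v u + u) = 4 * Q u"
      by (simp add: Q_diff Q_add gQ)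
    moreover have "(4::'a) \<noteq> 0" using two by (metis mult_2 mult_eq_0_iff numeral_Bit0)
    ultimately have "Q (g *v u - u) \<noteq> 0 \<or> Q (g *v u - (- u)) \<noteq> 0" using u(2) by auto
    then show ?thesis
    proof
      assume nz: "Q (g *v u - u) \<noteq> 0"
      let ?s = "g *v u - u"
      have s: "?s \<in> W" using gu u(1) vec.subspace_diff[OF Ws] by blast
      have "reflection ?s ** g \<in> K \<or> (\<exists>v\<in>W. Q v \<noteq> 0 \<and> reflection v ** (reflection ?s ** g) \<in> K)"
      proof (rule IH)
        show "reflection ?s ** g \<in> GO Q" using refl_GO nz g(1) by blast
        show "(reflection ?s ** g) *v v = v" if "v \<in> perp W" for v
          using reflection_fixes[OF s that] g(2)[OF that] by (simp flip: matrix_vector_mul_assoc)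
        show "(reflection ?s ** g) *v u = u"
          using reflection_maps[OF gQ nz] by (simp flip: matrix_vector_mul_assoc)
      qed
      then show ?thesis
      proof
        assume "\<exists>v\<in>W. Q v \<noteq> 0 \<and> reflection v ** (reflection ?s ** g) \<in> K"
        then obtain v where v: "v \<in> W" "Q v \<noteq> 0" "reflection v ** (reflection ?s ** g) \<in> K" by blast
        have "(reflection ?s ** reflection v) ** (reflection v ** (reflection ?s ** g)) \<in> K"
          by (rule K_mult[OF T[OF s v(1) nz v(2)] v(3)])
        then have "g \<in> K" by (simp only: cancel[OF v(2)] cancel[OF nz] matrix_mul_assoc[symmetric])
        then show ?thesis ..
      qed (use s nz in blast)
    next
      assume nz: "Q (g *v u - (- u)) \<noteq> 0"
      let ?s = "g *v u - (- u)"
      have s: "?s \<in> W" using gu u(1) vec.subspace_diff[OF Ws] vec.subspace_neg[OF Ws] by blast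
      \<comment> \<open>After the reflection to \<open>- u\<close>, a second one along
        \<open>u\<close> leads back to \<open>u\<close>; the disjunction in the conclusion keeps
        track of this parity.\<close>
      let ?h = "reflection u ** (reflection ?s ** g)"
      have "?h \<in> K \<or> (\<exists>v\<in>W. Q v \<noteq> 0 \<and> reflection v ** ?h \<in> K)"
      proof (rule IH)
        show "?h \<in> GO Q" using refl_GO nz u(2) g(1) by blast
        show "?h *v v = v" if "v \<in> perp W" for v
          using reflection_fixes[OF s that] reflection_fixes[OF u(1) that] g(2)[OF that]
          by (simp flip: matrix_vector_mul_assoc)
        have "reflection ?s *v (g *v u) = - u" using reflection_maps[OF _ nz] gQ Q_neg by simp
        moreover have "reflection u *v (- u) = u"
          using u(2) by (simp add: reflection_mult bilin polar_self vec_eq_iff)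
        ultimately show "?h *v u = u" by (simp flip: matrix_vector_mul_assoc)
      qed
      then show ?thesis
      proof
        assume h: "?h \<in> K"
        have "(reflection ?s ** reflection u) ** ?h \<in> K"
          by (rule K_mult[OF T[OF s u(1) nz u(2)] h])
        then have "g \<in> K" by (simp only: cancel[OF u(2)] cancel[OF nz] matrix_mul_assoc[symmetric])
        then show ?thesis ..
      next
        assume "\<exists>v\<in>W. Q v \<noteq> 0 \<and> reflection v ** ?h \<in> K"
        then obtain v where v: "v \<in> W" "Q v \<noteq> 0" "reflection v ** ?h \<in> K" by blast
        have "(reflection u ** reflection v) ** (reflection v ** ?h) \<in> K"
          by (rule K_mult[OF T[OF u(1) v(1) u(2) v(2)] v(3)])
        then have "reflection ?s ** g \<in> K"
          by (simp only: cancel[OF v(2)] cancel[OF u(2)] matrix_mul_assoc[symmetric])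
        then show ?thesis using s nz by blast
      qed
    qed
  qed
qed

text \<open>Generation with \<open>K = SL\<close>: pairs of reflections have determinant 1, so at
  most one reflection separates \<open>g\<close> from \<open>SL\<close>.\<close>

lemma det_GO:
  assumes g: "g \<in> GO Q" shows "det g = 1 \<or> det g = -1"
proof -
  have "g \<in> SL \<or> (\<exists>u\<in>UNIV. Q u \<noteq> 0 \<and> reflection u ** g \<in> SL)"
  proof (rule reflections_generate[OF subgroup_SL splits_UNIV])
    show "reflection u ** reflection v \<in> SL" if "Q u \<noteq> 0" "Q v \<noteq> 0" for u v
      using that by (simp add: SL_def det_mul det_reflection)
    fix v assume "v \<in> perp UNIV"
    then have "v = 0" using nondegenerate by (simp add: perp_def)
    then show "g *v v = v" by simp
  qed (rule g)
  then show ?thesis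
  proof
    assume "\<exists>u\<in>UNIV. Q u \<noteq> 0 \<and> reflection u ** g \<in> SL"
    then obtain u where "Q u \<noteq> 0" "det (reflection u) * det g = 1" by (auto simp: SL_def det_mul)
    then have "- det g = 1" by (simp add: det_reflection)
    then show ?thesis by (metis minus_minus)
  qed (simp add: SL_def)
qed

lemma SO_iff: "g \<in> SO Q \<longleftrightarrow> g \<in> GO Q \<and> det g = 1"
proof -
  have "CHAR('a) \<noteq> 2" using two char_two by blast
  then show ?thesis by (simp add: SO_def)
qed

text \<open>The first reflection vector moves along the line from \<open>v\<close> to
  \<open>u\<close>. At \<open>v\<close> the product is 1, and discarding the finitely many
  parameters where \<open>Q\<close> vanishes leaves an infinite set on which the entries are
  rational.\<close>

lemma reflection_pair_in_identity_component:
  assumes S: "\<And>u v. u \<in> W \<Longrightarrow> v \<in> W \<Longrightarrow> Q u \<noteq> 0 \<Longrightarrow> Q v \<noteq> 0 \<Longrightarrow> reflection u ** reflection v \<in> S"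
    and W: "vec.subspace W" and u: "u \<in> W" "Q u \<noteq> 0" and v: "v \<in> W" "Q v \<noteq> 0"
  shows "reflection u ** reflection v \<in> identity_component S"
proof -
  define d where "d = u - v"
  define x where "x t = v + t *s d" for t
  define T where "T = {t. Q (x t) \<noteq> 0}"
  define \<gamma> where "\<gamma> t = reflection (x t) ** reflection v" for t
  have xW: "x t \<in> W" for t
    unfolding x_def d_def using u v by (intro vec.subspace_add[OF W] vec.subspace_scale[OF W] vec.subspace_diff[OF W])
  have x01: "x 0 = v" "x 1 = u" by (simp_all add: x_def d_def)
  let ?p = "[: Q v, b v d, Q d :]"
  have Qx: "Q (x t) = poly ?p t" for t
  proof -
    have "Q (x t) = Q v + t\<^sup>2 * Q d + t * b v d"
      by (simp only: x_def Q_add Q_scale right.scale)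
    also have "\<dots> = poly ?p t"
      by (rule poly_quadratic[symmetric])
    finally show ?thesis .
  qed
  have "?p \<noteq> 0" using v(2) by simp
  then have "finite {t. poly ?p t = 0}" by (rule poly_roots_finite)
  moreover have "UNIV = T \<union> {t. poly ?p t = 0}" by (auto simp: T_def Qx)
  ultimately have "infinite T" using infinite_UNIV_alg_closed[where 'a = 'a] by (metis finite_Un)
  moreover have "rat_on T (\<lambda>t. \<gamma> t $ i $ j)" for i j
  proof -
    have rQ: "rat_on T (\<lambda>t. Q (x t))"
      unfolding rat_on_def Qx by (intro exI[of _ ?p] exI[of _ 1]) simp
    have lin: "b a (x t) = b a v + t * b a d" for a t by (simp only: x_def right.add right.scale)
    have entry: "\<gamma> t $ i $ j = (\<Sum>k\<in>UNIV. ((mat 1 :: 'a ^ 'n ^ 'n) $ i $ k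
        - (v $ i + t * d $ i) * (b (axis k 1) v + t * b (axis k 1) d) / Q (x t)) * reflection v $ k $ j)" for t
    proof -
      have xi: "x t $ i = v $ i + t * d $ i" by (simp add: x_def)
      have "reflection (x t) $ i $ k = (mat 1 :: 'a ^ 'n ^ 'n) $ i $ k - x t $ i * b (axis k 1) (x t) / Q (x t)" for k
        by (simp add: reflection_def rank_one_def divide_inverse)
      then have "reflection (x t) $ i $ k = (mat 1 :: 'a ^ 'n ^ 'n) $ i $ k
        - (v $ i + t * d $ i) * (b (axis k 1) v + t * b (axis k 1) d) / Q (x t)" for k
        unfolding lin xi .
      then show ?thesis by (simp add: \<gamma>_def matrix_matrix_mult_def)
    qed
    show ?thesis
      unfolding entry
      by (rule rat_on_sum, rule rat_on_mult, rule rat_on_diff, rule rat_on_const, rule rat_on_divide,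
          rule rat_on_mult, rule rat_on_add, rule rat_on_const, rule rat_on_mult, rule rat_on_id, rule rat_on_const,
          rule rat_on_add, rule rat_on_const, rule rat_on_mult, rule rat_on_id, rule rat_on_const, rule rQ)
        (simp add: T_def, rule rat_on_const)
  qed
  ultimately have "connectedin zariski (\<gamma> ` T)" by (rule connectedin_rational_curve)
  moreover have "\<gamma> ` T \<subseteq> S" using S xW v by (auto simp: \<gamma>_def T_def)
  moreover have "mat 1 \<in> \<gamma> ` T"
    by (rule image_eqI[of _ _ 0]) (use v(2) in \<open>simp_all add: \<gamma>_def x01 T_def reflection_square\<close>)
  ultimately have "\<gamma> ` T \<subseteq> identity_component S" by (rule identity_component_maximal)
  moreover have "1 \<in> T" using u(2) by (simp add: T_def x01)
  ultimately have "\<gamma> 1 \<in> identity_component S" by blast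
  then show ?thesis by (simp add: \<gamma>_def x01)
qed

end

section \<open>The centralizer in a special orthogonal group\<close>

context orthogonal_space
begin

theorem centralizer_structure:
  assumes F: "subgroup F GL" "F \<subseteq> SO Q" "finite F"
    and irr: "irreducible_in (SO Q) (identity_component (centralizer (SO Q) F))"
    and char2: "CHAR('a) = 2 \<Longrightarrow> F \<noteq> {mat 1}"
  shows "CHAR('a) \<noteq> 2 \<and> elementary_abelian_2 F \<and>
    (\<exists>\<W>\<subseteq>weight_spaces F.
      internal_direct_product (identity_component (centralizer (SO Q) F)) (SO_on Q) \<W> \<and>
      (\<forall>W\<in>\<W>. nondegenerate_quadratic_on Q W \<and> vec.dim W \<ge> 3) \<and>
      ((\<Sum>W\<in>\<W>. vec.dim W) = CARD('n) \<or> (\<Sum>W\<in>\<W>. vec.dim W) = CARD('n) - 1))"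
proof -
  have char: "CHAR('a) \<noteq> 2" using char_two_trivial[OF _ F irr] char2 by blast
  have two: "(2::'a) \<noteq> 0" by (rule char_not_two[OF char])
  interpret odd: quadratic_space_odd Q by unfold_locales (rule two)
  have inv: "f ** f = mat 1" if "f \<in> F" for f
    using involution[OF F(1,2) irr that] odd.isotropic_singular by blast
  interpret involution_group b Q 1 "\<lambda>x a. a = - Q x" "SO Q" F
    by (intro involution_group.intro involution_group_axioms.intro odd.nondegenerate_space_axioms two F inv)
  let ?C = "identity_component (centralizer (SO Q) F)"
  note conn = connectedin_identity_component[of "centralizer (SO Q) F"]
  have subC: "subgroup ?C GL" by (rule subgroup_identity_component[OF subgroup_centralizer[OF subgroup_SO]])
  have C: "?C \<subseteq> centralizer (SO Q) F" "?C \<subseteq> SO Q" by (rule identity_component_subset, rule centralizer_component(1))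
  have one: "mat 1 \<in> ?C" by (rule subgroup_GL_one[OF subC])
  have stW: "g *v w \<in> W" if "W \<in> weight_spaces F" "g \<in> ?C" "w \<in> W" for W g w
    using stableD[OF stable_weight_space[OF that(1)] _ that(3)] C(1) that(2) by blast
  have CQ: "Q (g *v x) = Q x" "b (g *v x) (g *v y) = b x y" if "g \<in> ?C" for g x y
    using isometry that C(2) by blast+
  have no_line: "e = 0" if "Q e = 0" "\<And>g. g \<in> ?C \<Longrightarrow> \<exists>c. g *v e = c *s e" for e
  proof -
    have "vec.span {e} = {0}"
      by (rule totally_singular_trivial[OF F(1,2) irr totally_singular_line[OF that(1)]])
        (rule stable_line, rule that(2))
    then show ?thesis using vec.span_base[of e "{e}"] by blast
  qed
  have dim_pos: "vec.dim W \<noteq> 0" if "W \<in> weight_spaces F" for W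
  proof
    assume "vec.dim W = 0"
    then have "W = {0}" using vec.subspace_0[OF weight_subspace[OF that]] by (auto simp: vec.dim_eq_0)
    then show False using that by (simp add: weight_spaces_def)
  qed
  \<comment> \<open>A weight space of dimension 2 is a hyperbolic plane with exactly two singular
    lines. The connected component cannot exchange them, so it would fix one, against
    irreducibility.\<close>
  have dim_2: "vec.dim W \<noteq> 2" if W: "W \<in> weight_spaces F" for W
  proof
    assume dim: "vec.dim W = 2"
    note Ws = weight_subspace[OF W]
    obtain x where x: "x \<in> W" "x \<noteq> 0" using W vec.subspace_0[OF Ws] by (auto simp: weight_spaces_def)
    have "\<not> W \<subseteq> vec.span {x}"
      using vec.dim_subset[of W "vec.span {x}"] dim x(2) vec.dim_span[of "{x}"] by (auto simp: vec.dim_singleton)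
    then obtain y where y: "y \<in> W" "y \<notin> vec.span {x}" by blast
    obtain c d where cd: "c \<noteq> 0 \<or> d \<noteq> 0" "Q (c *s x + d *s y) = 0" using singular_combination by blast
    define e where "e = c *s x + d *s y"
    have e: "e \<in> W" "Q e = 0"
      using cd(2) x y by (auto simp: e_def vec.subspace_add[OF Ws] vec.subspace_scale[OF Ws])
    have "e \<noteq> 0"
    proof
      assume e0: "e = 0"
      show False
      proof (cases "d = 0")
        case True
        then show ?thesis using e0 cd(1) x(2) by (simp add: e_def)
      next
        case False
        have "d *s y = (- c) *s x" using e0 by (simp add: e_def eq_neg_iff_add_eq_0 add.commute)
        then have "d *s y \<in> vec.span {x}" by (simp only:) (intro vec.span_scale vec.span_base, simp)
        then show ?thesis using subspace_scale_cancel[OF vec.subspace_span _ False] y(2) by blast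
      qed
    qed
    then obtain z where "z \<in> W" "b e z \<noteq> 0" using weight_nondegenerate[OF W e(1)] by blast
    then obtain f where f: "f \<in> W" "Q f = 0" "b e f = 1"
      using hyperbolic_partner[OF e(2) _ _ e(1) Ws] by blast
    have ee: "b e e = 0" "b f f = 0" "b f e = 1" using e f polar_commute[of f e] by (auto simp: polar_self)
    have "f \<noteq> 0" using f(3) by (auto simp: bilin)
    moreover have "e \<notin> vec.span {f}" using f(3) ee by (auto simp: vec.span_singleton bilin)
    ultimately have ind: "vec.independent {e, f}" by (simp add: vec.independent_insert)
    have "e \<noteq> f" using ee f(3) by auto
    then have span: "W \<subseteq> vec.span {e, f}"
      using e f dim by (intro vec.card_ge_dim_independent ind) auto
    have "?C \<subseteq> {g. b (g *v e) e = 0}"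
    proof (rule connectedin_zariski_two[OF conn])
      show "zariski_closed {g. b (g *v e) e = 0}" "zariski_closed {g. b (g *v e) f = 0}"
        by (intro zariski_closed_zero poly_fun_functional linear_left)+
      have dec: "\<exists>k l. g *v e = k *s e + l *s f \<and> b (g *v e) e = l \<and> b (g *v e) f = k \<and> k * l = 0" if g: "g \<in> ?C" for g
      proof -
        have "g *v e \<in> vec.span (insert e {f})" using span stW[OF W g e(1)] by auto
        then obtain k where "g *v e - k *s e \<in> vec.span {f}" using vec.span_breakdown_eq by metis
        then obtain l where "g *v e - k *s e = l *s f" by (auto simp: vec.span_singleton)
        then have gl: "g *v e = k *s e + l *s f" by (simp add: algebra_simps)
        moreover have "Q (g *v e) = 0" using CQ(1)[OF g] e by simp
        then have "k * l = 0" using e f unfolding gl by (auto simp: Q_add Q_scale bilin)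
        ultimately show ?thesis using ee f(3) by (intro exI[of _ k] exI[of _ l]) (simp add: bilin)
      qed
      show "?C \<subseteq> {g. b (g *v e) e = 0} \<union> {g. b (g *v e) f = 0}"
      proof
        fix g assume "g \<in> ?C"
        then show "g \<in> {g. b (g *v e) e = 0} \<union> {g. b (g *v e) f = 0}" using dec[of g] by auto
      qed
      show "?C \<inter> {g. b (g *v e) e = 0} \<inter> {g. b (g *v e) f = 0} = {}"
      proof (rule ccontr)
        assume "\<not> ?thesis"
        then obtain g where g: "g \<in> ?C" "b (g *v e) e = 0" "b (g *v e) f = 0" by blast
        then have "g *v e = 0" using dec[of g] by auto
        then have "e = 0" using stable_cancel[OF subC, of "{0}" g e] g(1) by (simp add: stable_def)
        then show False using \<open>e \<noteq> 0\<close> by blast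
      qed
      show "?C \<inter> {g. b (g *v e) e = 0} \<noteq> {}" using one ee(1) by force
    qed
    then have "\<exists>c. g *v e = c *s e" if g: "g \<in> ?C" for g
    proof -
      have "g *v e \<in> vec.span (insert e {f})" using span stW[OF W g e(1)] by auto
      then obtain k where "g *v e - k *s e \<in> vec.span {f}" using vec.span_breakdown_eq by metis
      then obtain l where "g *v e - k *s e = l *s f" by (auto simp: vec.span_singleton)
      then have gl: "g *v e = k *s e + l *s f" by (simp add: algebra_simps)
      have "b (g *v e) e = 0" using g \<open>?C \<subseteq> {g. b (g *v e) e = 0}\<close> by blast
      then have "l = 0" using ee by (simp add: gl bilin)
      then show ?thesis using gl by auto
    qed
    then have "e = 0" using no_line[OF e(2)] by blast
    then show False using \<open>e \<noteq> 0\<close> by blast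
  qed
  have dim_1: "\<exists>w. W = vec.span {w} \<and> Q w \<noteq> 0 \<and> (\<forall>g\<in>?C. g *v w = w)"
    if W: "W \<in> weight_spaces F" and dim: "vec.dim W = 1" for W
  proof -
    note Ws = weight_subspace[OF W]
    obtain w where w: "w \<in> W" "w \<noteq> 0" using W vec.subspace_0[OF Ws] by (auto simp: weight_spaces_def)
    have "W \<subseteq> vec.span {w}" using w dim by (intro vec.card_ge_dim_independent) auto
    then have eq: "W = vec.span {w}" using vec.span_minimal[of "{w}" W] w(1) Ws by blast
    have Qw: "Q w \<noteq> 0"
    proof
      assume "Q w = 0"
      then have "b w x = 0" if "x \<in> W" for x using that by (auto simp: eq vec.span_singleton bilin polar_self)
      then show False using weight_nondegenerate[OF W w(1)] w(2) by blast
    qed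
    have pm: "g *v w = w \<or> g *v w = - w" if g: "g \<in> ?C" for g
    proof -
      obtain c where c: "g *v w = c *s w" using stW[OF W g w(1)] by (auto simp: eq vec.span_singleton)
      then have "c\<^sup>2 * Q w = Q w" using CQ(1)[OF g, of w] by (simp add: Q_scale)
      then have "c\<^sup>2 = 1" using Qw by simp
      then have "c = 1 \<or> c = -1" by (simp add: power2_eq_1_iff)
      then show ?thesis using c by auto
    qed
    \<comment> \<open>The sign by which the component acts on the line is constant, since the closed
      conditions for the two signs are disjoint when 2 is invertible.\<close>
    have "?C \<subseteq> {g. (g + (- mat 1)) *v w \<in> {0}}"
    proof (rule connectedin_zariski_two[OF conn])
      show "zariski_closed {g. (g + (- mat 1)) *v w \<in> {0}}" "zariski_closed {g. (g + mat 1) *v w \<in> {0}}"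
        by (rule zariski_closed_maps_to[OF vec.subspace_single_0 poly_map_add[OF poly_map_id poly_map_const]])+
      show "?C \<subseteq> {g. (g + (- mat 1)) *v w \<in> {0}} \<union> {g. (g + mat 1) *v w \<in> {0}}"
        using pm by (fastforce simp: matrix_vector_mult_add_rdistrib matrix_vector_mult_diff_rdistrib)
      show "?C \<inter> {g. (g + (- mat 1)) *v w \<in> {0}} \<inter> {g. (g + mat 1) *v w \<in> {0}} = {}"
      proof (rule ccontr)
        assume "\<not> ?thesis"
        then obtain g where "g *v w - w = 0" "g *v w + w = 0"
          by (auto simp: matrix_vector_mult_add_rdistrib matrix_vector_mult_diff_rdistrib)
        then have "2 *s w = 0" by (simp add: vec_eq_iff)
        then show False using w(2) two by (simp add: vec_eq_iff)
      qed
      show "?C \<inter> {g. (g + (- mat 1)) *v w \<in> {0}} \<noteq> {}" using one by force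
    qed
    then have "g *v w = w" if "g \<in> ?C" for g
      using that by (auto simp: matrix_vector_mult_diff_rdistrib)
    then show ?thesis using eq Qw by blast
  qed
  have dim_1_unique: "W1 = W2" if W: "W1 \<in> weight_spaces F" "vec.dim W1 = 1" "W2 \<in> weight_spaces F" "vec.dim W2 = 1" for W1 W2
  proof (rule ccontr)
    assume ne: "W1 \<noteq> W2"
    obtain w1 where w1: "W1 = vec.span {w1}" "Q w1 \<noteq> 0" "\<forall>g\<in>?C. g *v w1 = w1" using dim_1[OF W(1,2)] by blast
    obtain w2 where w2: "W2 = vec.span {w2}" "Q w2 \<noteq> 0" "\<forall>g\<in>?C. g *v w2 = w2" using dim_1[OF W(3,4)] by blast
    have orth: "b w1 w2 = 0" "b w2 w1 = 0"
      using weight_spaces_orthogonal[OF W(1,3) ne] weight_spaces_orthogonal[OF W(3,1) ne[symmetric]]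
        vec.span_base[of w1 "{w1}"] vec.span_base[of w2 "{w2}"] w1(1) w2(1) by auto
    \<comment> \<open>Chosen to make \<open>w1 + c *s w2\<close> singular; both vectors are fixed,
      so its line is fixed as well. Hence at most one weight space is a line, which is the origin of
      \<open>CARD('n) - 1\<close>.\<close>
    obtain c where c: "c\<^sup>2 = - (Q w1 / Q w2)" using square_root_exists by blast
    let ?e = "w1 + c *s w2"
    have "Q ?e = 0" using c w2(2) orth by (simp add: Q_add Q_scale bilin)
    moreover have "g *v ?e = 1 *s ?e" if "g \<in> ?C" for g
      using w1(3) w2(3) that by (simp add: matrix_vector_right_distrib vector_scalar_commute)
    ultimately have "?e = 0" using no_line by blast
    then have "b ?e w1 = 0" by (simp only: left.zero)
    then have "b w1 w1 = 0" using orth by (simp add: bilin)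
    then show False using w1(2) odd.isotropic_singular by blast
  qed
  \<comment> \<open>Dimensions 0 and 2 do not occur, so the threshold 3 leaves out exactly the
    lines.\<close>
  define \<W> where "\<W> = {W\<in>weight_spaces F. vec.dim W \<ge> 3}"
  have small: "vec.dim W = 1" if "W \<in> weight_spaces F - \<W>" for W
  proof -
    have W: "W \<in> weight_spaces F" "\<not> vec.dim W \<ge> 3" using that by (auto simp: \<W>_def)
    show ?thesis using dim_pos[OF W(1)] dim_2[OF W(1)] W(2) by linarith
  qed
  have on: "isometries_on = SO_on Q" by (simp add: fun_eq_iff isometries_on_def SO_on_def)
  have pairs: "reflection u ** reflection v \<in> centralizer (SO Q) F"
    if W: "W \<in> weight_spaces F" and uv: "u \<in> W" "v \<in> W" "Q u \<noteq> 0" "Q v \<noteq> 0" for W u v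
  proof -
    have "reflection u ** reflection v \<in> isometries_on W"
      unfolding isometries_on_iff odd.SO_iff
      using uv reflection_in_GO subgroup_GL_mult[OF subgroup_GO, of "reflection u" "reflection v"]
      by (auto simp: det_mul det_reflection reflection_fixes simp flip: matrix_vector_mul_assoc)
    then show ?thesis using isometries_on_centralize[OF W] by blast
  qed
  have idp: "internal_direct_product ?C isometries_on \<W>"
  proof (rule internal_direct_product_isometries_on)
    show "\<W> \<subseteq> weight_spaces F" by (auto simp: \<W>_def)
    show "isometries_on W \<subseteq> ?C" if "W \<in> \<W>" for W
    proof
      fix g assume g: "g \<in> isometries_on W"
      have W: "W \<in> weight_spaces F" using that by (simp add: \<W>_def)
      have gSO: "g \<in> GO Q" "det g = 1" "\<And>v. v \<in> perp W \<Longrightarrow> g *v v = v"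
        using g by (auto simp: isometries_on_iff odd.SO_iff)
      have "g \<in> ?C \<or> (\<exists>u\<in>W. Q u \<noteq> 0 \<and> reflection u ** g \<in> ?C)"
      proof (rule odd.reflections_generate[OF subC weight_splits[OF W] _ gSO(1,3)])
        fix u v assume uv: "u \<in> W" "v \<in> W" "Q u \<noteq> 0" "Q v \<noteq> 0"
        show "reflection u ** reflection v \<in> ?C"
          by (rule odd.reflection_pair_in_identity_component[OF pairs[OF W] weight_subspace[OF W]]) (use uv in auto)
      qed
      \<comment> \<open>The odd case of the generation result is excluded by the determinant, which
        is 1 both for \<open>g\<close> and on \<open>?C\<close>.\<close>
      moreover have False if u: "Q u \<noteq> 0" "reflection u ** g \<in> ?C" for u
      proof -
        have "det (reflection u ** g) = 1" using u(2) C(2) odd.SO_iff by blast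
        then have "(-1::'a) = 1" using u(1) gSO(2) by (simp add: det_mul det_reflection)
        then have "(2::'a) = 0" by (metis add.left_inverse one_add_one)
        then show False using two by blast
      qed
      ultimately show "g \<in> ?C" by blast
    qed
    show "g *v w = w" if g: "g \<in> ?C" and W: "W \<in> weight_spaces F - \<W>" and w: "w \<in> W" for g W w
    proof -
      obtain x where x: "W = vec.span {x}" "\<forall>g\<in>?C. g *v x = x"
        using dim_1[of W] small[OF W] W by blast
      then obtain k where "w = k *s x" using w by (auto simp: vec.span_singleton)
      then show ?thesis using x(2) g by (simp add: vector_scalar_commute)
    qed
    show "odd.restrict_to W g \<in> SO Q" if g: "g \<in> ?C" and "W \<in> \<W>" for g W
    proof -
      have W: "W \<in> weight_spaces F" using \<open>W \<in> \<W>\<close> by (simp add: \<W>_def)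
      have GO: "odd.restrict_to W h \<in> GO Q" if h: "h \<in> ?C" for h
        unfolding GO_iff
        using odd.restrict_to_isometry(2)[OF weight_splits[OF W] _ stW[OF W h]] C(2) h by blast
      have poly: "poly_fun (\<lambda>h. det (odd.restrict_to W h))" by (rule poly_fun_det[OF odd.poly_map_restrict_to])
      \<comment> \<open>The restriction is an isometry, so its determinant is 1 or -1; it is 1 at
        the identity, and connectedness carries this to the whole component.\<close>
      have "?C \<subseteq> {h. det (odd.restrict_to W h) - 1 = 0}"
      proof (rule connectedin_zariski_two[OF conn])
        show "zariski_closed {h. det (odd.restrict_to W h) - 1 = 0}" "zariski_closed {h. det (odd.restrict_to W h) + 1 = 0}"
          by (intro zariski_closed_zero poly_fun_diff poly_fun.add poly poly_fun.const)+
        show "?C \<subseteq> {h. det (odd.restrict_to W h) - 1 = 0} \<union> {h. det (odd.restrict_to W h) + 1 = 0}"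
          using odd.det_GO[OF GO] by force
        show "?C \<inter> {h. det (odd.restrict_to W h) - 1 = 0} \<inter> {h. det (odd.restrict_to W h) + 1 = 0} = {}"
          using two by auto
        have "odd.restrict_to W (mat 1) = mat 1" by (simp add: odd.restrict_to_def)
        then have "mat 1 \<in> {h. det (odd.restrict_to W h) - 1 = 0}" by simp
        then show "?C \<inter> {h. det (odd.restrict_to W h) - 1 = 0} \<noteq> {}" using one by blast
      qed
      then show ?thesis using g GO[OF g] unfolding odd.SO_iff by auto
    qed
  qed
  have nd: "nondegenerate_quadratic_on Q W \<and> vec.dim W \<ge> 3" if "W \<in> \<W>" for W
    using that weight_nondegenerate[of W] by (auto simp: \<W>_def nondegenerate_quadratic_on_def)
  have dims: "(\<Sum>W\<in>\<W>. vec.dim W) = CARD('n) \<or> (\<Sum>W\<in>\<W>. vec.dim W) = CARD('n) - 1"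
  proof -
    have "\<W> \<subseteq> weight_spaces F" by (auto simp: \<W>_def)
    then have sum: "CARD('n) = (\<Sum>W\<in>weight_spaces F - \<W>. vec.dim W) + (\<Sum>W\<in>\<W>. vec.dim W)"
      using sum.subset_diff[OF _ finite_weight_spaces, of \<W> vec.dim] sum_dim_weight_spaces by simp
    show ?thesis
    proof (cases "weight_spaces F - \<W> = {}")
      case True
      show ?thesis using sum unfolding True by simp
    next
      case False
      then obtain W where W: "W \<in> weight_spaces F - \<W>" by blast
      have "W' = W" if "W' \<in> weight_spaces F - \<W>" for W'
        using dim_1_unique[of W' W] small[OF that] small[OF W] that W by blast
      then have eq: "weight_spaces F - \<W> = {W}" using W by blast
      show ?thesis using sum small[OF W] unfolding eq by simp
    qed
  qed
  have sub: "\<W> \<subseteq> weight_spaces F" by (auto simp: \<W>_def)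
  have "\<W> \<subseteq> weight_spaces F \<and> internal_direct_product ?C (SO_on Q) \<W> \<and>
      (\<forall>W\<in>\<W>. nondegenerate_quadratic_on Q W \<and> vec.dim W \<ge> 3) \<and>
      ((\<Sum>W\<in>\<W>. vec.dim W) = CARD('n) \<or> (\<Sum>W\<in>\<W>. vec.dim W) = CARD('n) - 1)"
    using sub idp[unfolded on] nd dims by blast
  then show ?thesis using char elementary_abelian by blast
qed

end

section \<open>The three families together\<close>

theorem proposition3:
  fixes G F :: "('a::alg_closed_field ^ 'n::finite ^ 'n) set"
  assumes "classical_simple G"
    and "subgroup F GL" "F \<subseteq> G" "finite F"
    and "irreducible_in G (identity_component (centralizer G F))"
    and SL_noncentral: "G = SL \<Longrightarrow> \<not> F \<subseteq> centralizer G G"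
    and char2_nontrivial: "CHAR('a) = 2 \<Longrightarrow> F \<noteq> {mat 1}"
  shows "CHAR('a) \<noteq> 2 \<and> elementary_abelian_2 F \<and> G \<noteq> SL \<and>
    (\<forall>b. is_Sp b G \<longrightarrow>
       internal_direct_product (identity_component (centralizer G F)) (Sp_on b) (weight_spaces F) \<and>
       (\<forall>W\<in>weight_spaces F. nondegenerate_on b W \<and> even (vec.dim W)) \<and>
       2 * (\<Sum>W\<in>weight_spaces F. vec.dim W div 2) = CARD('n)) \<and>
    (\<forall>Q. is_SO Q G \<longrightarrow>
       (\<exists>\<W>\<subseteq>weight_spaces F.
          internal_direct_product (identity_component (centralizer G F)) (SO_on Q) \<W> \<and>
          (\<forall>W\<in>\<W>. nondegenerate_quadratic_on Q W \<and> vec.dim W \<ge> 3) \<and>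
          ((\<Sum>W\<in>\<W>. vec.dim W) = CARD('n) \<or> (\<Sum>W\<in>\<W>. vec.dim W) = CARD('n) - 1)))"
proof -
  have G: "G \<noteq> SL"
  proof
    assume SL: "G = SL"
    then have "F \<subseteq> centralizer UNIV SL" using irreducible_SL_noncentral assms(5) by blast
    then have "F \<subseteq> centralizer G G" using assms(3) SL by (auto simp: centralizer_def)
    then show False using SL_noncentral[OF SL] by blast
  qed
  have Sp: "CHAR('a) \<noteq> 2 \<and> elementary_abelian_2 F \<and>
       internal_direct_product (identity_component (centralizer G F)) (Sp_on b) (weight_spaces F) \<and>
       (\<forall>W\<in>weight_spaces F. nondegenerate_on b W \<and> even (vec.dim W)) \<and>
       2 * (\<Sum>W\<in>weight_spaces F. vec.dim W div 2) = CARD('n)" if "is_Sp b G" for b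
  proof -
    have b: "symplectic_form b" "G = Sp b" using that by (auto simp: is_Sp_def)
    interpret symplectic_space b by unfold_locales (rule b(1))
    show ?thesis
      unfolding b(2)
      by (rule centralizer_structure) (use assms b(2) in auto)
  qed
  have SO: "CHAR('a) \<noteq> 2 \<and> elementary_abelian_2 F \<and>
       (\<exists>\<W>\<subseteq>weight_spaces F.
          internal_direct_product (identity_component (centralizer G F)) (SO_on Q) \<W> \<and>
          (\<forall>W\<in>\<W>. nondegenerate_quadratic_on Q W \<and> vec.dim W \<ge> 3) \<and>
          ((\<Sum>W\<in>\<W>. vec.dim W) = CARD('n) \<or> (\<Sum>W\<in>\<W>. vec.dim W) = CARD('n) - 1))"
    if "is_SO Q G" for Q
  proof -
    have Q: "nondegenerate_quadratic_form Q" "G = SO Q" "CARD('n) \<ge> 3" using that by (auto simp: is_SO_def)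
    interpret orthogonal_space Q by unfold_locales (rule Q(1), rule Q(3))
    show ?thesis
      unfolding Q(2)
      by (rule centralizer_structure) (use assms Q(2) in auto)
  qed
  have "(\<exists>b. is_Sp b G) \<or> (\<exists>Q. is_SO Q G)"
    using assms(1) G by (auto simp: classical_simple_def is_SL_def)
  then have "CHAR('a) \<noteq> 2 \<and> elementary_abelian_2 F" using Sp SO by blast
  then show ?thesis using G Sp SO by blast
qed

end
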